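(* Let $\alpha>0$, let $w\in A^{\mathrm{restricted}}_{\infty}$, and let $g(z)=az+b$ for some $a,b\in\mathbb{C}$. Then the Volterra operator $J_g$ belongs to $\mathcal{S}_p(F^2_{\alpha,w})$ for all $p>2$, but it fails to be Hilbert--Schmidt on $F^2_{\alpha,w}$ unless $a=0$.
   Context: A weight is a non-negative locally integrable function $w$ on $\mathbb{C}$; $dA$ (and $A(\cdot)$) is Lebesgue measure on $\mathbb{C}$. Squares $Q\subset\mathbb{C}$ have sides parallel to the axes, with side length $\ell(Q)$. For $1<q<\infty$ with $1/q+1/q'=1$, $w\in A_q^{\mathrm{restricted}}$ if for some (equivalently any) fixed $r>0$, $\sup_{\ell(Q)=r}\big(\frac1{A(Q)}\int_Q w\,dA\big)\big(\frac1{A(Q)}\int_Q w^{-q'/q}dA\big)^{q/q'}<\infty$; $w\in A_1^{\mathrm{restricted}}$ if for some (equivalently any) fixed $r>0$, $\sup_{\ell(Q)=r}\big(\frac1{A(Q)}\int_Q w\,dA\big)\|w^{-1}\|_{L^\infty(Q)}<\infty$ (in particular both factors are finite, so $w>0$ a.e.). Set $A_\infty^{\mathrm{restricted}}:=\bigcup_{1\le q<\infty}A_q^{\mathrm{restricted}}$. $F^2_{\alpha,w}$ is the Hilbert space of entire functions $f$ with $\|f\|^2_{F^2_{\alpha,w}}=\int_{\mathbb{C}}|f(z)|^2e^{-\alpha|z|^2}w(z)\,dA(z)<\infty$. For an entire function $g$, the Volterra operator is $J_gf(z):=\int_0^zf(\xi)g'(\xi)\,d\xi$ for entire $f$. A compact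 operator $T$ on a separable Hilbert space $H$ with singular values $\{s_n(T)\}$ is in the Schatten class $\mathcal{S}_p(H)$ if $\sum_n s_n(T)^p<\infty$; Hilbert--Schmidt means $\mathcal{S}_2$. *)

theory Defs
  imports
    "HOL-Complex_Analysis.Complex_Analysis"
    "HOL-Probability.Essential_Supremum"
    "HOL-Library.Function_Algebras"
begin

section \<open>Restricted Muckenhoupt weights\<close>

definition weight :: "(complex \<Rightarrow> real) \<Rightarrow> bool" where
  "weight w \<longleftrightarrow>
     (\<forall>z. 0 \<le> w z) \<and> w \<in> borel_measurable lebesgue \<and>
     (\<forall>K. compact K \<longrightarrow> set_integrable lebesgue K w)"

definition squares :: "real \<Rightarrow> complex set set" where
  "squares r = {cbox c (c + Complex r r) | c. True}"

definition average :: "complex set \<Rightarrow> (complex \<Rightarrow> real) \<Rightarrow> real" where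
  "average Q h = set_lebesgue_integral lebesgue Q h / measure lebesgue Q"

definition conj_exponent :: "real \<Rightarrow> real" where
  "conj_exponent q = q / (q - 1)"

text \<open>
  In HOL, \<open>0 powr s = 0\<close> and \<open>inverse 0 = 0\<close>, whereas a weight vanishing on a set of
  positive measure has to be excluded.  Both definitions therefore state explicitly that the
  weight is positive almost everywhere, which in the usual reading is implied by the
  finiteness of the two factors; likewise for integrability of \<open>w powr (- q' / q)\<close>, since the
  integral of a non-integrable function is \<open>0\<close> in HOL.
\<close>

definition Aq_restricted :: "real \<Rightarrow> (complex \<Rightarrow> real) set" where
  "Aq_restricted q = {w. weight w \<and> (AE z in lebesgue. 0 < w z) \<and>
     (\<exists>r>0.
        (\<forall>Q\<in>squares r. set_integrable lebesgue Q (\<lambda>z. w z powr (- conj_exponent q / q))) \<and>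
        bdd_above ((\<lambda>Q. average Q w *
            average Q (\<lambda>z. w z powr (- conj_exponent q / q)) powr (q / conj_exponent q))
          ` squares r))}"

definition A1_restricted :: "(complex \<Rightarrow> real) set" where
  "A1_restricted = {w. weight w \<and> (AE z in lebesgue. 0 < w z) \<and>
     (\<exists>r>0. (SUP Q\<in>squares r. ereal (average Q w) *
               esssup (restrict_space lebesgue Q) (\<lambda>z. ereal (inverse (w z)))) < \<infinity>)}"

definition A_infinity_restricted :: "(complex \<Rightarrow> real) set" where
  "A_infinity_restricted = A1_restricted \<union> (\<Union>q\<in>{1<..}. Aq_restricted q)"


section \<open>Schatten classes\<close>

text \<open>
  A Hilbert space of functions is given by its carrier \<open>V\<close> and its inner product \<open>ip\<close>, which is
  linear in the first argument; addition of functions is pointwise.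
\<close>

type_synonym cfun = "complex \<Rightarrow> complex"

definition cscale :: "complex \<Rightarrow> cfun \<Rightarrow> cfun" where
  "cscale c f = (\<lambda>z. c * f z)"

interpretation cfun: vector_space cscale
  by unfold_locales (auto simp: cscale_def fun_eq_iff algebra_simps)

definition ip_norm :: "(cfun \<Rightarrow> cfun \<Rightarrow> complex) \<Rightarrow> cfun \<Rightarrow> real" where
  "ip_norm ip f = sqrt (Re (ip f f))"

definition linear_operator :: "cfun set \<Rightarrow> (cfun \<Rightarrow> cfun) \<Rightarrow> bool" where
  "linear_operator V T \<longleftrightarrow>
     (\<forall>f\<in>V. T f \<in> V) \<and>
     (\<forall>f\<in>V. \<forall>g\<in>V. T (f + g) = T f + T g) \<and>
     (\<forall>c. \<forall>f\<in>V. T (cscale c f) = cscale c (T f))"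

definition compact_operator ::
  "cfun set \<Rightarrow> (cfun \<Rightarrow> cfun \<Rightarrow> complex) \<Rightarrow> (cfun \<Rightarrow> cfun) \<Rightarrow> bool" where
  "compact_operator V ip T \<longleftrightarrow> linear_operator V T \<and>
     (\<forall>f :: nat \<Rightarrow> cfun. (\<forall>n. f n \<in> V) \<and> bounded (range (\<lambda>n. ip_norm ip (f n))) \<longrightarrow>
        (\<exists>r. \<exists>g\<in>V. strict_mono r \<and> (\<lambda>n. ip_norm ip (T (f (r n)) - g)) \<longlonglongrightarrow> 0))"

text \<open>The graph of the adjoint \<open>T\<^sup>*\<close>: it consists of the pairs \<open>(g, h)\<close> with \<open>h = T\<^sup>* g\<close>.\<close>

definition adjoint_graph ::
  "cfun set \<Rightarrow> (cfun \<Rightarrow> cfun \<Rightarrow> complex) \<Rightarrow> (cfun \<Rightarrow> cfun) \<Rightarrow> (cfun \<times> cfun) set" where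
  "adjoint_graph V ip T = {(g, h). g \<in> V \<and> h \<in> V \<and> (\<forall>u\<in>V. ip (T u) g = ip u h)}"

text \<open>The singular values of \<open>T\<close> are the square roots of the eigenvalues of \<open>T\<^sup>* T\<close>.  The
  following is the eigenspace \<open>{f \<in> V. T\<^sup>* (T f) = \<sigma>\<^sup>2 f}\<close>.\<close>

definition singular_space ::
  "cfun set \<Rightarrow> (cfun \<Rightarrow> cfun \<Rightarrow> complex) \<Rightarrow> (cfun \<Rightarrow> cfun) \<Rightarrow> real \<Rightarrow> cfun set" where
  "singular_space V ip T \<sigma> =
     {f \<in> V. (T f, cscale (complex_of_real (\<sigma>\<^sup>2)) f) \<in> adjoint_graph V ip T}"

text \<open>The number of singular values \<open>\<ge> \<sigma>\<close>, counted with multiplicity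
  (finite if \<open>T\<close> is compact and \<open>\<sigma> > 0\<close>).\<close>

definition singular_count ::
  "cfun set \<Rightarrow> (cfun \<Rightarrow> cfun \<Rightarrow> complex) \<Rightarrow> (cfun \<Rightarrow> cfun) \<Rightarrow> real \<Rightarrow> nat" where
  "singular_count V ip T \<sigma> =
     (\<Sum>\<tau> | \<sigma> \<le> \<tau> \<and> singular_space V ip T \<tau> \<noteq> {0}. cfun.dim (singular_space V ip T \<tau>))"

text \<open>The non-increasing enumeration, starting at \<open>n = 0\<close>, of the singular values with
  multiplicity, padded with zeros if there are only finitely many positive ones: the \<open>n\<close>-th one
  is the largest \<open>\<sigma>\<close> such that more than \<open>n\<close> singular values are \<open>\<ge> \<sigma>\<close>.
  Meaningful for compact \<open>T\<close> only.\<close>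

definition singular_value ::
  "cfun set \<Rightarrow> (cfun \<Rightarrow> cfun \<Rightarrow> complex) \<Rightarrow> (cfun \<Rightarrow> cfun) \<Rightarrow> nat \<Rightarrow> real" where
  "singular_value V ip T n = Sup ({0} \<union> {\<sigma>. 0 < \<sigma> \<and> n < singular_count V ip T \<sigma>})"

definition schatten_class ::
  "real \<Rightarrow> cfun set \<Rightarrow> (cfun \<Rightarrow> cfun \<Rightarrow> complex) \<Rightarrow> (cfun \<Rightarrow> cfun) set" where
  "schatten_class p V ip =
     {T. compact_operator V ip T \<and> summable (\<lambda>n. singular_value V ip T n powr p)}"

definition hilbert_schmidt ::
  "cfun set \<Rightarrow> (cfun \<Rightarrow> cfun \<Rightarrow> complex) \<Rightarrow> (cfun \<Rightarrow> cfun) \<Rightarrow> bool" where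
  "hilbert_schmidt V ip T \<longleftrightarrow> T \<in> schatten_class 2 V ip"


section \<open>Weighted Fock spaces and Volterra operators\<close>

definition fock_space :: "real \<Rightarrow> (complex \<Rightarrow> real) \<Rightarrow> cfun set" where
  "fock_space \<alpha> w = {f. f holomorphic_on UNIV \<and>
     integrable lebesgue (\<lambda>z. (cmod (f z))\<^sup>2 * exp (- \<alpha> * (cmod z)\<^sup>2) * w z)}"

definition fock_inner :: "real \<Rightarrow> (complex \<Rightarrow> real) \<Rightarrow> cfun \<Rightarrow> cfun \<Rightarrow> complex" where
  "fock_inner \<alpha> w f g =
     (LINT z|lebesgue. f z * cnj (g z) * complex_of_real (exp (- \<alpha> * (cmod z)\<^sup>2) * w z))"

definition volterra :: "cfun \<Rightarrow> cfun \<Rightarrow> cfun" where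
  "volterra g f = (\<lambda>z. contour_integral (linepath 0 z) (\<lambda>\<xi>. f \<xi> * deriv g \<xi>))"

end

theory Submission
  imports Defs
begin

text \<open>
  A restricted weight satisfies \<open>\<nu>(Q) (|E| / |Q|)\<^sup>k \<le> C \<nu>(E)\<close> for \<open>E \<subseteq> Q\<close> and squares \<open>Q\<close> of one fixed size,
  where \<open>\<nu> = w dA\<close>.  Hence \<open>\<nu>\<close> is doubling at unit scale, and \<open>|f|\<^sup>2 e\<^bsup>-\<alpha>|z|\<^sup>2\<^esup> \<nu>(Q\<^sub>z)\<close> is controlled by
  the local norm of \<open>f\<close>.  Integrating along rays against the Gaussian yields the Littlewood--Paley
  inequality \<open>\<parallel>\<integral>f\<parallel>\<^sup>2 \<le> K \<integral> |f|\<^sup>2 (1 + |z|)\<^sup>-\<^sup>2\<close> with respect to \<open>e\<^bsup>-\<alpha>|z|\<^sup>2\<^esup> d\<nu>\<close>.  Summed over orthonormal vectors, whose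
  squared moduli are dominated by the reproducing kernel, this bounds the number of singular values
  \<open>\<ge> \<sigma>\<close> by a multiple of \<open>\<sigma>\<^sup>-\<^sup>p \<integral> (1 + |z|)\<^sup>-\<^sup>p dA\<close>, which is finite for \<open>p > 2\<close>.  Conversely, the normalized exponentials
  \<open>e\<^bsup>\<alpha> cnj c u\<^esup>\<close> with \<open>c\<close> in a lattice form a Bessel family, and \<open>J\<close> maps them to functions of
  squared norm \<open>\<ge> const / |c|\<^sup>2\<close>, which is not summable over the lattice.
\<close>

section \<open>Singular values of compact operators on a space of functions\<close>

text \<open>Singular values are defined through eigenspaces of \<open>T\<^sup>* T\<close>, where the
  dimension of an infinite-dimensional space and a sum over an infinite set are both 0 by
  convention. This makes the two halves unequal. For upper bounds the conventions are harmless: the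
  count is always the size of some orthonormal system, so \<open>count_bound\<close>, which mentions
  no eigenvectors, suffices. For the Hilbert-Schmidt half the count must be bounded from below, so
  eigenvectors have to be produced and the degenerate conventions excluded;
  \<open>count_bound\<close> with an exponent above 2 does the excluding. \<open>count_bound\<close>
  is a weak-type condition and yields summability only for strictly larger exponents. Nothing is
  lost, because the range of p is open. The obstacle on the analytic side is that w lies in some
  class with an arbitrary index, so a small set E may carry as little as the k-th power of its share
  of the area, with k large. The ordinary mean value property of holomorphic functions with respect
  to area does not survive this. The local estimate therefore looks for a square on which the
  function is large, whose possible smallness is paid for by the size of the function there.\<close>

definition orthonormal :: "(cfun \<Rightarrow> cfun \<Rightarrow> complex) \<Rightarrow> cfun set \<Rightarrow> bool" where
  "orthonormal ip S \<longleftrightarrow> (\<forall>e\<in>S. \<forall>e'\<in>S. ip e e' = (if e = e' then 1 else 0))"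

lemma orthonormal_insert:
  assumes "orthonormal ip S" "ip f f = 1" "\<And>e. e \<in> S \<Longrightarrow> ip f e = 0" "\<And>e. e \<in> S \<Longrightarrow> ip e f = 0"
  shows "orthonormal ip (insert f S)"
  using assms unfolding orthonormal_def by auto

lemma orthonormal_subset: "orthonormal ip S \<Longrightarrow> S' \<subseteq> S \<Longrightarrow> orthonormal ip S'"
  unfolding orthonormal_def by blast

text \<open>Semidefiniteness is the right generality: besides the inner product, the defect form of
  \<open>maximizer\<close> is an instance, and that form degenerates exactly at the vector
  sought.\<close>

locale psd_form =
  fixes V :: "cfun set" and Q :: "cfun \<Rightarrow> cfun \<Rightarrow> complex"
  assumes subspace: "cfun.subspace V"
    and add_left: "f \<in> V \<Longrightarrow> g \<in> V \<Longrightarrow> h \<in> V \<Longrightarrow> Q (f + g) h = Q f h + Q g h"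
    and scale_left: "f \<in> V \<Longrightarrow> g \<in> V \<Longrightarrow> Q (cscale c f) g = c * Q f g"
    and hermitian: "f \<in> V \<Longrightarrow> g \<in> V \<Longrightarrow> Q g f = cnj (Q f g)"
    and nonneg: "f \<in> V \<Longrightarrow> 0 \<le> Re (Q f f)"
begin

definition q :: "cfun \<Rightarrow> real" where "q f = Re (Q f f)"

lemma zero_in [simp, intro]: "0 \<in> V"
  and add_in [intro]: "f \<in> V \<Longrightarrow> g \<in> V \<Longrightarrow> f + g \<in> V"
  and diff_in [intro]: "f \<in> V \<Longrightarrow> g \<in> V \<Longrightarrow> f - g \<in> V"
  and scale_in [intro]: "f \<in> V \<Longrightarrow> cscale c f \<in> V"
  and sum_in: "(\<And>i. i \<in> I \<Longrightarrow> F i \<in> V) \<Longrightarrow> sum F I \<in> V"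
  using subspace cfun.subspace_0 cfun.subspace_add cfun.subspace_diff cfun.subspace_scale
    cfun.subspace_sum[of V I F] by auto

lemma diff_conv: "f - g = f + cscale (-1) g"
  by (auto simp: cscale_def fun_eq_iff)

lemma add_right: "f \<in> V \<Longrightarrow> g \<in> V \<Longrightarrow> h \<in> V \<Longrightarrow> Q h (f + g) = Q h f + Q h g"
  by (metis add_in add_left complex_cnj_add hermitian)

lemma scale_right: "f \<in> V \<Longrightarrow> g \<in> V \<Longrightarrow> Q g (cscale c f) = cnj c * Q g f"
  by (metis scale_in scale_left complex_cnj_mult hermitian)

lemma diff_left: "f \<in> V \<Longrightarrow> g \<in> V \<Longrightarrow> h \<in> V \<Longrightarrow> Q (f - g) h = Q f h - Q g h"
  unfolding diff_conv using scale_in[of g] by (simp add: add_left scale_left del: cfun.scale_minus_left)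

lemma diff_right: "f \<in> V \<Longrightarrow> g \<in> V \<Longrightarrow> h \<in> V \<Longrightarrow> Q h (f - g) = Q h f - Q h g"
  unfolding diff_conv using scale_in[of g] by (simp add: add_right scale_right del: cfun.scale_minus_left)

lemma zero_left [simp]: "f \<in> V \<Longrightarrow> Q 0 f = 0"
  using scale_left[of 0 f 0] by simp

lemma zero_right [simp]: "f \<in> V \<Longrightarrow> Q f 0 = 0"
  using hermitian[of 0 f] by auto

lemma sum_left:
  "(\<And>i. i \<in> I \<Longrightarrow> F i \<in> V) \<Longrightarrow> h \<in> V \<Longrightarrow> Q (sum F I) h = (\<Sum>i\<in>I. Q (F i) h)"
  by (induction I rule: infinite_finite_induct) (auto simp: add_left sum_in)

lemma sum_right:
  "(\<And>i. i \<in> I \<Longrightarrow> F i \<in> V) \<Longrightarrow> h \<in> V \<Longrightarrow> Q h (sum F I) = (\<Sum>i\<in>I. Q h (F i))"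
  by (induction I rule: infinite_finite_induct) (auto simp: add_right sum_in)

lemma self_eq: "f \<in> V \<Longrightarrow> Q f f = complex_of_real (q f)"
  using hermitian[of f f] by (auto simp: q_def complex_eq_iff)

lemma q_nonneg: "f \<in> V \<Longrightarrow> 0 \<le> q f"
  using nonneg by (simp add: q_def)

lemma q_zero [simp]: "q 0 = 0"
  by (simp add: q_def)

lemma q_scale: "f \<in> V \<Longrightarrow> q (cscale c f) = (cmod c)\<^sup>2 * q f"
  using self_eq[of f] cmod_power2[of c]
  by (simp add: q_def[of "cscale c f"] scale_left scale_right scale_in power2_eq_square algebra_simps
      flip: distrib_right)

lemma q_diff:
  assumes "f \<in> V" "g \<in> V"
  shows "q (f - g) = q f - 2 * Re (Q f g) + q g"
  using hermitian[OF assms] assms by (simp add: q_def diff_left diff_right diff_in)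

lemma q_add:
  assumes "f \<in> V" "g \<in> V"
  shows "q (f + g) = q f + 2 * Re (Q f g) + q g"
  using hermitian[OF assms] assms by (simp add: q_def add_left add_right add_in)

lemma q_diff_le: "f \<in> V \<Longrightarrow> g \<in> V \<Longrightarrow> q (f - g) \<le> 2 * q f + 2 * q g"
  using q_nonneg[OF add_in, of f g] by (simp add: q_add q_diff)

lemma q_add_le: "f \<in> V \<Longrightarrow> g \<in> V \<Longrightarrow> q (f + g) \<le> 2 * q f + 2 * q g"
  using q_nonneg[OF diff_in, of f g] by (simp add: q_add q_diff)

lemma Cauchy_Schwarz:
  assumes f: "f \<in> V" and g: "g \<in> V"
  shows "(cmod (Q f g))\<^sup>2 \<le> q f * q g"
proof -
  define c where "c = Q f g"
  have key: "0 \<le> q f - 2 * t * (cmod c)\<^sup>2 + t\<^sup>2 * (cmod c)\<^sup>2 * q g" for t :: real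
  proof -
    have "0 \<le> q (f - cscale (of_real t * c) g)"
      using f g by (intro q_nonneg) auto
    also have "\<dots> = q f - 2 * t * (cmod c)\<^sup>2 + t\<^sup>2 * (cmod c)\<^sup>2 * q g"
    proof -
      have "Re (Q f (cscale (of_real t * c) g)) = t * (cmod c)\<^sup>2"
        using f g by (simp add: scale_right c_def[symmetric] cmod_power2 algebra_simps flip: power2_eq_square)
      then show ?thesis
        using f g by (simp add: q_diff scale_in q_scale norm_mult power_mult_distrib)
    qed
    finally show ?thesis .
  qed
  show ?thesis
  proof (cases "q g = 0")
    case True
    have "c = 0"
    proof (rule ccontr)
      assume "c \<noteq> 0"
      then have pos: "(cmod c)\<^sup>2 > 0" by simp
      \<comment> \<open>For \<open>q g = 0\<close> the bound \<open>key\<close> is affine in t; this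
        t makes its right-hand side equal to -1.\<close>
      have "2 * ((q f + 1) / (2 * (cmod c)\<^sup>2)) * (cmod c)\<^sup>2 = q f + 1"
        using pos by (simp add: field_simps)
      then show False using key[of "(q f + 1) / (2 * (cmod c)\<^sup>2)"] True by simp
    qed
    then show ?thesis using True by (simp add: c_def)
  next
    case False
    then have pos: "q g > 0" using q_nonneg[OF g] by simp
    then have "q f - 2 * (1 / q g) * (cmod c)\<^sup>2 + (1 / q g)\<^sup>2 * (cmod c)\<^sup>2 * q g = q f - (cmod c)\<^sup>2 / q g"
      by (simp add: field_simps power2_eq_square)
    then have "0 \<le> q f - (cmod c)\<^sup>2 / q g" using key[of "1 / q g"] by linarith
    with pos show ?thesis
      by (simp add: c_def field_simps)
  qed
qed

lemma orthonormal_sum_left: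
  assumes "finite S" "S \<subseteq> V" "orthonormal Q S" "e \<in> S"
  shows "Q (\<Sum>e'\<in>S. cscale (c e') e') e = c e"
proof -
  have "Q (\<Sum>e'\<in>S. cscale (c e') e') e = (\<Sum>e'\<in>S. c e' * Q e' e)"
    using assms by (subst sum_left) (auto intro!: sum.cong scale_left)
  also have "\<dots> = (\<Sum>e'\<in>S. if e' = e then c e else 0)"
    using assms by (intro sum.cong) (auto simp: orthonormal_def)
  finally show ?thesis using assms by simp
qed

lemma orthonormal_independent:
  assumes "S \<subseteq> V" "orthonormal Q S"
  shows "\<not> cfun.dependent S"
proof
  assume "cfun.dependent S"
  then obtain t u v where *: "finite t" "t \<subseteq> S" "(\<Sum>v\<in>t. cscale (u v) v) = 0" "v \<in> t" "u v \<noteq> 0"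
    unfolding cfun.dependent_explicit by blast
  have "Q (\<Sum>e'\<in>t. cscale (u e') e') v = u v"
    using * assms by (intro orthonormal_sum_left) (auto intro: orthonormal_subset)
  then show False using * assms by auto
qed

lemma sub_form: "cfun.subspace W \<Longrightarrow> W \<subseteq> V \<Longrightarrow> psd_form W Q"
  by unfold_locales (auto dest: subsetD intro: add_left scale_left hermitian nonneg)

lemma span_in: "S \<subseteq> V \<Longrightarrow> cfun.span S \<subseteq> V"
  by (simp add: subspace cfun.span_minimal)

end

locale inner_form = psd_form V ip for V :: "cfun set" and ip +
  assumes definite: "f \<in> V \<Longrightarrow> Re (ip f f) = 0 \<Longrightarrow> f = 0"
begin

lemma q_pos: "f \<in> V \<Longrightarrow> f \<noteq> 0 \<Longrightarrow> 0 < q f"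
  using q_nonneg[of f] definite[of f] by (auto simp: q_def less_le)

lemma ip_norm_eq: "ip_norm ip f = sqrt (q f)"
  by (simp add: ip_norm_def q_def)

lemma normalise:
  assumes "f \<in> V" "f \<noteq> 0"
  obtains c where "c \<noteq> 0" "ip (cscale c f) (cscale c f) = 1"
proof
  let ?c = "of_real (1 / sqrt (q f)) :: complex"
  have pos: "q f > 0" using assms by (rule q_pos)
  then show "?c \<noteq> 0" by simp
  show "ip (cscale ?c f) (cscale ?c f) = 1"
    using pos assms by (simp add: self_eq scale_in q_scale norm_divide power_divide)
qed

text \<open>Gram-Schmidt: the projection \<open>p\<close> of the new vector onto the span built so
  far is subtracted, and independence keeps the remainder nonzero.\<close>

lemma orthonormal_basis:
  assumes "finite B" "B \<subseteq> V" "\<not> cfun.dependent B"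
  obtains S where "finite S" "card S = card B" "orthonormal ip S" "cfun.span S = cfun.span B"
    "S \<subseteq> V"
  using assms
proof (induction B arbitrary: thesis rule: finite_induct)
  case empty
  then show ?case by (auto simp: orthonormal_def)
next
  case (insert b B)
  have indB: "\<not> cfun.dependent B" using insert.prems(3) cfun.dependent_mono by blast
  obtain S where S: "finite S" "card S = card B" "orthonormal ip S" "cfun.span S = cfun.span B"
    "S \<subseteq> V"
    using insert.IH[OF _ _ indB] insert.prems by auto
  have bV: "b \<in> V" using insert.prems by auto
  define p where "p = (\<Sum>e\<in>S. cscale (ip b e) e)"
  have pspan: "p \<in> cfun.span S"
    unfolding p_def by (intro cfun.span_sum cfun.span_scale cfun.span_base)
  have pV: "p \<in> V" using pspan S span_in by blast
  have bnot: "b \<notin> cfun.span B"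
    using insert.prems(3) insert.hyps(2) by (simp add: cfun.independent_insert)
  have ne: "b - p \<noteq> 0" using bnot pspan S(4) by auto
  obtain c where c: "c \<noteq> 0" "ip (cscale c (b - p)) (cscale c (b - p)) = 1"
    using normalise[of "b - p"] ne bV pV by blast
  define e0 where "e0 = cscale c (b - p)"
  have e0V: "e0 \<in> V" using bV pV unfolding e0_def by blast
  have orth: "ip e0 e = 0" if "e \<in> S" for e
  proof -
    have "ip p e = ip b e" unfolding p_def using S that by (intro orthonormal_sum_left)
    then show ?thesis using that S bV pV
      by (auto simp: e0_def scale_left diff_in diff_left subset_iff)
  qed
  then have orth': "ip e e0 = 0" if "e \<in> S" for e
    using that hermitian[of e0 e] e0V S by auto
  have "e0 \<notin> S" using orth[of e0] c by (auto simp: e0_def)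
  have span: "cfun.span (insert e0 S) = cfun.span (insert b B)"
  proof (intro subset_antisym cfun.span_minimal cfun.subspace_span)
    have pB: "p \<in> cfun.span (insert b B)" using pspan S(4) cfun.span_mono[of B "insert b B"] by auto
    have "e0 \<in> cfun.span (insert b B)"
      unfolding e0_def by (intro cfun.span_scale cfun.span_diff pB cfun.span_base) auto
    moreover have "S \<subseteq> cfun.span (insert b B)"
      using cfun.span_superset[of S] S(4) cfun.span_mono[of B "insert b B"] by auto
    ultimately show "insert e0 S \<subseteq> cfun.span (insert b B)" by auto
    have "b = cscale (inverse c) e0 + p"
      using c(1) unfolding e0_def by (auto simp: cscale_def fun_eq_iff field_simps)
    moreover have "p \<in> cfun.span (insert e0 S)" using pspan cfun.span_mono[of S "insert e0 S"] by auto
    ultimately have "b \<in> cfun.span (insert e0 S)"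
      by (metis cfun.span_add cfun.span_base cfun.span_scale insertI1)
    moreover have "B \<subseteq> cfun.span (insert e0 S)"
      using cfun.span_superset[of B] S(4) cfun.span_mono[of S "insert e0 S"] by auto
    ultimately show "insert b B \<subseteq> cfun.span (insert e0 S)" by auto
  qed
  show ?case
  proof (rule insert.prems(1)[of "insert e0 S"])
    show "orthonormal ip (insert e0 S)"
      using S orth orth' c by (intro orthonormal_insert) (auto simp: e0_def)
  qed (use S span e0V insert.hyps \<open>e0 \<notin> S\<close> in auto)
qed

end

text \<open>A weak form of membership in \<open>S\<^sub>p\<close> that does not mention eigenvectors.\<close>

definition count_bound ::
  "cfun set \<Rightarrow> (cfun \<Rightarrow> cfun \<Rightarrow> complex) \<Rightarrow> (cfun \<Rightarrow> cfun) \<Rightarrow> real \<Rightarrow> real \<Rightarrow> bool" where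
  "count_bound V ip T p C \<longleftrightarrow> (\<forall>\<sigma>>0. \<forall>S. finite S \<longrightarrow> S \<subseteq> V \<longrightarrow> orthonormal ip S \<longrightarrow>
     (\<forall>e\<in>S. \<sigma>\<^sup>2 \<le> Re (ip (T e) (T e))) \<longrightarrow> card S * \<sigma> powr p \<le> C)"

section \<open>Counting singular values by orthonormal systems of eigenvectors\<close>

locale operator_form = inner_form V ip for V :: "cfun set" and ip +
  fixes T :: "cfun \<Rightarrow> cfun"
  assumes linear: "linear_operator V T"
begin

abbreviation E :: "real \<Rightarrow> cfun set" where "E \<equiv> singular_space V ip T"
abbreviation N :: "real \<Rightarrow> nat" where "N \<equiv> singular_count V ip T"
abbreviation s :: "nat \<Rightarrow> real" where "s \<equiv> singular_value V ip T"

lemma T_in [intro]: "f \<in> V \<Longrightarrow> T f \<in> V"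
  and T_add: "f \<in> V \<Longrightarrow> g \<in> V \<Longrightarrow> T (f + g) = T f + T g"
  and T_scale: "f \<in> V \<Longrightarrow> T (cscale c f) = cscale c (T f)"
  using linear by (auto simp: linear_operator_def)

lemma T_zero [simp]: "T 0 = 0"
  using T_scale[of 0 0] by simp

lemma T_diff: "f \<in> V \<Longrightarrow> g \<in> V \<Longrightarrow> T (f - g) = T f - T g"
  unfolding diff_conv using scale_in[of g] by (simp add: T_add T_scale del: cfun.scale_minus_left)

lemma T_sum: "(\<And>i. i \<in> I \<Longrightarrow> F i \<in> V) \<Longrightarrow> T (sum F I) = (\<Sum>i\<in>I. T (F i))"
  by (induction I rule: infinite_finite_induct) (auto simp: T_add sum_in)

lemma E_iff: "f \<in> E \<tau> \<longleftrightarrow> f \<in> V \<and> (\<forall>u\<in>V. ip (T u) (T f) = of_real (\<tau>\<^sup>2) * ip u f)"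
  unfolding singular_space_def adjoint_graph_def by (auto simp: scale_right)

lemma E_in: "f \<in> E \<tau> \<Longrightarrow> f \<in> V"
  by (simp add: E_iff)

lemma E_subspace: "cfun.subspace (E \<tau>)"
  unfolding cfun.subspace_def
  by (auto simp: E_iff T_add T_scale add_right scale_right T_in algebra_simps)

lemma q_T_eigen: "f \<in> E \<tau> \<Longrightarrow> q (T f) = \<tau>\<^sup>2 * q f"
  using E_iff[of f \<tau>] by (auto simp: q_def)

text \<open>Evaluating \<open>ip (T f) (T g)\<close> through either eigenvector identity gives two
  different multiples of \<open>ip f g\<close>. Positivity is needed because the parameters enter
  only through their squares.\<close>

lemma E_orthogonal:
  assumes f: "f \<in> E \<tau>" and g: "g \<in> E \<tau>'" and "\<tau> > 0" "\<tau>' > 0" "\<tau> \<noteq> \<tau>'"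
  shows "ip f g = 0"
proof -
  have V: "f \<in> V" "g \<in> V" using f g E_in by auto
  have "of_real (\<tau>'\<^sup>2) * ip f g = ip (T f) (T g)" using g V by (simp add: E_iff)
  also have "\<dots> = cnj (ip (T g) (T f))" using V by (intro hermitian T_in)
  also have "\<dots> = of_real (\<tau>\<^sup>2) * ip f g" using f V hermitian[of f g] by (auto simp: E_iff)
  finally have "(of_real (\<tau>'\<^sup>2) - of_real (\<tau>\<^sup>2)) * ip f g = 0" by (simp add: algebra_simps)
  moreover have "\<tau>'\<^sup>2 \<noteq> \<tau>\<^sup>2" using assms by (simp add: power2_eq_iff)
  ultimately show ?thesis
    by (metis mult_eq_0_iff of_real_eq_iff right_minus_eq)
qed

lemma orthonormal_Union_eigen:
  assumes fin: "finite A" and pos: "\<And>\<tau>. \<tau> \<in> A \<Longrightarrow> \<tau> > 0"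
    and on: "\<And>\<tau>. \<tau> \<in> A \<Longrightarrow> finite (B \<tau>) \<and> orthonormal ip (B \<tau>) \<and> B \<tau> \<subseteq> E \<tau>"
  shows "orthonormal ip (\<Union>(B ` A))" "card (\<Union>(B ` A)) = (\<Sum>\<tau>\<in>A. card (B \<tau>))"
proof -
  have orth: "ip e e' = 0" if "\<tau> \<in> A" "\<tau>' \<in> A" "\<tau> \<noteq> \<tau>'" "e \<in> B \<tau>" "e' \<in> B \<tau>'" for \<tau> \<tau>' e e'
    using that on pos by (intro E_orthogonal[of e \<tau> e' \<tau>']) blast+
  have one: "ip e e = 1" if "\<tau> \<in> A" "e \<in> B \<tau>" for \<tau> e
    using on[OF that(1)] that(2) by (auto simp: orthonormal_def)
  show "orthonormal ip (\<Union>(B ` A))"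
    unfolding orthonormal_def
  proof (intro ballI)
    fix e e' assume "e \<in> \<Union>(B ` A)" "e' \<in> \<Union>(B ` A)"
    then obtain \<tau> \<tau>' where *: "\<tau> \<in> A" "e \<in> B \<tau>" "\<tau>' \<in> A" "e' \<in> B \<tau>'" by blast
    show "ip e e' = (if e = e' then 1 else 0)"
    proof (cases "\<tau> = \<tau>'")
      case True
      then show ?thesis using on[OF *(1)] * unfolding orthonormal_def by auto
    next
      case False
      then show ?thesis using orth[of \<tau> \<tau>' e e'] * one[of \<tau> e] by (cases "e = e'") auto
    qed
  qed
  have disj: "B \<tau> \<inter> B \<tau>' = {}" if "\<tau> \<in> A" "\<tau>' \<in> A" "\<tau> \<noteq> \<tau>'" for \<tau> \<tau>'
  proof (rule ccontr)
    assume "B \<tau> \<inter> B \<tau>' \<noteq> {}"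
    then obtain e where "e \<in> B \<tau>" "e \<in> B \<tau>'" by auto
    then show False using orth[OF that] one[OF that(1)] by fastforce
  qed
  show "card (\<Union>(B ` A)) = (\<Sum>\<tau>\<in>A. card (B \<tau>))"
    by (rule card_UN_disjoint) (use fin on disj in auto)
qed

lemma eigenspace_orthonormal:
  obtains S where "finite S" "orthonormal ip S" "S \<subseteq> E \<tau>" "card S = cfun.dim (E \<tau>)"
proof -
  obtain B where B: "B \<subseteq> E \<tau>" "\<not> cfun.dependent B" "E \<tau> \<subseteq> cfun.span B"
      "card B = cfun.dim (E \<tau>)"
    using cfun.basis_exists by blast
  show ?thesis
  proof (cases "finite B")
    case True
    have "B \<subseteq> V" using B(1) E_in by blast
    then obtain S where S: "finite S" "card S = card B" "orthonormal ip S" "cfun.span S = cfun.span B"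
      using orthonormal_basis[OF True _ B(2)] by metis
    have "cfun.span B \<subseteq> E \<tau>" using B(1) E_subspace by (simp add: cfun.span_minimal)
    then have "S \<subseteq> E \<tau>" using S cfun.span_superset[of S] by auto
    then show ?thesis using that S B by simp
  next
    \<comment> \<open>\<open>dim\<close> is the cardinality of a basis, hence 0 here, and the empty
      system has the right size.\<close>
    case False
    then have "cfun.dim (E \<tau>) = 0" using B(4) by simp
    then show ?thesis using that[of "{}"] by (simp add: orthonormal_def)
  qed
qed

text \<open>Orthonormal systems of the separate eigenspaces are mutually orthogonal and can be
  united. No finiteness is assumed: if there are infinitely many eigenspaces, the sum defining the
  count is 0 and the empty system realizes it.\<close>

lemma singular_count_orthonormal:
  assumes "\<sigma> > 0"
  obtains S where "finite S" "S \<subseteq> V" "orthonormal ip S" "card S = N \<sigma>" "\<And>e. e \<in> S \<Longrightarrow> \<sigma>\<^sup>2 \<le> q (T e)"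
proof (cases "finite {\<tau>. \<sigma> \<le> \<tau> \<and> E \<tau> \<noteq> {0}}")
  case True
  define A where "A = {\<tau>. \<sigma> \<le> \<tau> \<and> E \<tau> \<noteq> {0}}"
  have "\<exists>S. finite S \<and> orthonormal ip S \<and> S \<subseteq> E \<tau> \<and> card S = cfun.dim (E \<tau>)" for \<tau>
    using eigenspace_orthonormal by metis
  then obtain B where B: "\<And>\<tau>. finite (B \<tau>) \<and> orthonormal ip (B \<tau>) \<and> B \<tau> \<subseteq> E \<tau> \<and> card (B \<tau>) = cfun.dim (E \<tau>)"
    by metis
  show ?thesis
  proof (rule that[of "\<Union>(B ` A)"])
    show "finite (\<Union>(B ` A))" using True B by (auto simp: A_def)
    show "\<Union>(B ` A) \<subseteq> V" using B E_in by fastforce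
    show "orthonormal ip (\<Union>(B ` A))"
      using True B assms by (intro orthonormal_Union_eigen(1)) (auto simp: A_def)
    have "card (\<Union>(B ` A)) = (\<Sum>\<tau>\<in>A. card (B \<tau>))"
      using True B assms by (intro orthonormal_Union_eigen(2)) (auto simp: A_def)
    then show "card (\<Union>(B ` A)) = N \<sigma>" using B by (simp add: singular_count_def A_def)
    fix e assume "e \<in> \<Union>(B ` A)"
    then obtain \<tau> where \<tau>: "\<tau> \<in> A" "e \<in> B \<tau>" by auto
    have "ip e e = 1" using B[of \<tau>] \<tau>(2) by (auto simp: orthonormal_def)
    then have "q e = 1" by (simp add: q_def)
    moreover have "e \<in> E \<tau>" using B[of \<tau>] \<tau> by auto
    ultimately have "q (T e) = \<tau>\<^sup>2" by (simp add: q_T_eigen)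
    then show "\<sigma>\<^sup>2 \<le> q (T e)" using \<tau> assms by (auto simp: A_def intro!: power_mono)
  qed
next
  case False
  then have "N \<sigma> = 0" by (simp add: singular_count_def)
  then show ?thesis using that[of "{}"] by (simp add: orthonormal_def)
qed

lemma count_boundD:
  assumes "count_bound V ip T p C" "\<sigma> > 0" "finite S" "S \<subseteq> V" "orthonormal ip S"
    "\<And>e. e \<in> S \<Longrightarrow> \<sigma>\<^sup>2 \<le> q (T e)"
  shows "card S * \<sigma> powr p \<le> C"
  using assms unfolding count_bound_def q_def by blast

lemma singular_count_bound:
  assumes "count_bound V ip T p C" "\<sigma> > 0"
  shows "N \<sigma> * \<sigma> powr p \<le> C"
  using singular_count_orthonormal[OF assms(2)] count_boundD[OF assms] by metis

text \<open>The enumeration starts at 0, so \<open>n < N \<sigma>\<close> supplies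
  \<open>n + 1\<close> orthonormal vectors for the count bound.\<close>

lemma singular_value_bound:
  assumes cb: "count_bound V ip T p C" and p: "p > 0" and \<sigma>: "\<sigma> > 0" "n < N \<sigma>"
  shows "\<sigma> \<le> (C / (n + 1)) powr (1 / p)"
proof -
  have "(n + 1) * \<sigma> powr p \<le> N \<sigma> * \<sigma> powr p"
    using \<sigma> by (intro mult_right_mono) (auto simp del: of_nat_Suc)
  then have "\<sigma> powr p \<le> C / (n + 1)"
    using singular_count_bound[OF cb \<sigma>(1)] by (simp add: field_simps)
  then have "(\<sigma> powr p) powr (1 / p) \<le> (C / (n + 1)) powr (1 / p)"
    using p by (intro powr_mono2) auto
  then show ?thesis using \<sigma> p by (simp add: powr_powr)
qed

text \<open>Needed to give the supremum in \<open>singular_value\<close> a meaning; for an unbounded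
  set it would be an unspecified real number.\<close>

lemma singular_value_bdd:
  assumes "count_bound V ip T p C" "p > 0"
  shows "bdd_above ({0} \<union> {\<sigma>. 0 < \<sigma> \<and> n < N \<sigma>})"
  using singular_value_bound[OF assms] by (intro bdd_aboveI[of _ "(C / (n + 1)) powr (1 / p)"]) auto

lemma singular_value_nonneg:
  assumes "count_bound V ip T p C" "p > 0"
  shows "0 \<le> s n"
  unfolding singular_value_def by (rule cSup_upper[OF _ singular_value_bdd[OF assms]]) auto

lemma singular_value_ge:
  assumes "count_bound V ip T p C" "p > 0" "0 < \<sigma>" "n < N \<sigma>"
  shows "\<sigma> \<le> s n"
  unfolding singular_value_def by (rule cSup_upper[OF _ singular_value_bdd[OF assms(1,2)]]) (use assms in auto)

lemma singular_value_le:
  assumes "count_bound V ip T p C" "p > 0"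
  shows "s n \<le> (C / (n + 1)) powr (1 / p)"
  unfolding singular_value_def
  by (rule cSup_least) (use singular_value_bound[OF assms] in auto)

text \<open>The n-th singular value is of order at most n to the power -1/p'. Its p-th power is then
  dominated by a series with exponent p/p' > 1, which is where the gap between the exponents is
  used.\<close>

lemma summable_singular_values:
  assumes cb: "count_bound V ip T p' C" and p: "0 < p'" "p' < p"
  shows "summable (\<lambda>n. s n powr p)"
proof -
  have "C \<ge> 0" using count_boundD[OF cb, of 1 "{}"] by (simp add: orthonormal_def)
  have "summable (\<lambda>n. real (Suc n) powr - (p / p'))"
    using p by (subst summable_Suc_iff) (simp add: summable_real_powr_iff)
  then have "summable (\<lambda>n. C powr (p / p') * real (Suc n) powr - (p / p'))"
    by (rule summable_mult)
  then show ?thesis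
  proof (rule summable_comparison_test')
    fix n :: nat
    have "s n powr p \<le> ((C / (n + 1)) powr (1 / p')) powr p"
      using singular_value_le[OF cb p(1), of n] singular_value_nonneg[OF cb p(1)] p
      by (intro powr_mono2) auto
    also have "\<dots> = C powr (p / p') * real (Suc n) powr - (p / p')"
      using \<open>C \<ge> 0\<close> by (simp add: powr_powr powr_divide powr_minus_divide add.commute)
    finally show "norm (s n powr p) \<le> C powr (p / p') * real (Suc n) powr - (p / p')" by simp
  qed
qed

text \<open>Infinitely many parameters would provide arbitrarily many orthonormal eigenvectors, one
  per eigenspace. The finiteness keeps the sum in \<open>singular_count\<close> from collapsing to 0
  when the count is bounded from below.\<close>

lemma finite_singular_values:
  assumes cb: "count_bound V ip T p C" and \<sigma>: "\<sigma> > 0"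
  shows "finite {\<tau>. \<sigma> \<le> \<tau> \<and> E \<tau> \<noteq> {0}}"
proof (rule ccontr)
  assume inf: "infinite {\<tau>. \<sigma> \<le> \<tau> \<and> E \<tau> \<noteq> {0}}"
  \<comment> \<open>Any number exceeding the largest cardinality that the count bound
    permits.\<close>
  define n where "n = nat \<lceil>C / \<sigma> powr p\<rceil> + 1"
  obtain A where A: "finite A" "card A = n" "A \<subseteq> {\<tau>. \<sigma> \<le> \<tau> \<and> E \<tau> \<noteq> {0}}"
    using infinite_arbitrarily_large[OF inf] by blast
  have "\<exists>e\<in>E \<tau>. ip e e = 1" if "\<tau> \<in> A" for \<tau>
  proof -
    have "E \<tau> \<noteq> {0}" using A(3) that by blast
    then obtain f where f: "f \<in> E \<tau>" "f \<noteq> 0"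
      using cfun.subspace_0[OF E_subspace, of \<tau>] by blast
    obtain c where "ip (cscale c f) (cscale c f) = 1"
      using normalise[OF E_in[OF f(1)] f(2)] by blast
    then show ?thesis using f(1) E_subspace cfun.subspace_scale by blast
  qed
  then obtain u where u: "\<And>\<tau>. \<tau> \<in> A \<Longrightarrow> u \<tau> \<in> E \<tau> \<and> ip (u \<tau>) (u \<tau>) = 1"
    by metis
  have pos: "\<tau> > 0" if "\<tau> \<in> A" for \<tau> using A(3) that \<sigma> by auto
  have U: "(\<Union>\<tau>\<in>A. {u \<tau>}) = u ` A" by auto
  have "orthonormal ip (u ` A)" "card (u ` A) = n"
    using orthonormal_Union_eigen[of A "\<lambda>\<tau>. {u \<tau>}"] A(1,2) u pos unfolding U
    by (auto simp: orthonormal_def)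
  moreover have "\<sigma>\<^sup>2 \<le> q (T e)" if e: "e \<in> u ` A" for e
  proof -
    obtain \<tau> where \<tau>: "\<tau> \<in> A" "e = u \<tau>" using e by blast
    then have "q (T e) = \<tau>\<^sup>2" using u[OF \<tau>(1)] q_T_eigen[of e \<tau>] by (simp add: q_def)
    then show ?thesis using \<sigma> A(3) \<tau> by (auto intro!: power_mono)
  qed
  ultimately have "n * \<sigma> powr p \<le> C"
    using count_boundD[OF cb \<sigma>, of "u ` A"] A(1) u E_in by auto
  then have "n \<le> C / \<sigma> powr p" using \<sigma> by (simp add: field_simps)
  then show False unfolding n_def by linarith
qed

text \<open>The danger is an infinite-dimensional eigenspace, whose \<open>dim\<close> would be 0.
  Gram-Schmidt applied to large finite parts of an infinite basis would violate the count
  bound.\<close>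

lemma card_eigen_le_dim:
  assumes cb: "count_bound V ip T p C" and \<tau>: "\<tau> > 0"
    and S: "finite S" "S \<subseteq> E \<tau>" "orthonormal ip S"
  shows "card S \<le> cfun.dim (E \<tau>)"
proof -
  obtain B where B: "B \<subseteq> E \<tau>" "\<not> cfun.dependent B" "E \<tau> \<subseteq> cfun.span B" "card B = cfun.dim (E \<tau>)"
    using cfun.basis_exists by blast
  have "finite B"
  proof (rule ccontr)
    assume inf: "infinite B"
    define n where "n = nat \<lceil>C / \<tau> powr p\<rceil> + 1"
    obtain B' where B': "finite B'" "card B' = n" "B' \<subseteq> B"
      using infinite_arbitrarily_large[OF inf] by blast
    have ind: "\<not> cfun.dependent B'" using B' B(2) cfun.dependent_mono by blast
    have BE: "B' \<subseteq> E \<tau>" using B' B(1) by blast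
    have "B' \<subseteq> V" using BE E_in by blast
    then obtain S where S: "finite S" "card S = card B'" "orthonormal ip S" "cfun.span S = cfun.span B'" "S \<subseteq> V"
      using orthonormal_basis[OF B'(1) _ ind] by metis
    have "cfun.span B' \<subseteq> E \<tau>" using BE E_subspace by (simp add: cfun.span_minimal)
    then have SE: "S \<subseteq> E \<tau>" using S(4) cfun.span_superset[of S] by auto
    have "\<tau>\<^sup>2 \<le> q (T e)" if "e \<in> S" for e
      using that SE S(3) q_T_eigen[of e \<tau>] by (auto simp: orthonormal_def q_def)
    then have "n * \<tau> powr p \<le> C"
      using count_boundD[OF cb \<tau> S(1) S(5) S(3)] S(2) B'(2) by auto
    then have "n \<le> C / \<tau> powr p" using \<tau> by (simp add: field_simps)
    then show False unfolding n_def by linarith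
  qed
  moreover have "S \<subseteq> V" using S(2) E_in by blast
  moreover have "S \<subseteq> cfun.span B" using S(2) B(3) by blast
  ultimately show ?thesis
    using cfun.independent_span_bound[of B S] orthonormal_independent[of S] S(3) B(4) by auto
qed

text \<open>The lower bound for the count, obtained by sorting the vectors according to their
  eigenspace.\<close>

lemma card_le_singular_count:
  assumes cb: "count_bound V ip T p C" and \<sigma>: "\<sigma> > 0"
    and S: "finite S" "orthonormal ip S" and t: "\<And>e. e \<in> S \<Longrightarrow> \<sigma> \<le> t e \<and> e \<in> E (t e)"
  shows "card S \<le> N \<sigma>"
proof -
  let ?A = "{\<tau>. \<sigma> \<le> \<tau> \<and> E \<tau> \<noteq> {0}}"
  have fin: "finite ?A" by (rule finite_singular_values[OF cb \<sigma>])
  have ne: "e \<noteq> 0" if "e \<in> S" for e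
    using S(2) that zero_left[of 0] unfolding orthonormal_def by (metis zero_in zero_neq_one)
  have "t ` S \<subseteq> ?A" using t ne by blast
  then have "card S = (\<Sum>\<tau>\<in>?A. card {e\<in>S. t e = \<tau>})"
    using S(1) fin sum.group[of S ?A t "\<lambda>_. 1::nat"] by simp
  also have "\<dots> \<le> (\<Sum>\<tau>\<in>?A. cfun.dim (E \<tau>))"
  proof (rule sum_mono)
    fix \<tau> assume "\<tau> \<in> ?A"
    then have "\<tau> > 0" using \<sigma> by auto
    then show "card {e\<in>S. t e = \<tau>} \<le> cfun.dim (E \<tau>)"
      using S t orthonormal_subset[OF S(2)] by (intro card_eigen_le_dim[OF cb]) auto
  qed
  finally show ?thesis by (simp add: singular_count_def)
qed

text \<open>Induction that removes the vector with the smallest parameter. All k + 1 vectors have at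
  least this parameter, so the count there exceeds k and the parameter is at most
  \<open>s k\<close>; the others are covered by the earlier singular values.\<close>

lemma sum_eigen_le:
  assumes cb: "count_bound V ip T p C" and p: "p > 0"
    and S: "finite S" "orthonormal ip S" and t: "\<And>e. e \<in> S \<Longrightarrow> 0 < t e \<and> e \<in> E (t e)"
  shows "(\<Sum>e\<in>S. (t e)\<^sup>2) \<le> (\<Sum>n<card S. (s n)\<^sup>2)"
  using S t
proof (induction "card S" arbitrary: S)
  case 0
  then show ?case by auto
next
  case (Suc k)
  have ne: "S \<noteq> {}" using Suc.hyps(2) by auto
  obtain e where e: "e \<in> S" "\<And>e'. e' \<in> S \<Longrightarrow> t e \<le> t e'"
    using ex_min_if_finite[of "t ` S"] Suc.prems(1) ne
    by (metis (no_types, lifting) finite_imageI imageE image_eqI image_is_empty linorder_not_less)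
  have IH: "(\<Sum>e\<in>S - {e}. (t e)\<^sup>2) \<le> (\<Sum>n<card (S - {e}). (s n)\<^sup>2)"
    using Suc.prems Suc.hyps(2) e(1) orthonormal_subset[OF Suc.prems(2)]
    by (intro Suc.hyps(1)) auto
  have ck: "card (S - {e}) = k" using Suc.hyps(2) Suc.prems(1) e(1) by simp
  have "card S \<le> N (t e)"
    using Suc.prems e by (intro card_le_singular_count[OF cb, of "t e" S t]) auto
  then have "t e \<le> s k"
    using Suc.hyps(2) Suc.prems(3)[OF e(1)] by (intro singular_value_ge[OF cb p]) auto
  then have "(t e)\<^sup>2 \<le> (s k)\<^sup>2" using Suc.prems(3)[OF e(1)] by (intro power_mono) auto
  moreover have "(\<Sum>e\<in>S. (t e)\<^sup>2) = (t e)\<^sup>2 + (\<Sum>e\<in>S - {e}. (t e)\<^sup>2)"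
    using Suc.prems(1) e(1) by (rule sum.remove)
  ultimately show ?case using IH unfolding ck by (simp flip: Suc.hyps(2))
qed

end

section \<open>Existence of eigenvectors and splitting of a compact operator\<close>

locale compact_form = operator_form V ip T for V ip T +
  fixes p C :: real
  assumes compact: "compact_operator V ip T"
    and complete: "\<And>f :: nat \<Rightarrow> cfun. (\<And>n. f n \<in> V) \<Longrightarrow>
      (\<And>\<epsilon>. \<epsilon> > 0 \<Longrightarrow> \<exists>N. \<forall>m\<ge>N. \<forall>n\<ge>N. Re (ip (f m - f n) (f m - f n)) < \<epsilon>) \<Longrightarrow>
      \<exists>g\<in>V. (\<lambda>n. Re (ip (f n - g) (f n - g))) \<longlonglongrightarrow> 0"
    and cb: "count_bound V ip T p C"
    and p_pos: "p > 0"
begin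

text \<open>The count bound, applied to a single normalized vector with \<sigma> the norm of its
  image, already limits that norm. The added 1 only makes the constant positive.\<close>

lemma T_bounded: obtains K where "K > 0" "\<And>f. f \<in> V \<Longrightarrow> q (T f) \<le> K * q f"
proof
  define K where "K = (max C 0 powr (1 / p))\<^sup>2 + 1"
  show "K > 0" unfolding K_def by (simp add: add_nonneg_pos)
  fix f assume f: "f \<in> V"
  show "q (T f) \<le> K * q f"
  proof (cases "f = 0 \<or> q (T f) = 0")
    case True
    then show ?thesis using f q_nonneg[of f] \<open>K > 0\<close> by auto
  next
    case False
    obtain c where c: "c \<noteq> 0" "ip (cscale c f) (cscale c f) = 1"
      using normalise[OF f] False by blast
    define e where "e = cscale c f"
    define \<sigma> where "\<sigma> = sqrt (q (T e))"
    have eV: "e \<in> V" unfolding e_def using f by blast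
    have qe: "(cmod c)\<^sup>2 * q f = 1" using c(2) q_scale[OF f, of c] by (simp add: q_def)
    have qTe: "q (T e) = (cmod c)\<^sup>2 * q (T f)"
      using q_scale[OF T_in[OF f]] T_scale[OF f] by (simp add: e_def)
    have "q (T e) > 0" using qTe c(1) False q_nonneg[OF T_in[OF f]] by simp
    then have \<sigma>: "\<sigma> > 0" "\<sigma>\<^sup>2 = q (T e)" by (auto simp: \<sigma>_def)
    have "card {e} * \<sigma> powr p \<le> C"
      by (rule count_boundD[OF cb \<sigma>(1)]) (use eV c \<sigma> in \<open>auto simp: orthonormal_def e_def\<close>)
    then have "\<sigma> powr p \<le> max C 0" by simp
    then have "(\<sigma> powr p) powr (1 / p) \<le> max C 0 powr (1 / p)"
      using p_pos by (intro powr_mono2) auto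
    then have "\<sigma> \<le> max C 0 powr (1 / p)" using p_pos \<sigma> by (simp add: powr_powr)
    then have "\<sigma>\<^sup>2 \<le> (max C 0 powr (1 / p))\<^sup>2" using \<sigma> by (intro power_mono) auto
    then have "(cmod c)\<^sup>2 * q (T f) \<le> K * ((cmod c)\<^sup>2 * q f)" using \<sigma>(2) qTe qe by (simp add: K_def)
    then show ?thesis using c(1) by (simp add: mult.left_commute)
  qed
qed

lemma compact_subsequence:
  assumes "\<And>n. f n \<in> V" "\<And>n. q (f n) \<le> 1"
  obtains r g where "strict_mono (r :: nat \<Rightarrow> nat)" "g \<in> V" "(\<lambda>n. q (T (f (r n)) - g)) \<longlonglongrightarrow> 0"
proof -
  have "bounded (range (\<lambda>n. ip_norm ip (f n)))"
    unfolding bounded_iff using assms by (intro exI[of _ 1]) (auto simp: ip_norm_eq q_nonneg)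
  then obtain r g where rg: "g \<in> V" "strict_mono (r :: nat \<Rightarrow> nat)" "(\<lambda>n. ip_norm ip (T (f (r n)) - g)) \<longlonglongrightarrow> 0"
    using compact assms(1) unfolding compact_operator_def by blast
  have "(\<lambda>n. (ip_norm ip (T (f (r n)) - g))\<^sup>2) \<longlonglongrightarrow> 0"
    using tendsto_power[OF rg(3), of 2] by simp
  moreover have "(ip_norm ip (T (f (r n)) - g))\<^sup>2 = q (T (f (r n)) - g)" for n
    unfolding ip_norm_eq using assms rg(1) by (intro real_sqrt_pow2 q_nonneg) auto
  ultimately show ?thesis using that rg by simp
qed

text \<open>The quadratic form \<open>M\<^sup>2 \<parallel>f\<parallel>\<^sup>2 - \<parallel>T f\<parallel>\<^sup>2\<close> is positive on a subspace on which \<open>T\<close> has norm \<open>M\<close>.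
  Together with compactness this makes every maximizing sequence (sub)converge, and the
  Cauchy--Schwarz inequality of the form turns a maximizer into an eigenvector.\<close>

lemma maximizer:
  assumes W: "cfun.subspace W" "W \<subseteq> V"
    and closed: "\<And>f g. (\<And>n. f n \<in> W) \<Longrightarrow> g \<in> V \<Longrightarrow> (\<lambda>n. q (f n - g)) \<longlonglongrightarrow> 0 \<Longrightarrow> g \<in> W"
    and f0: "f0 \<in> W" "q (T f0) > \<sigma>\<^sup>2 * q f0" and \<sigma>: "\<sigma> > 0"
  obtains f M where "f \<in> W" "f \<noteq> 0" "M > \<sigma>" "\<And>u. u \<in> W \<Longrightarrow> ip (T u) (T f) = of_real (M\<^sup>2) * ip u f"
proof -
  obtain K where K: "K > 0" "\<And>f. f \<in> V \<Longrightarrow> q (T f) \<le> K * q f"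
    using T_bounded by blast
  define X where "X = {q (T f) | f. f \<in> W \<and> q f \<le> 1}"
  have WV: "f \<in> V" if "f \<in> W" for f using that W by blast
  have X_bdd: "bdd_above X"
  proof (rule bdd_aboveI)
    fix x assume "x \<in> X"
    then obtain f where "x = q (T f)" "f \<in> W" "q f \<le> 1" by (auto simp: X_def)
    moreover have "K * q f \<le> K" using K(1) \<open>q f \<le> 1\<close> mult_left_le[of "q f" K] by simp
    ultimately show "x \<le> K" using K(2)[of f] WV by fastforce
  qed
  have "0 \<in> W" using W(1) cfun.subspace_0 by blast
  then have "0 \<in> X" unfolding X_def by (auto intro!: exI[of _ "0::cfun"])
  define S where "S = Sup X"
  have SX: "x \<le> S" if "x \<in> X" for x unfolding S_def using X_bdd that by (simp add: cSup_upper)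
  have main: "q (T f) \<le> S * q f" if f: "f \<in> W" for f
  proof (cases "f = 0")
    case False
    obtain c where c: "c \<noteq> 0" "ip (cscale c f) (cscale c f) = 1"
      using normalise[OF WV[OF f] False] by blast
    have qc: "(cmod c)\<^sup>2 * q f = 1" using c(2) q_scale[OF WV[OF f], of c] by (simp add: q_def)
    have cW: "cscale c f \<in> W" using f W(1) cfun.subspace_scale by blast
    have "q (T (cscale c f)) \<le> S"
      using cW c by (intro SX) (auto simp: X_def q_def intro!: exI[of _ "cscale c f"])
    then have "(cmod c)\<^sup>2 * q (T f) \<le> S * ((cmod c)\<^sup>2 * q f)"
      using q_scale[OF T_in[OF WV[OF f]]] T_scale[OF WV[OF f]] qc by simp
    then show ?thesis using c(1) by (simp add: mult.left_commute)
  qed simp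
  have f0V: "f0 \<in> V" using f0 WV by blast
  have "\<sigma>\<^sup>2 * q f0 < S * q f0" using main[OF f0(1)] f0(2) by linarith
  \<comment> \<open>The vector \<open>f0\<close> beats \<sigma>, hence so does the supremum; this
    yields \<open>M > \<sigma>\<close> for \<open>M = sqrt S\<close>.\<close>
  then have S\<sigma>: "\<sigma>\<^sup>2 < S" using q_nonneg[OF f0V] mult_less_cancel_right[of "\<sigma>\<^sup>2" "q f0" S] by auto
  then have S_pos: "S > 0" using zero_le_power2[of \<sigma>] by linarith
  define Q where "Q = (\<lambda>f g. of_real S * ip f g - ip (T f) (T g))"
  interpret W: psd_form W ip using W by (rule sub_form)
  interpret D: psd_form W Q
  proof
    show "cfun.subspace W" by fact
    fix f g h assume "f \<in> W" "g \<in> W" "h \<in> W"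
    then have V: "f \<in> V" "g \<in> V" "h \<in> V" using WV by auto
    show "Q (f + g) h = Q f h + Q g h"
      using V by (simp add: Q_def add_left T_add T_in algebra_simps)
  next
    fix f g c assume "f \<in> W" "g \<in> W"
    then have V: "f \<in> V" "g \<in> V" using WV by auto
    show "Q (cscale c f) g = c * Q f g"
      using V by (simp add: Q_def scale_left T_scale T_in algebra_simps)
    show "Q g f = cnj (Q f g)"
      using hermitian[OF V] hermitian[OF T_in[OF V(1)] T_in[OF V(2)]] by (simp add: Q_def)
  next
    fix f assume "f \<in> W"
    then show "0 \<le> Re (Q f f)" using main[of f] by (simp add: Q_def q_def)
  qed
  have Dq: "D.q f = S * q f - q (T f)" for f unfolding D.q_def q_def by (simp add: Q_def)
  have "\<exists>f. f \<in> W \<and> q f \<le> 1 \<and> S - 1 / (n + 1) < q (T f)" for n :: nat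
  proof -
    have "S - 1 / (n + 1) < Sup X" by (simp add: S_def)
    then obtain x where "x \<in> X" "S - 1 / (n + 1) < x"
      using less_cSup_iff[OF _ X_bdd] \<open>0 \<in> X\<close> by blast
    then show ?thesis by (auto simp: X_def)
  qed
  then obtain F where F: "\<And>n::nat. F n \<in> W" "\<And>n. q (F n) \<le> 1" "\<And>n::nat. S - 1 / (n + 1) < q (T (F n))"
    by metis
  have FV: "F n \<in> V" for n using F WV by blast
  obtain r g where r: "strict_mono (r :: nat \<Rightarrow> nat)" and g: "g \<in> V" "(\<lambda>n. q (T (F (r n)) - g)) \<longlonglongrightarrow> 0"
    using compact_subsequence[of F, OF FV F(2)] by metis
  define G where "G n = F (r n)" for n
  have G: "G n \<in> W" "G n \<in> V" "q (G n) \<le> 1" for n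
    using F FV by (auto simp: G_def)
  have G4: "S - 1 / real (n + 1) < q (T (G n))" for n
  proof -
    have "1 / real (r n + 1) \<le> 1 / real (n + 1)"
      using seq_suble[OF r, of n] by (intro divide_left_mono) auto
    then show ?thesis using F(3)[of "r n"] unfolding G_def by linarith
  qed
  have DG: "D.q (G n) \<le> 1 / real (n + 1)" for n
  proof -
    have "S * q (G n) \<le> S" using G(3)[of n] S_pos by (intro mult_left_le) auto
    then show ?thesis using G4[of n] unfolding Dq by linarith
  qed
  have lim1: "(\<lambda>n. 1 / real (n + 1)) \<longlonglongrightarrow> 0"
    using LIMSEQ_inverse_real_of_nat by (simp add: inverse_eq_divide add.commute)
  have DG0: "(\<lambda>n. D.q (G n)) \<longlonglongrightarrow> 0"
    by (rule tendsto_sandwich[OF _ _ tendsto_const lim1]) (use DG G D.q_nonneg in auto)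
  define h where "h n = 2 * D.q (G n) + 2 * q (T (G n) - g)" for n
  have h0: "h \<longlonglongrightarrow> 0"
    unfolding h_def using tendsto_add[OF tendsto_mult_right_zero[OF DG0, of 2] tendsto_mult_right_zero[OF g(2), of 2]]
    by (simp add: G_def)
  \<comment> \<open>\<open>S * q\<close> is the sum of the defect form and \<open>q (T _)\<close>.
    The first tends to 0 along a maximizing sequence and the second is controlled by the convergence
    of the images, so the sequence itself is Cauchy.\<close>
  have cauchy: "S * q (G m - G n) \<le> h m + h n" for m n
  proof -
    have "D.q (G m - G n) \<le> 2 * D.q (G m) + 2 * D.q (G n)"
      by (intro D.q_diff_le G)
    moreover have "q (T (G m) - T (G n)) \<le> 2 * q (T (G m) - g) + 2 * q (T (G n) - g)"
      using q_diff_le[of "T (G m) - g" "T (G n) - g"] G(2) g(1) by (auto simp: T_in diff_in)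
    ultimately show ?thesis using G(2) by (simp add: Dq T_diff h_def)
  qed
  have cauchyG: "\<exists>N. \<forall>m\<ge>N. \<forall>n\<ge>N. Re (ip (G m - G n) (G m - G n)) < \<epsilon>" if "\<epsilon> > 0" for \<epsilon> :: real
  proof -
    have "eventually (\<lambda>n. h n < S * \<epsilon> / 2) sequentially"
      using h0 S_pos that by (intro order_tendstoD) auto
    then obtain N where N: "\<And>n. n \<ge> N \<Longrightarrow> h n < S * \<epsilon> / 2" by (auto simp: eventually_sequentially)
    have "S * q (G m - G n) < S * \<epsilon>" if "m \<ge> N" "n \<ge> N" for m n
      using cauchy[of m n] N[OF that(1)] N[OF that(2)] by linarith
    then have "q (G m - G n) < \<epsilon>" if "m \<ge> N" "n \<ge> N" for m n
      using that S_pos by auto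
    then show ?thesis by (auto simp: q_def)
  qed
  obtain f where f: "f \<in> V" "(\<lambda>n. q (G n - f)) \<longlonglongrightarrow> 0"
    using complete[of G, OF G(2) cauchyG] unfolding q_def by blast
  have fW: "f \<in> W" using closed[OF G(1) f] .
  have "D.q f \<le> 2 * D.q (G n) + 2 * (S * q (G n - f))" for n
  proof -
    have GfW: "G n - f \<in> W" using G(1) fW by auto
    have "f = G n - (G n - f)" by simp
    then have "D.q f \<le> 2 * D.q (G n) + 2 * D.q (G n - f)" using D.q_diff_le[OF G(1) GfW] by metis
    moreover have "D.q (G n - f) \<le> S * q (G n - f)" using q_nonneg[OF T_in] GfW WV by (simp add: Dq)
    ultimately show ?thesis by linarith
  qed
  moreover have "(\<lambda>n. 2 * D.q (G n) + 2 * (S * q (G n - f))) \<longlonglongrightarrow> 0"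
    using tendsto_add[OF tendsto_mult_right_zero[OF DG0, of 2]
      tendsto_mult_right_zero[OF tendsto_mult_right_zero[OF f(2), of S], of 2]] by simp
  ultimately have "D.q f \<le> 0" by (intro LIMSEQ_le_const) auto
  then have Df: "D.q f = 0" using D.q_nonneg[OF fW] by simp
  have ortho: "ip (T u) (T f) = of_real S * ip u f" if "u \<in> W" for u
    using D.Cauchy_Schwarz[OF that fW] Df by (simp add: Q_def)
  \<comment> \<open>Convergence of \<open>G\<close> to 0 would send the images to 0 by boundedness,
    whereas their squared norms approach \<open>S > 0\<close>.\<close>
  have "f \<noteq> 0"
  proof
    assume "f = 0"
    then have lim: "(\<lambda>n. K * q (G n) + 1 / real (n + 1)) \<longlonglongrightarrow> 0"
      using f(2) tendsto_add[OF tendsto_mult_right_zero[OF f(2), of K] lim1] by simp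
    have "S \<le> K * q (G n) + 1 / real (n + 1)" for n
      using K(2)[OF G(2)[of n]] G4[of n] by simp
    then have "S \<le> 0" using LIMSEQ_le_const[OF lim] by auto
    then show False using S_pos by simp
  qed
  then show ?thesis
    using that[of f "sqrt S"] fW ortho S_pos S\<sigma> \<sigma> real_less_rsqrt[OF S\<sigma>] by auto
qed

text \<open>The count bound caps the size of orthonormal systems of eigenvectors with parameters at
  least \<sigma>, so a largest one exists. If T exceeded \<sigma> somewhere on its orthogonal
  complement, a maximizer on the complement would be a further eigenvector. This takes the place of
  a full spectral decomposition.\<close>

lemma finite_rank_splitting:
  assumes \<sigma>: "\<sigma> > 0"
  obtains S t where "finite S" "S \<subseteq> V" "orthonormal ip S" "\<And>e. e \<in> S \<Longrightarrow> \<sigma> \<le> t e \<and> e \<in> E (t e)"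
    "\<And>f. f \<in> V \<Longrightarrow> (\<And>e. e \<in> S \<Longrightarrow> ip f e = 0) \<Longrightarrow> q (T f) \<le> \<sigma>\<^sup>2 * q f"
proof -
  define P where "P S \<longleftrightarrow> finite S \<and> orthonormal ip S \<and> (\<forall>e\<in>S. \<exists>\<tau>\<ge>\<sigma>. e \<in> E \<tau>)" for S
  have "card S \<le> nat \<lfloor>C / \<sigma> powr p\<rfloor>" if "P S" for S
  proof -
    have "\<sigma>\<^sup>2 \<le> q (T e)" if e: "e \<in> S" for e
    proof -
      obtain \<tau> where "\<tau> \<ge> \<sigma>" "e \<in> E \<tau>"
        using e \<open>P S\<close> unfolding P_def by blast
      moreover have "ip e e = 1" using e \<open>P S\<close> by (simp add: P_def orthonormal_def)
      ultimately show ?thesis using \<sigma> q_T_eigen[of e \<tau>] by (auto simp: q_def intro!: power_mono)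
    qed
    then have "card S * \<sigma> powr p \<le> C"
      using \<open>P S\<close> E_in by (intro count_boundD[OF cb \<sigma>]) (auto simp: P_def)
    then have "card S \<le> C / \<sigma> powr p" using \<sigma> by (simp add: field_simps)
    then show ?thesis by (simp add: le_nat_iff le_floor_iff)
  qed
  moreover have "P {}" by (simp add: P_def orthonormal_def)
  ultimately obtain S where S: "P S" "\<And>S'. P S' \<Longrightarrow> card S' \<le> card S"
    using ex_has_greatest_nat[of P "{}" card] by (metis le_imp_less_Suc)
  obtain t where t: "\<And>e. e \<in> S \<Longrightarrow> \<sigma> \<le> t e \<and> e \<in> E (t e)"
    using S(1) unfolding P_def by metis
  have SV: "S \<subseteq> V" using t E_in by blast
  have fin: "finite S" and on: "orthonormal ip S" using S(1) by (auto simp: P_def)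
  define W where "W = {f \<in> V. \<forall>e\<in>S. ip f e = 0}"
  have W: "cfun.subspace W" "W \<subseteq> V"
    using SV unfolding W_def cfun.subspace_def by (auto simp: add_left scale_left subset_iff)
  have "q (T f) \<le> \<sigma>\<^sup>2 * q f" if "f \<in> V" "\<And>e. e \<in> S \<Longrightarrow> ip f e = 0" for f
  proof (rule ccontr)
    assume neg: "\<not> ?thesis"
    have fW: "f \<in> W" using that by (auto simp: W_def)
    have closed: "g \<in> W" if "\<And>n :: nat. F n \<in> W" "g \<in> V" "(\<lambda>n. q (F n - g)) \<longlonglongrightarrow> 0" for F g
    proof -
      have "ip g e = 0" if e: "e \<in> S" for e
      proof -
        have eV: "e \<in> V" using e SV by blast
        have "(cmod (ip g e))\<^sup>2 \<le> q (F n - g) * q e" for n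
        proof -
          have "F n \<in> V" "ip (F n) e = 0" using \<open>\<And>n. F n \<in> W\<close>[of n] e by (auto simp: W_def)
          then show ?thesis
            using Cauchy_Schwarz[of "F n - g" e] eV \<open>g \<in> V\<close> by (auto simp: diff_left)
        qed
        moreover have "(\<lambda>n. q (F n - g) * q e) \<longlonglongrightarrow> 0"
          by (rule tendsto_mult_left_zero[OF \<open>(\<lambda>n. q (F n - g)) \<longlonglongrightarrow> 0\<close>])
        ultimately have "(cmod (ip g e))\<^sup>2 \<le> 0" by (intro LIMSEQ_le_const) auto
        then show ?thesis by simp
      qed
      then show ?thesis using that(2) by (auto simp: W_def)
    qed
    have big: "q (T f) > \<sigma>\<^sup>2 * q f" using neg by simp
    have "\<exists>h M. h \<in> W \<and> h \<noteq> 0 \<and> M > \<sigma> \<and> (\<forall>u\<in>W. ip (T u) (T h) = of_real (M\<^sup>2) * ip u h)"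
    proof (rule maximizer[OF W _ fW big \<sigma>])
      fix F g assume "\<And>n :: nat. F n \<in> W" "g \<in> V" "(\<lambda>n. q (F n - g)) \<longlonglongrightarrow> 0"
      then show "g \<in> W" by (rule closed)
    qed blast
    then obtain h M where h: "h \<in> W" "h \<noteq> 0" "M > \<sigma>"
      "\<And>u. u \<in> W \<Longrightarrow> ip (T u) (T h) = of_real (M\<^sup>2) * ip u h"
      by blast
    have hV: "h \<in> V" using h W by blast
    have hS: "ip h e = 0" if "e \<in> S" for e using h(1) that by (auto simp: W_def)
    have hS': "ip e h = 0" if "e \<in> S" for e
      using hS[OF that] hermitian[OF hV, of e] that SV by auto
    have TeTh: "ip (T e) (T h) = 0" if "e \<in> S" for e
    proof -
      have eV: "e \<in> V" using that SV by blast
      have "ip (T h) (T e) = 0" using t[OF that] hS[OF that] hV by (simp add: E_iff)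
      then show ?thesis using hermitian[OF T_in[OF hV] T_in[OF eV]] by simp
    qed
    \<comment> \<open>The identity is known only against W. A general u differs from a member of W
      by a combination v of S, and v contributes nothing: h is orthogonal to S, and
      \<open>T h\<close> is orthogonal to \<open>T e\<close> because e is an eigenvector.\<close>
    have hE: "h \<in> E M"
      unfolding E_iff
    proof (intro conjI ballI hV)
      fix u assume u: "u \<in> V"
      define v where "v = (\<Sum>e\<in>S. cscale (ip u e) e)"
      have v: "v \<in> V" unfolding v_def using SV by (intro sum_in) blast
      have "ip v e = ip u e" if "e \<in> S" for e
        unfolding v_def using fin SV on that by (intro orthonormal_sum_left)
      then have uvW: "u - v \<in> W" using u v SV by (auto simp: W_def diff_left)
      have "ip v h = 0" unfolding v_def using hV SV hS' by (subst sum_left) (auto simp: scale_left subset_iff)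
      moreover have "ip (T v) (T h) = 0"
      proof -
        have "T v = (\<Sum>e\<in>S. cscale (ip u e) (T e))"
          unfolding v_def using SV by (subst T_sum) (auto simp: T_scale subset_iff)
        then show ?thesis using hV SV TeTh T_in
          by (simp only:) (subst sum_left, auto simp: scale_left subset_iff)
      qed
      ultimately show "ip (T u) (T h) = of_real (M\<^sup>2) * ip u h"
        using h(4)[OF uvW] u v hV by (simp add: T_diff diff_left T_in)
    qed
    obtain c where c: "c \<noteq> 0" "ip (cscale c h) (cscale c h) = 1" using normalise[OF hV h(2)] by blast
    have "orthonormal ip (insert (cscale c h) S)"
      using c hS hS' hV SV by (intro orthonormal_insert[OF on]) (auto simp: scale_left scale_right subset_iff)
    moreover have "cscale c h \<in> E M" using hE E_subspace cfun.subspace_scale by blast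
    ultimately have "P (insert (cscale c h) S)"
      using S(1) h(3) by (auto simp: P_def intro!: exI[of _ M])
    \<comment> \<open>Otherwise h would be orthogonal to a multiple of itself that has norm
      1.\<close>
    moreover have "cscale c h \<notin> S"
      using c hS[of "cscale c h"] hV scale_right[OF hV hV, of c] scale_left[OF hV scale_in[OF hV], of c c] by auto
    ultimately show False using S(2)[of "insert (cscale c h) S"] fin by simp
  qed
  then show ?thesis using that[OF fin SV on t] by blast
qed

text \<open>For each eigenvector e the squared coefficients of the family sum to at most B, so the
  part of T above \<sigma> contributes at most B times the sum of squared singular values. The
  remainder contributes at most \<open>\<sigma>\<^sup>2\<close> times a quantity fixed by the finite
  family, and \<sigma> tends to 0. Orthonormality of the family is thus replaced by a Bessel
  bound.\<close>

lemma hilbert_schmidt_bessel: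
  assumes sm: "summable (\<lambda>n. (s n)\<^sup>2)" and I: "finite I" "\<And>i. i \<in> I \<Longrightarrow> F i \<in> V"
    and bessel: "\<And>h. h \<in> V \<Longrightarrow> (\<Sum>i\<in>I. (cmod (ip (F i) h))\<^sup>2) \<le> B * q h" and B: "B \<ge> 0"
  shows "(\<Sum>i\<in>I. q (T (F i))) \<le> B * (\<Sum>n. (s n)\<^sup>2)"
proof -
  have approx: "(\<Sum>i\<in>I. q (T (F i))) \<le> B * (\<Sum>n. (s n)\<^sup>2) + \<sigma>\<^sup>2 * (\<Sum>i\<in>I. q (F i))" if \<sigma>: "\<sigma> > 0" for \<sigma>
  proof -
    obtain S t where S: "finite S" "S \<subseteq> V" "orthonormal ip S" "\<And>e. e \<in> S \<Longrightarrow> \<sigma> \<le> t e \<and> e \<in> E (t e)"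
      "\<And>f. f \<in> V \<Longrightarrow> (\<And>e. e \<in> S \<Longrightarrow> ip f e = 0) \<Longrightarrow> q (T f) \<le> \<sigma>\<^sup>2 * q f"
      using finite_rank_splitting[OF \<sigma>] by metis
    have one: "q (T f) \<le> (\<Sum>e\<in>S. (t e)\<^sup>2 * (cmod (ip f e))\<^sup>2) + \<sigma>\<^sup>2 * q f" if f: "f \<in> V" for f
    proof -
      define v where "v = (\<Sum>e\<in>S. cscale (ip f e) e)"
      have v: "v \<in> V" unfolding v_def using S(2) by (intro sum_in) blast
      have ve: "ip v e = ip f e" if "e \<in> S" for e
        unfolding v_def using S that by (intro orthonormal_sum_left)
      define u where "u = f - v"
      have u: "u \<in> V" unfolding u_def using f v by blast
      have ue: "ip u e = 0" if "e \<in> S" for e using ve[OF that] that S(2) f v by (auto simp: u_def diff_left)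
      have Tv: "T v = (\<Sum>e\<in>S. cscale (ip f e) (T e))"
        unfolding v_def using S(2) by (subst T_sum) (auto simp: T_scale subset_iff)
      \<comment> \<open>The images under T of the projection v and of the remainder u stay
        orthogonal because v is built from eigenvectors of \<open>T\<^sup>* T\<close>.\<close>
      have Tev: "ip (T g) (T v) = (\<Sum>e\<in>S. cnj (ip f e) * (of_real ((t e)\<^sup>2) * ip g e))" if g: "g \<in> V" for g
        unfolding Tv using g S(2,4) T_in
        by (subst sum_right) (auto simp: scale_right subset_iff E_iff intro!: sum.cong)
      have uv: "ip u v = 0"
        unfolding v_def using u S(2) ue by (subst sum_right) (auto simp: scale_right subset_iff)
      have "q f = q u + q v" using q_add[OF u v] uv by (simp add: u_def)
      then have quf: "q u \<le> q f" using q_nonneg[OF v] by simp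
      have "f = u + v" by (simp add: u_def)
      then have "q (T f) = q (T u) + 2 * Re (ip (T u) (T v)) + q (T v)"
        using u v by (simp add: T_add q_add T_in)
      also have "ip (T u) (T v) = 0" using Tev[OF u] ue by simp
      also have "q (T v) = (\<Sum>e\<in>S. (t e)\<^sup>2 * (cmod (ip f e))\<^sup>2)"
        unfolding q_def Tev[OF v] Re_sum
      proof (rule sum.cong[OF refl])
        fix e assume "e \<in> S"
        have "cnj (ip f e) * (of_real ((t e)\<^sup>2) * ip f e) = of_real ((t e)\<^sup>2 * (cmod (ip f e))\<^sup>2)"
          by (simp only: of_real_mult complex_norm_square mult_ac)
        then show "Re (cnj (ip f e) * (of_real ((t e)\<^sup>2) * ip v e)) = (t e)\<^sup>2 * (cmod (ip f e))\<^sup>2"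
          using ve[OF \<open>e \<in> S\<close>] by (simp only: Re_complex_of_real)
      qed
      finally have "q (T f) = q (T u) + (\<Sum>e\<in>S. (t e)\<^sup>2 * (cmod (ip f e))\<^sup>2)" by simp
      moreover have "q (T u) \<le> \<sigma>\<^sup>2 * q u" using S(5)[OF u ue] .
      moreover have "\<sigma>\<^sup>2 * q u \<le> \<sigma>\<^sup>2 * q f" using quf by (intro mult_left_mono) auto
      ultimately show ?thesis by linarith
    qed
    have "(\<Sum>i\<in>I. q (T (F i))) \<le> (\<Sum>i\<in>I. (\<Sum>e\<in>S. (t e)\<^sup>2 * (cmod (ip (F i) e))\<^sup>2) + \<sigma>\<^sup>2 * q (F i))"
      using I one by (intro sum_mono) auto
    also have "\<dots> = (\<Sum>e\<in>S. (t e)\<^sup>2 * (\<Sum>i\<in>I. (cmod (ip (F i) e))\<^sup>2)) + \<sigma>\<^sup>2 * (\<Sum>i\<in>I. q (F i))"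
      by (simp add: sum.distrib sum_distrib_left sum.swap[of _ S I])
    also have "(\<Sum>e\<in>S. (t e)\<^sup>2 * (\<Sum>i\<in>I. (cmod (ip (F i) e))\<^sup>2)) \<le> (\<Sum>e\<in>S. (t e)\<^sup>2 * B)"
    proof (intro sum_mono mult_left_mono)
      fix e assume e: "e \<in> S"
      then have "q e = 1" using S(3) by (auto simp: orthonormal_def q_def)
      then show "(\<Sum>i\<in>I. (cmod (ip (F i) e))\<^sup>2) \<le> B" using bessel[of e] e S(2) by auto
    qed simp
    also have "(\<Sum>e\<in>S. (t e)\<^sup>2 * B) = B * (\<Sum>e\<in>S. (t e)\<^sup>2)" by (simp add: sum_distrib_left mult.commute)
    also have "\<dots> \<le> B * (\<Sum>n<card S. (s n)\<^sup>2)"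
      using S(4) \<sigma> by (intro mult_left_mono B sum_eigen_le[OF cb p_pos S(1,3)]) force+
    also have "\<dots> \<le> B * (\<Sum>n. (s n)\<^sup>2)"
      using sm by (intro mult_left_mono B sum_le_suminf) auto
    finally show ?thesis by simp
  qed
  have "((\<lambda>\<sigma>. B * (\<Sum>n. (s n)\<^sup>2) + \<sigma>\<^sup>2 * (\<Sum>i\<in>I. q (F i))) \<longlongrightarrow> B * (\<Sum>n. (s n)\<^sup>2) + 0\<^sup>2 * (\<Sum>i\<in>I. q (F i))) (at_right 0)"
    by (intro tendsto_intros)
  then have lim: "((\<lambda>\<sigma>. B * (\<Sum>n. (s n)\<^sup>2) + \<sigma>\<^sup>2 * (\<Sum>i\<in>I. q (F i))) \<longlongrightarrow> B * (\<Sum>n. (s n)\<^sup>2)) (at_right 0)"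
    by simp
  show ?thesis
    using approx by (intro tendsto_lowerbound[OF lim]) (auto simp: eventually_at_filter)
qed

end

section \<open>The comparison property of restricted weights\<close>

definition sq :: "real \<Rightarrow> complex \<Rightarrow> complex set" where
  "sq r c = cbox c (c + Complex r r)"

lemma sq_iff: "z \<in> sq r c \<longleftrightarrow> Re c \<le> Re z \<and> Re z \<le> Re c + r \<and> Im c \<le> Im z \<and> Im z \<le> Im c + r"
  by (auto simp: sq_def in_cbox_complex_iff)

lemma sq_measurable [simp, measurable]: "sq r c \<in> sets lebesgue"
  by (simp add: sq_def)

lemma compact_sq [simp]: "compact (sq r c)"
  by (simp add: sq_def)

lemma measure_sq: "r \<ge> 0 \<Longrightarrow> measure lebesgue (sq r c) = r\<^sup>2"
  by (simp add: sq_def measure_lborel_cbox_eq Basis_complex_def inner_complex_def power2_eq_square)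

lemma emeasure_sq_finite: "emeasure lebesgue (sq r c) < \<infinity>"
  using emeasure_lborel_cbox_finite[of c "c + Complex r r"] by (simp add: sq_def less_top)

lemma dist_sq:
  assumes "z \<in> sq r c" "r > 0"
  shows "cmod (z - c) \<le> 2 * r"
  using cmod_le[of "z - c"] assms by (auto simp: sq_iff)

section \<open>The weighted measure on bounded sets\<close>

definition wmeas :: "(complex \<Rightarrow> real) \<Rightarrow> complex measure" where
  "wmeas w = density lebesgue (\<lambda>z. ennreal (w z))"

lemma sets_wmeas [simp, measurable_cong]: "sets (wmeas w) = sets lebesgue"
  by (simp add: wmeas_def)

context
  fixes w assumes w: "weight w"
begin

lemma weight_nonneg: "0 \<le> w z" and weight_measurable [measurable]: "w \<in> borel_measurable lebesgue"
  using w by (auto simp: weight_def)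

lemma weight_set_integrable:
  assumes "compact K" "A \<subseteq> K" "A \<in> sets lebesgue"
  shows "set_integrable lebesgue A w"
  using w assms set_integrable_subset[of lebesgue K w A] by (auto simp: weight_def)

lemma emeasure_wmeas:
  assumes "compact K" "A \<subseteq> K" "A \<in> sets lebesgue"
  shows "emeasure (wmeas w) A = ennreal (set_lebesgue_integral lebesgue A w)"
proof -
  have "emeasure (wmeas w) A = (\<integral>\<^sup>+z. ennreal (w z) * indicator A z \<partial>lebesgue)"
    using assms unfolding wmeas_def by (intro emeasure_density) auto
  also have "\<dots> = (\<integral>\<^sup>+z. ennreal (indicator A z *\<^sub>R w z) \<partial>lebesgue)"
    by (intro nn_integral_cong) (auto simp: indicator_def)
  also have "\<dots> = ennreal (set_lebesgue_integral lebesgue A w)"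
    using weight_set_integrable[OF assms] unfolding set_integrable_def set_lebesgue_integral_def
    by (intro nn_integral_eq_integral) (auto simp: weight_nonneg indicator_def)
  finally show ?thesis .
qed

lemma set_integral_weight_nonneg: "0 \<le> set_lebesgue_integral lebesgue A w"
  unfolding set_lebesgue_integral_def by (intro integral_nonneg_AE) (auto simp: weight_nonneg indicator_def)

lemma measure_wmeas:
  assumes "compact K" "A \<subseteq> K" "A \<in> sets lebesgue"
  shows "measure (wmeas w) A = set_lebesgue_integral lebesgue A w"
  using emeasure_wmeas[OF assms] set_integral_weight_nonneg by (simp add: measure_def)

lemma wmeas_finite:
  assumes "compact K" "A \<subseteq> K" "A \<in> sets lebesgue"
  shows "emeasure (wmeas w) A = ennreal (measure (wmeas w) A)"
  using emeasure_wmeas[OF assms] measure_wmeas[OF assms] by simp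

lemma average_sq:
  "r > 0 \<Longrightarrow> average (sq r c) w = measure (wmeas w) (sq r c) / r\<^sup>2"
  unfolding average_def by (subst measure_wmeas[of "sq r c"]) (auto simp: measure_sq)

end

text \<open>The condition says that the average of w over the square is at most a constant times w
  almost everywhere on it; integrating over E gives the power 1. The exponent is written out so that
  the result has the shape of \<open>comparison_weight\<close> with k = 1.\<close>

lemma A1_comparison:
  assumes "w \<in> A1_restricted"
  obtains r C where "r > 0" "C > 0"
    "\<And>c E. E \<in> sets lebesgue \<Longrightarrow> E \<subseteq> sq r c \<Longrightarrow>
      measure (wmeas w) (sq r c) * (measure lebesgue E / r\<^sup>2) ^ 1 \<le> C * measure (wmeas w) E"
proof -
  obtain r where w: "weight w" and pos: "AE z in lebesgue. 0 < w z" and r: "r > 0" and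
    S: "(SUP Q\<in>squares r. ereal (average Q w) * esssup (restrict_space lebesgue Q) (\<lambda>z. ereal (inverse (w z)))) < \<infinity>"
    (is "?S < \<infinity>")
    using assms by (auto simp: A1_restricted_def)
  obtain B where B: "?S \<le> ereal B"
    using S by (cases ?S) auto
  define C where "C = max B 1"
  show ?thesis
  proof (rule that[OF r, of C])
    show "C > 0" by (simp add: C_def)
    fix c E assume E: "E \<in> sets lebesgue" "E \<subseteq> sq r c"
    define a where "a = average (sq r c) w"
    have a: "a \<ge> 0" using average_sq[OF w r] by (simp add: a_def)
    have Q: "sq r c \<in> squares r" by (auto simp: squares_def sq_def)
    have le: "ereal a * esssup (restrict_space lebesgue (sq r c)) (\<lambda>z. ereal (inverse (w z))) \<le> ereal B"
      using SUP_upper[OF Q, of "\<lambda>Q. ereal (average Q w) * esssup (restrict_space lebesgue Q) (\<lambda>z. ereal (inverse (w z)))"]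
        B order_trans unfolding a_def by blast
    have "AE z in restrict_space lebesgue (sq r c). ereal (inverse (w z)) \<le> esssup (restrict_space lebesgue (sq r c)) (\<lambda>z. ereal (inverse (w z)))"
      by (rule esssup_AE)
    then have "AE z in lebesgue. z \<in> sq r c \<longrightarrow> ereal (inverse (w z)) \<le> esssup (restrict_space lebesgue (sq r c)) (\<lambda>z. ereal (inverse (w z)))"
      by (subst (asm) AE_restrict_space_iff) auto
    with pos have ae: "AE z in lebesgue. z \<in> sq r c \<longrightarrow> a \<le> C * w z"
    proof eventually_elim
      case (elim z)
      show ?case
      proof
        assume "z \<in> sq r c"
        then have "ereal a * ereal (inverse (w z)) \<le> ereal B"
          using elim a le by (meson ereal_less_eq(5) ereal_mult_left_mono order_trans)
        then have "a * inverse (w z) \<le> B" by simp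
        then have "a * inverse (w z) \<le> C" by (simp add: C_def)
        then show "a \<le> C * w z" using elim by (simp add: field_simps)
      qed
    qed
    have Efin: "emeasure lebesgue E < \<infinity>"
      using emeasure_mono[OF E(2), of lebesgue] emeasure_sq_finite[of r c] by (auto simp: le_less_trans)
    have sw: "set_integrable lebesgue E w"
      by (rule weight_set_integrable[OF w compact_sq E(2,1)])
    have "a * measure lebesgue E = (LINT z:E|lebesgue. a)"
      using E(1) Efin by (simp add: set_lebesgue_integral_def)
    also have "\<dots> \<le> (LINT z:E|lebesgue. C * w z)"
    proof (rule set_integral_mono_AE)
      show "set_integrable lebesgue E (\<lambda>z. a)" using E(1) Efin by (simp add: set_integrable_def)
      show "set_integrable lebesgue E (\<lambda>z. C * w z)" using sw by simp
      show "AE z\<in>E in lebesgue. a \<le> C * w z" using ae E(2) by (auto elim!: eventually_mono)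
    qed
    also have "\<dots> = C * measure (wmeas w) E"
      using measure_wmeas[OF w compact_sq E(2,1)] by simp
    finally show "measure (wmeas w) (sq r c) * (measure lebesgue E / r\<^sup>2) ^ 1 \<le> C * measure (wmeas w) E"
      using average_sq[OF w r, of c] r by (simp add: a_def field_simps)
  qed
qed

text \<open>For every \<open>t > 0\<close> one has \<open>1 \<le> t w + (t w)\<^sup>-\<^sup>s\<close>; integrating this over \<open>E\<close> and optimizing over \<open>t\<close>
  replaces the use of the Hoelder inequality.\<close>

lemma Aq_comparison:
  assumes "w \<in> Aq_restricted q" "q > 1"
  obtains r k C where "r > 0" "C > 0"
    "\<And>c E. E \<in> sets lebesgue \<Longrightarrow> E \<subseteq> sq r c \<Longrightarrow>
      measure (wmeas w) (sq r c) * (measure lebesgue E / r\<^sup>2) ^ k \<le> C * measure (wmeas w) E"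
proof -
  \<comment> \<open>Here t = q - 1 and s = 1/t.\<close>
  define s where "s = conj_exponent q / q"
  define t where "t = q / conj_exponent q"
  have st: "s > 0" "t > 0" "s * t = 1" "q = 1 + t"
    using assms(2) by (auto simp: s_def t_def conj_exponent_def field_simps)
  obtain r where w: "weight w" and pos: "AE z in lebesgue. 0 < w z" and r: "r > 0" and
    I: "\<And>Q. Q \<in> squares r \<Longrightarrow> set_integrable lebesgue Q (\<lambda>z. w z powr (- s))" and
    bdd: "bdd_above ((\<lambda>Q. average Q w * average Q (\<lambda>z. w z powr (- s)) powr t) ` squares r)"
    using assms(1) by (auto simp: Aq_restricted_def s_def t_def)
  obtain B where B: "\<And>Q. Q \<in> squares r \<Longrightarrow> average Q w * average Q (\<lambda>z. w z powr (- s)) powr t \<le> B"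
    using bdd by (auto simp: bdd_above_def)
  define C where "C = 2 powr q * max B 1"
  show ?thesis
  \<comment> \<open>E has at most the area of the square, so rounding the exponent q up to an
    integer weakens the inequality.\<close>
  proof (rule that[OF r, of C "nat \<lceil>q\<rceil>"])
    show "C > 0" by (simp add: C_def)
    fix c E assume E: "E \<in> sets lebesgue" "E \<subseteq> sq r c"
    define m where "m = measure lebesgue E"
    define \<sigma> where "\<sigma> = (LINT z:sq r c|lebesgue. w z powr (- s))"
    define W where "W = measure (wmeas w) (sq r c)"
    have Q: "sq r c \<in> squares r" by (auto simp: squares_def sq_def)
    have Efin: "emeasure lebesgue E < \<infinity>"
      using emeasure_mono[OF E(2), of lebesgue] emeasure_sq_finite[of r c] by (auto simp: le_less_trans)
    have m_le: "m \<le> r\<^sup>2"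
      unfolding m_def using E emeasure_sq_finite[of r c] r
      by (subst measure_sq[of r c, symmetric]) (auto intro!: measure_mono_fmeasurable fmeasurableI)
    have sw: "set_integrable lebesgue E w"
      by (rule weight_set_integrable[OF w compact_sq E(2,1)])
    have Is: "set_integrable lebesgue E (\<lambda>z. w z powr (- s))"
      using I[OF Q] E by (rule set_integrable_subset)
    have \<sigma>E: "(LINT z:E|lebesgue. w z powr (- s)) \<le> \<sigma>"
      unfolding \<sigma>_def using I[OF Q] Is E unfolding set_lebesgue_integral_def set_integrable_def
      by (intro integral_mono) (auto simp: indicator_def)
    have key: "m \<le> l * measure (wmeas w) E + l powr (- s) * \<sigma>" if l: "l > 0" for l
    proof -
      have ae: "AE z in lebesgue. z \<in> E \<longrightarrow> 1 \<le> l * w z + l powr (- s) * (w z powr (- s))"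
        using pos
      proof eventually_elim
        case (elim z)
        have "1 \<le> l * w z + (l * w z) powr (- s)"
        proof (cases "1 \<le> l * w z")
          case False
          then have "(l * w z) powr s \<le> 1"
            using elim l st by (intro powr_le1) auto
          then have "(l * w z) powr (- s) \<ge> 1"
            using elim l by (simp add: powr_minus one_le_inverse_iff)
          then show ?thesis using elim l by (simp add: add_increasing)
        qed (simp add: add_increasing2)
        then show ?case using elim l by (simp add: powr_mult)
      qed
      have "m = (LINT z:E|lebesgue. 1)"
        using E(1) Efin by (simp add: set_lebesgue_integral_def m_def)
      also have "\<dots> \<le> (LINT z:E|lebesgue. l * w z + l powr (- s) * (w z powr (- s)))"
      proof (rule set_integral_mono_AE[OF _ _ ae])
        show "set_integrable lebesgue E (\<lambda>z. 1)" using E(1) Efin by (simp add: set_integrable_def)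
        show "set_integrable lebesgue E (\<lambda>z. l * w z + l powr (- s) * (w z powr (- s)))"
          using sw Is by (intro set_integral_add(1)) auto
      qed
      also have "\<dots> = l * measure (wmeas w) E + l powr (- s) * (LINT z:E|lebesgue. w z powr (- s))"
        using sw Is measure_wmeas[OF w compact_sq E(2,1)] by (subst set_integral_add(2)) auto
      also have "\<dots> \<le> l * measure (wmeas w) E + l powr (- s) * \<sigma>"
        using \<sigma>E by (intro add_left_mono mult_left_mono) auto
      finally show ?thesis .
    qed
    have \<sigma>0: "\<sigma> \<ge> 0" unfolding \<sigma>_def set_lebesgue_integral_def by (intro integral_nonneg_AE) auto
    have k0: "nat \<lceil>q\<rceil> > 0" using assms(2) by auto
    have "W * (m / r\<^sup>2) ^ nat \<lceil>q\<rceil> \<le> C * measure (wmeas w) E"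
    proof (cases "m = 0")
      case True
      then have "W * (m / r\<^sup>2) ^ nat \<lceil>q\<rceil> = 0"
        by (simp only: True div_0 zero_power[OF k0] mult_zero_right)
      then show ?thesis using \<open>C > 0\<close> by (simp only:) simp
    next
      case False
      then have m: "m > 0" by (simp add: m_def zero_less_measure_iff)
      \<comment> \<open>With \<sigma> = 0 the bound \<open>key\<close> would hold without its second
        term for arbitrarily small l, forcing m = 0.\<close>
      have "\<sigma> > 0"
      proof (rule ccontr)
        assume "\<not> \<sigma> > 0"
        then have "\<sigma> = 0" using \<sigma>0 by simp
        then have *: "m \<le> l * measure (wmeas w) E" if "l > 0" for l using key[OF that] by simp
        show False
        proof (cases "measure (wmeas w) E = 0")
          case True then show False using *[of 1] m by simp
        next
          case False
          then have "measure (wmeas w) E > 0" by (simp add: zero_less_measure_iff)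
          then show False using *[of "m / (2 * measure (wmeas w) E)"] m by simp
        qed
      qed
      \<comment> \<open>Chosen so that the second term of \<open>key\<close> equals m/2 and can be
        absorbed on the left.\<close>
      define l where "l = (2 * \<sigma> / m) powr t"
      have l: "l > 0" using \<open>\<sigma> > 0\<close> m by (simp add: l_def)
      have "t * s = 1" using st(3) by (simp add: mult.commute)
      then have "l powr (- s) = (2 * \<sigma> / m) powr (- 1)"
        by (simp add: l_def powr_powr)
      then have "l powr (- s) * \<sigma> = m / 2"
        using \<open>\<sigma> > 0\<close> m by (simp add: powr_minus powr_one)
      then have "m / 2 \<le> l * measure (wmeas w) E" using key[OF l] by simp
      then have "m \<le> 2 * (2 * \<sigma> / m) powr t * measure (wmeas w) E" by (simp add: l_def)
      then have "m * m powr t \<le> 2 * (2 * \<sigma> / m) powr t * measure (wmeas w) E * m powr t"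
        by (intro mult_right_mono) auto
      also have "\<dots> = 2 powr q * \<sigma> powr t * measure (wmeas w) E"
        using m \<open>\<sigma> > 0\<close> by (simp add: st(4) powr_add powr_divide powr_mult)
      finally have mq: "m powr q \<le> 2 powr q * \<sigma> powr t * measure (wmeas w) E"
        using m by (simp add: st(4) powr_add)
      have "W / r\<^sup>2 * (\<sigma> / r\<^sup>2) powr t \<le> B"
        using B[OF Q] average_sq[OF w r, of c] r by (simp add: W_def \<sigma>_def average_def[of _ "\<lambda>z. w z powr _"] measure_sq)
      then have "W / r\<^sup>2 * (\<sigma> / r\<^sup>2) powr t \<le> max B 1" by simp
      then have B': "W * \<sigma> powr t \<le> max B 1 * (r\<^sup>2) powr q"
        using r \<open>\<sigma> > 0\<close> by (simp add: st(4) powr_add powr_divide field_simps)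
      have "W * (m / r\<^sup>2) ^ nat \<lceil>q\<rceil> = W * (m / r\<^sup>2) powr (nat \<lceil>q\<rceil>)"
        using m r by (simp add: powr_realpow)
      also have "\<dots> \<le> W * (m / r\<^sup>2) powr q"
        using m r m_le real_nat_ceiling_ge[of q] by (intro mult_left_mono powr_mono') (auto simp: W_def)
      also have "\<dots> = W * m powr q / (r\<^sup>2) powr q"
        using m r by (simp add: powr_divide)
      also have "\<dots> \<le> W * (2 powr q * \<sigma> powr t * measure (wmeas w) E) / (r\<^sup>2) powr q"
        by (intro divide_right_mono mult_left_mono mq) (auto simp: W_def)
      also have "\<dots> = (W * \<sigma> powr t) * (2 powr q * measure (wmeas w) E / (r\<^sup>2) powr q)"
        by simp
      also have "\<dots> \<le> (max B 1 * (r\<^sup>2) powr q) * (2 powr q * measure (wmeas w) E / (r\<^sup>2) powr q)"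
        by (intro mult_right_mono B') auto
      also have "\<dots> = C * measure (wmeas w) E" using r by (simp add: C_def)
      finally show ?thesis .
    qed
    then show "measure (wmeas w) (sq r c) * (measure lebesgue E / r\<^sup>2) ^ nat \<lceil>q\<rceil> \<le> C * measure (wmeas w) E"
      by (simp add: W_def m_def)
  qed
qed

text \<open>The quantitative \<open>A\<^sub>\<infinity>\<close> condition at the fixed scale \<open>r\<close>.\<close>

locale comparison_weight =
  fixes w :: "complex \<Rightarrow> real" and r :: real and k :: nat and C :: real
  assumes weight: "weight w" and weight_pos: "AE z in lebesgue. 0 < w z"
    and r: "r > 0" and C: "C > 0"
    and comparison: "\<And>c E. E \<in> sets lebesgue \<Longrightarrow> E \<subseteq> sq r c \<Longrightarrow>
      measure (wmeas w) (sq r c) * (measure lebesgue E / r\<^sup>2) ^ k \<le> C * measure (wmeas w) E"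

lemma A_infinity_comparison:
  assumes "w \<in> A_infinity_restricted"
  obtains r k C where "comparison_weight w r k C"
proof (cases "w \<in> A1_restricted")
  case True
  then have "weight w" "AE z in lebesgue. 0 < w z" by (auto simp: A1_restricted_def)
  moreover obtain r C where "r > 0" "C > 0"
    "\<And>c E. E \<in> sets lebesgue \<Longrightarrow> E \<subseteq> sq r c \<Longrightarrow>
      measure (wmeas w) (sq r c) * (measure lebesgue E / r\<^sup>2) ^ 1 \<le> C * measure (wmeas w) E"
    using A1_comparison[OF True] by metis
  ultimately have "comparison_weight w r 1 C" by unfold_locales
  then show ?thesis by (rule that)
next
  case False
  then obtain q where q: "q > 1" "w \<in> Aq_restricted q"
    using assms by (auto simp: A_infinity_restricted_def)
  then have "weight w" "AE z in lebesgue. 0 < w z" by (auto simp: Aq_restricted_def)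
  moreover obtain r k C where "r > 0" "C > 0"
    "\<And>c E. E \<in> sets lebesgue \<Longrightarrow> E \<subseteq> sq r c \<Longrightarrow>
      measure (wmeas w) (sq r c) * (measure lebesgue E / r\<^sup>2) ^ k \<le> C * measure (wmeas w) E"
    using Aq_comparison[OF q(2,1)] by metis
  ultimately have "comparison_weight w r k C" by unfold_locales
  then show ?thesis by (rule that)
qed

section \<open>Lattice sums and exponential kernels\<close>

text \<open>Lattice sums are taken as integrals over counting measure with values in
  \<open>ennreal\<close>, so that they can be exchanged with other integrals without proving
  summability first.\<close>

abbreviation nsum :: "('a \<Rightarrow> ennreal) \<Rightarrow> ennreal" where
  "nsum f \<equiv> (\<integral>\<^sup>+i. f i \<partial>count_space UNIV)"

text \<open>Two copies of the natural numbers cover the integers, with 0 covered twice.\<close>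

lemma nsum_int_le: "nsum (\<lambda>m::int. f (nat \<bar>m\<bar>)) \<le> 2 * (\<Sum>n. f n)"
proof -
  have pos: "(\<integral>\<^sup>+m. f (nat \<bar>m\<bar>) * indicator (range int) m \<partial>count_space UNIV) = (\<Sum>n. f n)"
  proof -
    have "(\<integral>\<^sup>+m. f (nat \<bar>m\<bar>) * indicator (range int) m \<partial>count_space UNIV)
        = (\<integral>\<^sup>+m. f (nat \<bar>m\<bar>) \<partial>count_space (range int))"
      by (simp add: nn_integral_count_space_indicator)
    also have "\<dots> = nsum (\<lambda>n. f (nat \<bar>int n\<bar>))"
      by (rule nn_integral_bij_count_space[symmetric]) (simp add: inj_on_imp_bij_betw)
    finally show ?thesis by (simp add: nn_integral_count_space_nat)
  qed
  have neg: "(\<integral>\<^sup>+m. f (nat \<bar>m\<bar>) * indicator (range (\<lambda>n. - int n)) m \<partial>count_space UNIV) = (\<Sum>n. f n)"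
  proof -
    have "(\<integral>\<^sup>+m. f (nat \<bar>m\<bar>) * indicator (range (\<lambda>n. - int n)) m \<partial>count_space UNIV)
        = (\<integral>\<^sup>+m. f (nat \<bar>m\<bar>) \<partial>count_space (range (\<lambda>n. - int n)))"
      by (simp add: nn_integral_count_space_indicator)
    also have "\<dots> = nsum (\<lambda>n. f (nat \<bar>- int n\<bar>))"
      by (rule nn_integral_bij_count_space[symmetric, where g = "\<lambda>n. - int n"])
        (auto intro!: inj_on_imp_bij_betw injI)
    finally show ?thesis by (simp add: nn_integral_count_space_nat)
  qed
  have "nsum (\<lambda>m::int. f (nat \<bar>m\<bar>)) \<le> (\<integral>\<^sup>+m. f (nat \<bar>m\<bar>) * indicator (range int) m
      + f (nat \<bar>m\<bar>) * indicator (range (\<lambda>n. - int n)) m \<partial>count_space UNIV)"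
  proof (rule nn_integral_mono)
    fix m :: int
    have "m = int (nat m) \<or> m = - int (nat (- m))" by linarith
    then have "m \<in> range int \<or> m \<in> range (\<lambda>n. - int n)" by blast
    then show "f (nat \<bar>m\<bar>) \<le> f (nat \<bar>m\<bar>) * indicator (range int) m + f (nat \<bar>m\<bar>) * indicator (range (\<lambda>n. - int n)) m"
      by (auto simp: indicator_def)
  qed
  also have "\<dots> = (\<Sum>n. f n) + (\<Sum>n. f n)"
    by (subst nn_integral_add) (simp_all add: pos neg)
  finally show ?thesis by (simp add: mult_2)
qed

lemma nsum_prod: "nsum (\<lambda>(m, n). f m * g n) = nsum f * nsum g"
proof -
  have "nsum (\<lambda>(m, n). f m * g n) = nsum (\<lambda>m. nsum (\<lambda>n. f m * g n))"
    by (subst nn_integral_fst_count_space[symmetric]) simp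
  also have "\<dots> = nsum (\<lambda>m. f m * nsum g)" by (simp add: nn_integral_cmult)
  also have "\<dots> = nsum f * nsum g" by (simp add: nn_integral_multc)
  finally show ?thesis .
qed

definition latt :: "real \<Rightarrow> int \<times> int \<Rightarrow> complex" where
  "latt r = (\<lambda>(m, n). Complex (m * r) (n * r))"

text \<open>The modulus dominates half the sum of the two coordinate distances, so the sum factors
  into one-dimensional ones. Shifting the index by \<open>\<lfloor>x / r\<rfloor>\<close> compares
  each of these with a geometric series, at the price of a factor \<open>exp (a * r)\<close>. The
  point is that the bound does not depend on u.\<close>

lemma nsum_latt_exp:
  assumes r: "r > 0" and t: "t > 0"
  obtains K where "K > 0" "\<And>u. nsum (\<lambda>i. ennreal (exp (- t * cmod (u - latt r i)))) \<le> ennreal K"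
proof -
  define a where "a = t / 2"
  have a: "a > 0" using t by (simp add: a_def)
  define f where "f n = exp (a * r) * exp (- a * r) ^ n" for n :: nat
  have "summable f" unfolding f_def using a r by (intro summable_mult summable_geometric) (simp add: mult_pos_pos)
  moreover have "f n \<ge> 0" for n by (simp add: f_def)
  ultimately have sf: "(\<Sum>n. ennreal (f n)) = ennreal (\<Sum>n. f n)"
    by (intro suminf_ennreal2)
  define K where "K = 2 * (\<Sum>n. f n)"
  have sum_pos: "0 < (\<Sum>n. f n)" by (rule suminf_pos[OF \<open>summable f\<close>]) (simp add: f_def)
  have one: "nsum (\<lambda>m::int. ennreal (exp (- a * \<bar>x - m * r\<bar>))) \<le> ennreal K" for x
  proof -
    define m0 where "m0 = \<lfloor>x / r\<rfloor>"
    have m0: "m0 * r \<le> x" "x < (m0 + 1) * r"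
      using floor_divide_lower[OF r, of x] floor_divide_upper[OF r, of x] by (auto simp: m0_def)
    have "nsum (\<lambda>m::int. ennreal (exp (- a * \<bar>x - m * r\<bar>))) = nsum (\<lambda>m::int. ennreal (exp (- a * \<bar>x - (m0 + m) * r\<bar>)))"
      using nn_integral_bij_count_space[of "\<lambda>m. m0 + m" UNIV UNIV "\<lambda>m::int. ennreal (exp (- a * \<bar>x - m * r\<bar>))"]
      by (simp add: bij_plus_right)
    also have "\<dots> \<le> nsum (\<lambda>m::int. ennreal (f (nat \<bar>m\<bar>)))"
    proof (intro nn_integral_mono ennreal_leI)
      fix m :: int
      have "\<bar>real_of_int m * r\<bar> \<le> \<bar>x - (m0 + m) * r\<bar> + \<bar>x - m0 * r\<bar>" by (simp add: algebra_simps)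
      moreover have "\<bar>x - m0 * r\<bar> \<le> r" using m0 by (simp add: algebra_simps)
      moreover have "\<bar>real_of_int m * r\<bar> = nat \<bar>m\<bar> * r" using r by (simp add: abs_mult)
      ultimately have "nat \<bar>m\<bar> * r - r \<le> \<bar>x - (m0 + m) * r\<bar>" by linarith
      then have "a * (nat \<bar>m\<bar> * r - r) \<le> a * \<bar>x - (m0 + m) * r\<bar>" using a by (intro mult_left_mono) auto
      then have "exp (- a * \<bar>x - (m0 + m) * r\<bar>) \<le> exp (a * r + nat \<bar>m\<bar> * (- a * r))"
        by (simp add: algebra_simps)
      also have "\<dots> = f (nat \<bar>m\<bar>)" by (simp only: f_def exp_add exp_of_nat_mult)
      finally show "exp (- a * \<bar>x - (m0 + m) * r\<bar>) \<le> f (nat \<bar>m\<bar>)" .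
    qed
    also have "\<dots> \<le> 2 * (\<Sum>n. ennreal (f n))" by (rule nsum_int_le)
    also have "\<dots> = ennreal K" unfolding sf K_def using sum_pos by (simp add: ennreal_mult')
    finally show ?thesis .
  qed
  show ?thesis
  proof (rule that[of "K * K"])
    show "K * K > 0" using sum_pos by (simp add: K_def)
    fix u
    have "nsum (\<lambda>i. ennreal (exp (- t * cmod (u - latt r i))))
        \<le> nsum (\<lambda>(m, n). ennreal (exp (- a * \<bar>Re u - real_of_int m * r\<bar>)) * ennreal (exp (- a * \<bar>Im u - real_of_int n * r\<bar>)))"
    proof (rule nn_integral_mono, clarify)
      fix m n :: int
      have "\<bar>Re u - m * r\<bar> \<le> cmod (u - latt r (m, n))" "\<bar>Im u - n * r\<bar> \<le> cmod (u - latt r (m, n))"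
        using abs_Re_le_cmod[of "u - latt r (m, n)"] abs_Im_le_cmod[of "u - latt r (m, n)"] by (auto simp: latt_def)
      then have "a * (\<bar>Re u - m * r\<bar> + \<bar>Im u - n * r\<bar>) \<le> a * (2 * cmod (u - latt r (m, n)))"
        using a by (intro mult_left_mono) auto
      then have "exp (- t * cmod (u - latt r (m, n))) \<le> exp (- a * \<bar>Re u - m * r\<bar> + - a * \<bar>Im u - n * r\<bar>)"
        by (simp add: a_def algebra_simps)
      then show "ennreal (exp (- t * cmod (u - latt r (m, n)))) \<le>
          ennreal (exp (- a * \<bar>Re u - m * r\<bar>)) * ennreal (exp (- a * \<bar>Im u - n * r\<bar>))"
        by (simp only: exp_add ennreal_mult'[symmetric] exp_ge_zero) (rule ennreal_leI)
    qed
    also have "\<dots> = nsum (\<lambda>m::int. ennreal (exp (- a * \<bar>Re u - m * r\<bar>))) * nsum (\<lambda>m::int. ennreal (exp (- a * \<bar>Im u - m * r\<bar>)))"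
      by (rule nsum_prod)
    also have "\<dots> \<le> ennreal K * ennreal K" by (intro mult_mono one) auto
    also have "\<dots> = ennreal (K * K)" using sum_pos by (subst ennreal_mult'[symmetric]) (simp_all add: K_def)
    finally show "nsum (\<lambda>i. ennreal (exp (- t * cmod (u - latt r i)))) \<le> ennreal (K * K)" .
  qed
qed

text \<open>The modulus is at least each coordinate, so the exponent can be split evenly between
  them; both one-dimensional series have exponent p/2, which exceeds 1 precisely when p > 2.\<close>

lemma nsum_latt_powr:
  assumes r: "r > 0" and p: "p > 2"
  shows "nsum (\<lambda>i. ennreal ((1 + cmod (latt r i)) powr - p)) < \<infinity>"
proof -
  define f where "f n = (1 + real n * r) powr - (p / 2)" for n
  have "summable (\<lambda>n. r powr - (p / 2) * real n powr - (p / 2))"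
    using p by (intro summable_mult) (simp add: summable_real_powr_iff)
  moreover have "norm (f n) \<le> r powr - (p / 2) * real n powr - (p / 2)" if "n \<ge> 1" for n
  proof -
    have "f n \<le> (real n * r) powr - (p / 2)"
      unfolding f_def using r p that by (intro powr_mono2') auto
    then show ?thesis using r by (simp add: powr_mult mult.commute f_def)
  qed
  ultimately have "summable f" by (rule summable_comparison_test')
  moreover have "f n \<ge> 0" for n by (simp add: f_def)
  ultimately have sf: "(\<Sum>n. ennreal (f n)) = ennreal (\<Sum>n. f n)"
    by (intro suminf_ennreal2)
  have one: "nsum (\<lambda>m::int. ennreal (f (nat \<bar>m\<bar>))) < \<infinity>"
    using nsum_int_le[of "\<lambda>n. ennreal (f n)"] unfolding sf
    by (rule le_less_trans) (simp add: ennreal_mult_less_top)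
  have "nsum (\<lambda>i. ennreal ((1 + cmod (latt r i)) powr - p))
      \<le> nsum (\<lambda>(m, n). ennreal (f (nat \<bar>m\<bar>)) * ennreal (f (nat \<bar>n\<bar>)))"
  proof (rule nn_integral_mono, clarify)
    fix m n :: int
    let ?z = "latt r (m, n)"
    have "nat \<bar>m\<bar> * r \<le> cmod ?z" "nat \<bar>n\<bar> * r \<le> cmod ?z"
      using abs_Re_le_cmod[of ?z] abs_Im_le_cmod[of ?z] r by (auto simp: latt_def abs_mult)
    then have "(1 + cmod ?z) powr - (p / 2) \<le> f (nat \<bar>m\<bar>)" "(1 + cmod ?z) powr - (p / 2) \<le> f (nat \<bar>n\<bar>)"
      unfolding f_def using p r by (intro powr_mono2'; simp add: add_pos_nonneg)+
    then have "(1 + cmod ?z) powr - (p / 2) * (1 + cmod ?z) powr - (p / 2) \<le> f (nat \<bar>m\<bar>) * f (nat \<bar>n\<bar>)"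
      by (intro mult_mono) (auto simp: f_def)
    then have "(1 + cmod ?z) powr - p \<le> f (nat \<bar>m\<bar>) * f (nat \<bar>n\<bar>)"
      by (simp add: powr_add[symmetric])
    then show "ennreal ((1 + cmod ?z) powr - p) \<le> ennreal (f (nat \<bar>m\<bar>)) * ennreal (f (nat \<bar>n\<bar>))"
      by (subst ennreal_mult'[symmetric]) (auto simp: f_def intro!: ennreal_leI)
  qed
  also have "\<dots> = nsum (\<lambda>m::int. ennreal (f (nat \<bar>m\<bar>))) * nsum (\<lambda>m::int. ennreal (f (nat \<bar>m\<bar>)))"
    by (rule nsum_prod)
  also have "\<dots> < \<infinity>" using one by (simp add: ennreal_mult_less_top)
  finally show ?thesis .
qed

lemma latt_covers:
  assumes "r > 0"
  obtains i where "z \<in> sq r (latt r i)"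
proof (rule that[of "(\<lfloor>Re z / r\<rfloor>, \<lfloor>Im z / r\<rfloor>)"])
  show "z \<in> sq r (latt r (\<lfloor>Re z / r\<rfloor>, \<lfloor>Im z / r\<rfloor>))"
    using floor_divide_lower[OF assms, of "Re z"] floor_divide_upper[OF assms, of "Re z"]
      floor_divide_lower[OF assms, of "Im z"] floor_divide_upper[OF assms, of "Im z"]
    by (auto simp: sq_iff latt_def algebra_simps)
qed

lemma borel_measurable_lebesgue_continuous:
  assumes "continuous_on UNIV f" "sets M = sets lebesgue"
  shows "f \<in> borel_measurable M"
proof -
  have "f \<in> borel_measurable lebesgue"
    using borel_measurable_continuous_onI[OF assms(1)] by (simp add: measurable_completion)
  then show ?thesis using measurable_cong_sets[OF assms(2) refl] by blast
qed

lemma nn_integral_latt_le: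
  assumes r: "r > 0" and [simp]: "sets M = sets lebesgue" and [measurable]: "f \<in> borel_measurable M"
  shows "(\<integral>\<^sup>+z. f z \<partial>M) \<le> nsum (\<lambda>i. \<integral>\<^sup>+z. f z * indicator (sq r (latt r i)) z \<partial>M)"
proof -
  have "(\<integral>\<^sup>+z. f z \<partial>M) \<le> (\<integral>\<^sup>+z. nsum (\<lambda>i. f z * indicator (sq r (latt r i)) z) \<partial>M)"
  proof (rule nn_integral_mono)
    fix z
    obtain i where i: "z \<in> sq r (latt r i)" by (rule latt_covers[OF r])
    have "f z * indicator (sq r (latt r i)) z \<le> nsum (\<lambda>i. f z * indicator (sq r (latt r i)) z)"
      by (rule nn_integral_ge_point) simp
    then show "f z \<le> nsum (\<lambda>i. f z * indicator (sq r (latt r i)) z)" using i by simp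
  qed
  also have "\<dots> = nsum (\<lambda>i. \<integral>\<^sup>+z. f z * indicator (sq r (latt r i)) z \<partial>M)"
    by (rule nn_integral_count_space_nn_integral)
      (simp_all add: borel_measurable_times_ennreal borel_measurable_indicator)
  finally show ?thesis .
qed

lemma nn_integral_sq_le:
  assumes M: "sets M = sets lebesgue" and f: "\<And>z. z \<in> sq r c \<Longrightarrow> f z \<le> B"
  shows "(\<integral>\<^sup>+z. f z * indicator (sq r c) z \<partial>M) \<le> B * emeasure M (sq r c)"
proof -
  have "(\<integral>\<^sup>+z. f z * indicator (sq r c) z \<partial>M) \<le> (\<integral>\<^sup>+z. B * indicator (sq r c) z \<partial>M)"
    using f by (intro nn_integral_mono) (auto simp: indicator_def)
  also have "\<dots> = B * emeasure M (sq r c)" using M by (intro nn_integral_cmult_indicator) simp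
  finally show ?thesis .
qed

section \<open>Growth of the mass of squares under translation\<close>

context comparison_weight begin

definition mass :: "complex \<Rightarrow> real" where "mass c = measure (wmeas w) (sq r c)"

lemma emeasure_sq: "emeasure (wmeas w) (sq r c) = ennreal (mass c)"
  unfolding mass_def by (rule wmeas_finite[OF weight compact_sq]) auto

lemma mass_pos: "mass c > 0"
proof -
  have "emeasure (wmeas w) (sq r c) \<noteq> 0"
  proof
    assume "emeasure (wmeas w) (sq r c) = 0"
    then have "(\<integral>\<^sup>+z. ennreal (w z) * indicator (sq r c) z \<partial>lebesgue) = 0"
      using weight_measurable[OF weight] by (simp add: wmeas_def emeasure_density)
    then have "AE z in lebesgue. ennreal (w z) * indicator (sq r c) z = 0"
      using weight_measurable[OF weight] by (subst (asm) nn_integral_0_iff_AE) auto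
    with weight_pos have "AE z in lebesgue. z \<notin> sq r c"
      by eventually_elim (auto simp: indicator_def)
    then have "emeasure lebesgue (sq r c) = 0"
      by (subst (asm) AE_iff_measurable[of "sq r c"]) auto
    then have "measure lebesgue (sq r c) = 0" by (simp only: measure_def) simp
    then show False using r by (simp add: measure_sq)
  qed
  then show ?thesis unfolding emeasure_sq by (simp add: mass_def zero_less_measure_iff)
qed

text \<open>Two squares displaced by at most half a side in each coordinate share a square of half
  the side, with lower left corner \<open>a\<close>. It has a quarter of the area, and the
  comparison property bounds its mass from below.\<close>

lemma mass_shift:
  assumes "\<bar>Re d\<bar> \<le> r / 2" "\<bar>Im d\<bar> \<le> r / 2"
  shows "mass c \<le> C * 4 ^ k * mass (c + d)"
proof -
  define a where "a = c + Complex (max 0 (Re d)) (max 0 (Im d))"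
  have sub: "sq (r / 2) a \<subseteq> sq r c \<inter> sq r (c + d)"
    using assms by (auto simp: sq_iff a_def)
  have "mass c * (measure lebesgue (sq (r / 2) a) / r\<^sup>2) ^ k \<le> C * measure (wmeas w) (sq (r / 2) a)"
    unfolding mass_def using sub by (intro comparison) auto
  also have "measure lebesgue (sq (r / 2) a) / r\<^sup>2 = 1 / 4"
    using r by (simp add: measure_sq power2_eq_square)
  also have "measure (wmeas w) (sq (r / 2) a) \<le> mass (c + d)"
    unfolding mass_def using sub emeasure_sq[of "c + d"]
    by (intro measure_mono_fmeasurable) (auto simp: fmeasurable_def)
  finally have "mass c * (1 / 4) ^ k \<le> C * mass (c + d)" using C by simp
  then show ?thesis by (simp add: power_divide field_simps)
qed

text \<open>A chain of short steps from c to c', in number proportional to their distance, costs a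
  factor D each, which is exponential in the distance.\<close>

lemma mass_doubling:
  obtains D \<kappa> where "D > 0" "\<kappa> > 0" "\<And>c c'. mass c \<le> D * exp (\<kappa> * cmod (c - c')) * mass c'"
proof -
  \<comment> \<open>The maximum with 2 makes \<open>ln D\<close>, and so the rate \<kappa>,
    positive.\<close>
  define D where "D = max (C * 4 ^ k) 2"
  have D: "D > 1" by (simp add: D_def)
  have shift: "mass c \<le> D * mass (c + d)" if "\<bar>Re d\<bar> \<le> r / 2" "\<bar>Im d\<bar> \<le> r / 2" for c d
  proof -
    have "C * 4 ^ k * mass (c + d) \<le> D * mass (c + d)"
      by (intro mult_right_mono) (auto simp: D_def mass_def)
    then show ?thesis using mass_shift[OF that, of c] by linarith
  qed
  have steps: "mass c \<le> D ^ n * mass (c + of_nat n * d)" if "\<bar>Re d\<bar> \<le> r / 2" "\<bar>Im d\<bar> \<le> r / 2" for c d n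
  proof (induction n)
    case (Suc n)
    have "mass (c + of_nat n * d) \<le> D * mass (c + of_nat n * d + d)" by (rule shift[OF that])
    then have "D ^ n * mass (c + of_nat n * d) \<le> D ^ n * (D * mass (c + of_nat n * d + d))"
      using D by (intro mult_left_mono) auto
    also have "c + of_nat n * d + d = c + of_nat (Suc n) * d" by (simp add: algebra_simps)
    finally show ?case using Suc by (simp add: algebra_simps)
  qed simp
  define \<kappa> where "\<kappa> = 2 * ln D / r"
  show ?thesis
  proof (rule that[of D \<kappa>])
    show "D > 0" "\<kappa> > 0" using D r by (auto simp: \<kappa>_def)
    fix c c'
    define x where "x = 2 * cmod (c - c') / r"
    \<comment> \<open>The successor makes n positive even when c = c', and strictly larger than x,
      so that each step is short enough.\<close>
    define n where "n = Suc (nat \<lfloor>x\<rfloor>)"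
    have x: "x \<ge> 0" using r by (simp add: x_def)
    have n: "n > 0" "n > x" "n \<le> x + 1" using x by (auto simp: n_def) linarith+
    define d where "d = (c' - c) / of_nat n"
    have "cmod d = cmod (c - c') / n" by (simp add: d_def norm_divide norm_minus_commute)
    also have "\<dots> \<le> r / 2" using n r by (simp add: x_def field_simps)
    finally have "\<bar>Re d\<bar> \<le> r / 2" "\<bar>Im d\<bar> \<le> r / 2"
      using abs_Re_le_cmod[of d] abs_Im_le_cmod[of d] by auto
    then have "mass c \<le> D ^ n * mass (c + of_nat n * d)" by (rule steps)
    also have "c + of_nat n * d = c'" using n by (simp add: d_def)
    also have "D ^ n * mass c' \<le> D * exp (\<kappa> * cmod (c - c')) * mass c'"
    proof (rule mult_right_mono)
      have "D ^ n = D powr n" using D by (simp add: powr_realpow)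
      also have "\<dots> \<le> D powr (x + 1)" using D n by (intro powr_mono) auto
      also have "\<dots> = D * exp (\<kappa> * cmod (c - c'))"
      proof -
        have "x * ln D = \<kappa> * cmod (c - c')" by (simp add: x_def \<kappa>_def)
        then show ?thesis using D by (simp add: powr_add powr_def[of D x])
      qed
      finally show "D ^ n \<le> D * exp (\<kappa> * cmod (c - c'))" .
    qed (simp add: mass_def)
    finally show "mass c \<le> D * exp (\<kappa> * cmod (c - c')) * mass c'" .
  qed
qed

text \<open>The decay rate is taken one larger than the growth rate of \<open>mass_doubling\<close>.
  After the masses of the lattice squares have been compared with \<open>mass c\<close>, a factor
  with rate 1 is left to make the lattice sum converge.\<close>

lemma exp_kernel_integral:
  obtains \<kappa> K where "\<kappa> > 0" "K > 0"
    "\<And>c. (\<integral>\<^sup>+z. ennreal (exp (- \<kappa> * cmod (z - c))) \<partial>wmeas w) \<le> ennreal (K * mass c)"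
proof -
  obtain D \<kappa>0 where D: "D > 0" "\<kappa>0 > 0" "\<And>c c'. mass c \<le> D * exp (\<kappa>0 * cmod (c - c')) * mass c'"
    using mass_doubling by metis
  obtain K1 where K1: "K1 > 0" "\<And>u. nsum (\<lambda>i. ennreal (exp (- 1 * cmod (u - latt r i)))) \<le> ennreal K1"
    using nsum_latt_exp[OF r, of 1] by (metis zero_less_one)
  define \<kappa> where "\<kappa> = \<kappa>0 + 1"
  define K where "K = exp (\<kappa> * (2 * r)) * D * K1"
  show ?thesis
  proof (rule that[of \<kappa> K])
    show "\<kappa> > 0" "K > 0" using D K1 by (auto simp: \<kappa>_def K_def)
    fix c
    let ?f = "\<lambda>z. ennreal (exp (- \<kappa> * cmod (z - c)))"
    have "(\<integral>\<^sup>+z. ?f z \<partial>wmeas w) \<le> nsum (\<lambda>i. \<integral>\<^sup>+z. ?f z * indicator (sq r (latt r i)) z \<partial>wmeas w)"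
      by (rule nn_integral_latt_le[OF r])
        (auto intro!: measurable_compose[OF _ measurable_ennreal] borel_measurable_lebesgue_continuous continuous_intros)
    also have "\<dots> \<le> nsum (\<lambda>i. ennreal (exp (\<kappa> * (2 * r)) * D * mass c) * ennreal (exp (- 1 * cmod (c - latt r i))))"
    proof (rule nn_integral_mono)
      fix i
      let ?z = "latt r i"
      have "(\<integral>\<^sup>+z. ?f z * indicator (sq r ?z) z \<partial>wmeas w) \<le> ennreal (exp (\<kappa> * (2 * r) - \<kappa> * cmod (c - ?z))) * emeasure (wmeas w) (sq r ?z)"
      proof (rule nn_integral_sq_le)
        fix z assume "z \<in> sq r ?z"
        then have "cmod (z - ?z) \<le> 2 * r" using r by (rule dist_sq)
        then have "cmod (c - ?z) \<le> cmod (z - c) + 2 * r"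
          using norm_triangle_ineq4[of "z - ?z" "z - c"] by simp
        then have "\<kappa> * cmod (c - ?z) \<le> \<kappa> * (cmod (z - c) + 2 * r)"
          using D by (intro mult_left_mono) (auto simp: \<kappa>_def)
        then show "?f z \<le> ennreal (exp (\<kappa> * (2 * r) - \<kappa> * cmod (c - ?z)))"
          by (intro ennreal_leI) (simp add: algebra_simps)
      qed simp
      also have "\<dots> = ennreal (exp (\<kappa> * (2 * r) - \<kappa> * cmod (c - ?z)) * mass ?z)"
        unfolding emeasure_sq by (simp add: ennreal_mult')
      also have "\<dots> \<le> ennreal (exp (\<kappa> * (2 * r) - \<kappa> * cmod (c - ?z)) * (D * exp (\<kappa>0 * cmod (?z - c)) * mass c))"
        by (intro ennreal_leI mult_left_mono D(3)) auto
      also have "exp (\<kappa> * (2 * r) - \<kappa> * cmod (c - ?z)) * (D * exp (\<kappa>0 * cmod (?z - c)) * mass c)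
          = (exp (\<kappa> * (2 * r)) * D * mass c) * (exp (- \<kappa> * cmod (c - ?z)) * exp (\<kappa>0 * cmod (c - ?z)))"
        by (simp add: exp_diff exp_minus field_simps norm_minus_commute)
      also have "exp (- \<kappa> * cmod (c - ?z)) * exp (\<kappa>0 * cmod (c - ?z)) = exp (- 1 * cmod (c - ?z))"
        by (simp add: \<kappa>_def algebra_simps flip: exp_add)
      finally show "(\<integral>\<^sup>+z. ?f z * indicator (sq r ?z) z \<partial>wmeas w)
          \<le> ennreal (exp (\<kappa> * (2 * r)) * D * mass c) * ennreal (exp (- 1 * cmod (c - latt r i)))"
        by (subst (asm) ennreal_mult'') simp_all
    qed
    also have "\<dots> = ennreal (exp (\<kappa> * (2 * r)) * D * mass c) * nsum (\<lambda>i. ennreal (exp (- 1 * cmod (c - latt r i))))"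
      by (rule nn_integral_cmult) simp
    also have "\<dots> \<le> ennreal (exp (\<kappa> * (2 * r)) * D * mass c) * ennreal K1"
      by (intro mult_left_mono K1) simp
    also have "\<dots> = ennreal (K * mass c)"
      using K1 by (subst ennreal_mult''[symmetric]) (simp_all add: K_def mult_ac)
    finally show "(\<integral>\<^sup>+z. ?f z \<partial>wmeas w) \<le> ennreal (K * mass c)" .
  qed
qed

end

section \<open>Pointwise estimates\<close>

text \<open>At a point maximizing \<open>|h| d\<^sup>k\<close>, where \<open>d\<close> is the distance to the boundary of a disc, Cauchy's
  estimate keeps \<open>|h|\<close> above half of its value on a square of side comparable to \<open>d\<close>.  This
  replaces the subharmonicity of \<open>|h|\<^sup>s\<close> for small \<open>s\<close>.\<close>

lemma weighted_maximum:
  assumes h: "h holomorphic_on UNIV" and R: "R > 0" and k: "k > 0"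
  obtains u d where "0 < d" "cmod (u - z) + d \<le> R" "cmod (h z) * R ^ k \<le> cmod (h u) * d ^ k"
    "\<And>v. cmod (v - u) \<le> d / 2 ^ (k + 3) \<Longrightarrow> cmod (h u) / 2 \<le> cmod (h v)"
proof -
  define \<psi> where "\<psi> u = cmod (h u) * (R - cmod (u - z)) ^ k" for u
  have ch: "continuous_on A h" for A
    using holomorphic_on_imp_continuous_on[OF h] continuous_on_subset by blast
  have "continuous_on (cball z R) \<psi>" unfolding \<psi>_def[abs_def] by (intro continuous_intros ch)
  moreover have "cball z R \<noteq> {}" using R by simp
  ultimately have "\<exists>u\<in>cball z R. \<forall>v\<in>cball z R. \<psi> v \<le> \<psi> u"
    by (intro continuous_attains_sup compact_cball)
  then obtain u where u: "u \<in> cball z R" "\<And>v. v \<in> cball z R \<Longrightarrow> \<psi> v \<le> \<psi> u" by blast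
  have "\<psi> z \<le> \<psi> u" using R by (intro u) simp
  then have zu: "cmod (h z) * R ^ k \<le> \<psi> u" by (simp add: \<psi>_def)
  show ?thesis
  proof (cases "h z = 0")
    case True
    then show ?thesis using that[of R z] R by auto
  next
    case False
    define d where "d = R - cmod (u - z)"
    have "d \<ge> 0" using u(1) by (simp add: d_def dist_norm norm_minus_commute)
    have "d \<noteq> 0"
    proof
      assume "d = 0"
      then have "\<psi> u = 0" using k by (simp add: \<psi>_def d_def)
      then show False using zu False zero_less_power[OF R, of k] by (simp add: mult_le_0_iff)
    qed
    then have d: "d > 0" using \<open>d \<ge> 0\<close> by simp
      \<comment> \<open>Within distance d/2 of u the distance to the boundary is still at least d/2,
        so maximality at u limits the growth of h to \<open>2 ^ k\<close>.\<close>
      have hv: "cmod (h v) \<le> 2 ^ k * cmod (h u)" if "cmod (v - u) \<le> d / 2" for v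
      proof -
        have "cmod (v - z) \<le> cmod (v - u) + cmod (u - z)"
          using norm_triangle_ineq[of "v - u" "u - z"] by simp
        then have dv: "R - cmod (v - z) \<ge> d / 2" using that by (simp add: d_def)
        then have "v \<in> cball z R" using d by (simp add: dist_norm norm_minus_commute)
        then have "\<psi> v \<le> \<psi> u" by (rule u)
        moreover have "cmod (h v) * (d / 2) ^ k \<le> \<psi> v"
          unfolding \<psi>_def using dv d by (intro mult_left_mono power_mono) auto
        ultimately have "cmod (h v) * (d / 2) ^ k \<le> cmod (h u) * d ^ k"
          by (simp add: \<psi>_def d_def)
        then show ?thesis using d by (simp add: power_divide field_simps)
      qed
      \<comment> \<open>Cauchy's estimate on circles of radius d/4, which stay inside the disc of
        radius d/2 around u.\<close>
      have deriv: "cmod (deriv h v) \<le> 2 ^ (k + 2) * cmod (h u) / d" if v: "cmod (v - u) \<le> d / 4" for v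
      proof -
        have "cmod ((deriv ^^ 1) h v) \<le> fact 1 * (2 ^ k * cmod (h u)) / (d / 4) ^ 1"
        proof (rule Cauchy_inequality)
          show "h holomorphic_on ball v (d / 4)" using h holomorphic_on_subset by blast
          show "continuous_on (cball v (d / 4)) h" by (rule ch)
          show "0 < d / 4" using d by simp
          fix x assume "cmod (v - x) = d / 4"
          then have "cmod (x - u) \<le> d / 2"
            using v norm_triangle_ineq[of "x - v" "v - u"] by (simp add: norm_minus_commute)
          then show "cmod (h x) \<le> 2 ^ k * cmod (h u)" by (rule hv)
        qed
        then show ?thesis by (simp add: power_add mult_ac)
      qed
      show ?thesis
      proof (rule that[of d u])
        show "0 < d" "cmod (u - z) + d \<le> R" by (use d in \<open>auto simp: d_def\<close>)
        show "cmod (h z) * R ^ k \<le> cmod (h u) * d ^ k" using zu by (simp add: \<psi>_def d_def)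
        \<comment> \<open>This radius times the derivative bound is exactly half of the modulus at
          u.\<close>
        fix v assume v: "cmod (v - u) \<le> d / 2 ^ (k + 3)"
        have "d / 2 ^ (k + 3) \<le> d / 4"
          using d power_increasing[of 2 "k + 3" "2::real"] by (intro divide_left_mono) auto
        then have v4: "cmod (v - u) \<le> d / 4" using v by linarith
        have "cmod (h v - h u) \<le> (2 ^ (k + 2) * cmod (h u) / d) * cmod (v - u)"
        proof (rule field_differentiable_bound[of "cball u (d / 4)" h "deriv h"])
          fix y assume y: "y \<in> cball u (d / 4)"
          show "(h has_field_derivative deriv h y) (at y within cball u (d / 4))"
            using holomorphic_derivI[OF h open_UNIV, of y] has_field_derivative_at_within by blast
          show "cmod (deriv h y) \<le> 2 ^ (k + 2) * cmod (h u) / d"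
            using y by (intro deriv) (simp add: dist_norm norm_minus_commute)
        qed (use v4 d in \<open>auto simp: dist_norm norm_minus_commute\<close>)
        also have "\<dots> \<le> (2 ^ (k + 2) * cmod (h u) / d) * (d / 2 ^ (k + 3))"
          using d v by (intro mult_left_mono) auto
        also have "\<dots> = cmod (h u) / 2" using d by (simp add: power_add)
        finally show "cmod (h u) / 2 \<le> cmod (h v)"
          using norm_triangle_ineq2[of "h u" "h v"] by (simp add: norm_minus_commute)
      qed
  qed
qed

section \<open>Submean value inequalities for the weighted norm\<close>

locale fock_weight = comparison_weight w r k C for w r k C +
  fixes \<alpha> :: real
  assumes \<alpha>: "\<alpha> > 0"
begin

definition phi :: "cfun \<Rightarrow> complex \<Rightarrow> real" where
  "phi f z = (cmod (f z))\<^sup>2 * exp (- \<alpha> * (cmod z)\<^sup>2)"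

abbreviation nu :: "complex measure" where "nu \<equiv> wmeas w"

text \<open>The squared norm with infinite values allowed, so that estimates can be stated for every
  entire function before membership in the space is known.\<close>

definition nrm :: "cfun \<Rightarrow> ennreal" where
  "nrm f = (\<integral>\<^sup>+z. ennreal (phi f z) \<partial>nu)"

definition entire :: "cfun \<Rightarrow> bool" where "entire f \<longleftrightarrow> f holomorphic_on UNIV"

lemma entire_continuous: "entire f \<Longrightarrow> continuous_on A f"
  unfolding entire_def using holomorphic_on_imp_continuous_on continuous_on_subset by blast

lemma phi_nonneg [simp]: "0 \<le> phi f z" by (simp add: phi_def)

lemma borel_measurable_nu [measurable]: "continuous_on UNIV (f :: complex \<Rightarrow> real) \<Longrightarrow> f \<in> borel_measurable nu"
  by (rule borel_measurable_lebesgue_continuous) simp_all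

lemma ennreal_measurable_nu: "continuous_on UNIV (f :: complex \<Rightarrow> real) \<Longrightarrow> (\<lambda>z. ennreal (f z)) \<in> borel_measurable nu"
  by (intro measurable_compose[OF borel_measurable_nu measurable_ennreal])

lemma phi_continuous: "entire f \<Longrightarrow> continuous_on UNIV (phi f)"
  unfolding phi_def[abs_def] by (intro continuous_intros entire_continuous)

lemma phi_measurable: "entire f \<Longrightarrow> (\<lambda>z. ennreal (phi f z)) \<in> borel_measurable nu"
  by (intro ennreal_measurable_nu phi_continuous)

definition csq :: "complex \<Rightarrow> complex set" where "csq z = sq r (z - Complex (r / 2) (r / 2))"

lemma csq_iff: "u \<in> csq z \<longleftrightarrow> \<bar>Re u - Re z\<bar> \<le> r / 2 \<and> \<bar>Im u - Im z\<bar> \<le> r / 2"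
  unfolding csq_def sq_iff abs_diff_le_iff by auto

lemma csq_dist: "u \<in> csq z \<Longrightarrow> cmod (u - z) \<le> r"
  using cmod_le[of "u - z"] by (auto simp: csq_iff)

lemma csq_measurable [measurable, simp]: "csq z \<in> sets lebesgue"
  by (simp add: csq_def)

text \<open>An exponential factor makes the Gaussian harmless near z and reduces the claim to a
  holomorphic h. \<open>weighted_maximum\<close> finds a point u and a small square E of side s near
  it on which h keeps half of its value at u. The smallness of \<open>nu\<close> on E costs the n-th
  power of \<open>s\<^sup>2 / r\<^sup>2\<close>, and the gain in the squared modulus at u over that
  at z offsets exactly this power.\<close>

lemma submean_csq:
  obtains K where "K > 0" "\<And>f z. entire f \<Longrightarrow>
    ennreal (phi f z * mass (z - Complex (r / 2) (r / 2))) \<le> ennreal K * (\<integral>\<^sup>+u. ennreal (phi f u) * indicator (csq z) u \<partial>nu)"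
proof -
  \<comment> \<open>\<open>weighted_maximum\<close> asks for a positive exponent, and k may be 0.
    Raising k is allowed because the area ratio is at most 1.\<close>
  define n where "n = Suc k"
  have n: "n > 0" by (simp add: n_def)
  \<comment> \<open>The 4 comes from squaring the half, C from the comparison property, the next
    factor from \<open>d = s * 2 ^ (n + 3)\<close>, and the last from the disc of radius
    r/2.\<close>
  define K0 where "K0 = 4 * C * (2 ^ (n + 3)) ^ (2 * n) * 2 ^ (2 * n)"
  define K where "K = K0 * exp (\<alpha> * r\<^sup>2)"
  have K0: "K0 > 0" using C by (simp add: K0_def)
  show ?thesis
  proof (rule that[of K])
    show "K > 0" using K0 by (simp add: K_def)
    fix f z assume f: "entire f"
    define m where "m = mass (z - Complex (r / 2) (r / 2))"
    have m: "m > 0" by (simp add: m_def mass_pos)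
    \<comment> \<open>Completing the square in the exponent: the squared modulus of h is
      \<open>phi f\<close> times the exponential of
      \<open>\<alpha> * (cmod (u - z))\<^sup>2\<close>, which is bounded on the square around
      z.\<close>
    define h where "h u = f u * exp (of_real (- \<alpha>) * cnj z * u + of_real (\<alpha> * (cmod z)\<^sup>2 / 2))" for u
    have h: "h holomorphic_on UNIV"
      using f unfolding h_def[abs_def] entire_def by (intro holomorphic_intros)
    have hphi: "(cmod (h u))\<^sup>2 = phi f u * exp (\<alpha> * (cmod (u - z))\<^sup>2)" for u
    proof -
      have "(cmod (h u))\<^sup>2 = (cmod (f u))\<^sup>2 * exp (2 * (- \<alpha> * Re (cnj z * u) + \<alpha> * (cmod z)\<^sup>2 / 2))"
        by (simp add: h_def norm_mult norm_exp_eq_Re power_mult_distrib mult.assoc flip: exp_double)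
      also have "2 * (- \<alpha> * Re (cnj z * u) + \<alpha> * (cmod z)\<^sup>2 / 2) = - \<alpha> * (cmod u)\<^sup>2 + \<alpha> * (cmod (u - z))\<^sup>2"
        unfolding cmod_power2 by (simp add: power2_eq_square algebra_simps)
      finally show ?thesis by (simp only: phi_def exp_add mult.assoc)
    qed
    obtain u d where ud: "0 < d" "cmod (u - z) + d \<le> r / 2" "cmod (h z) * (r / 2) ^ n \<le> cmod (h u) * d ^ n"
      "\<And>v. cmod (v - u) \<le> d / 2 ^ (n + 3) \<Longrightarrow> cmod (h u) / 2 \<le> cmod (h v)"
      using weighted_maximum[OF h half_gt_zero[OF r] n, of z] by metis
    define s where "s = d / 2 ^ (n + 3)"
    have s: "s > 0" "s \<le> d" using ud(1) by (auto simp: s_def divide_le_eq)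
    define E where "E = sq s (u - Complex (s / 2) (s / 2))"
    have Eu: "cmod (v - u) \<le> s" if "v \<in> E" for v
      using cmod_le[of "v - u"] that by (auto simp: E_def sq_iff)
    have Esub: "E \<subseteq> csq z"
    proof
      fix v assume "v \<in> E"
      then have "cmod (v - z) \<le> r / 2"
        using Eu[of v] norm_triangle_ineq[of "v - u" "u - z"] ud(2) s(2) by simp
      then show "v \<in> csq z"
        using abs_Re_le_cmod[of "v - z"] abs_Im_le_cmod[of "v - z"] by (simp add: csq_iff)
    qed
    have "s \<le> r" using s ud(2) r norm_ge_zero[of "u - z"] by linarith
    then have sr: "s\<^sup>2 / r\<^sup>2 \<le> 1" "0 \<le> s\<^sup>2 / r\<^sup>2"
      using s r by (auto simp: divide_le_eq intro!: power_mono)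
    have "m * (s\<^sup>2 / r\<^sup>2) ^ n \<le> m * (s\<^sup>2 / r\<^sup>2) ^ k"
      using sr m by (intro mult_left_mono power_decreasing) (auto simp: n_def)
    also have "\<dots> \<le> C * measure nu E"
      using comparison[of E "z - Complex (r / 2) (r / 2)"] Esub s
      by (simp add: m_def mass_def E_def measure_sq csq_def)
    finally have E_large: "m * (s\<^sup>2 / r\<^sup>2) ^ n \<le> C * measure nu E" .
    have Em: "E \<in> sets lebesgue" by (simp add: E_def)
    have Efin: "emeasure nu E = ennreal (measure nu E)"
      unfolding E_def by (rule wmeas_finite[OF weight compact_sq order_refl]) simp
    have "ennreal ((cmod (h u))\<^sup>2 / 4 * measure nu E) = (\<integral>\<^sup>+v. ennreal ((cmod (h u))\<^sup>2 / 4) * indicator E v \<partial>nu)"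
      using Efin Em by (subst nn_integral_cmult_indicator) (simp_all flip: ennreal_mult')
    also have "\<dots> \<le> (\<integral>\<^sup>+v. ennreal (exp (\<alpha> * r\<^sup>2)) * (ennreal (phi f v) * indicator (csq z) v) \<partial>nu)"
    proof (rule nn_integral_mono)
      fix v
      show "ennreal ((cmod (h u))\<^sup>2 / 4) * indicator E v \<le> ennreal (exp (\<alpha> * r\<^sup>2)) * (ennreal (phi f v) * indicator (csq z) v)"
      proof (cases "v \<in> E")
        case True
        have "(cmod (h u) / 2)\<^sup>2 \<le> (cmod (h v))\<^sup>2"
          using Eu[OF True] ud(4)[of v] by (intro power_mono) (auto simp: s_def)
        also have "\<dots> \<le> phi f v * exp (\<alpha> * r\<^sup>2)"
          unfolding hphi using csq_dist[of v z] Esub True \<alpha> by (intro mult_left_mono) (auto intro!: power_mono)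
        finally have "(cmod (h u))\<^sup>2 / 4 \<le> exp (\<alpha> * r\<^sup>2) * phi f v" by (simp add: power_divide mult.commute)
        then have "ennreal ((cmod (h u))\<^sup>2 / 4) \<le> ennreal (exp (\<alpha> * r\<^sup>2)) * ennreal (phi f v)"
          by (subst ennreal_mult'[symmetric]) (auto intro: ennreal_leI)
        then show ?thesis using True Esub by auto
      qed simp
    qed
    also have "\<dots> = ennreal (exp (\<alpha> * r\<^sup>2)) * (\<integral>\<^sup>+v. ennreal (phi f v) * indicator (csq z) v \<partial>nu)"
      using phi_measurable[OF f] by (intro nn_integral_cmult borel_measurable_times_ennreal borel_measurable_indicator) auto
    finally have int: "ennreal ((cmod (h u))\<^sup>2 / 4 * measure nu E) \<le> \<dots>" .
    have "(cmod (h z))\<^sup>2 * ((r / 2) ^ n)\<^sup>2 \<le> (cmod (h u))\<^sup>2 * (d ^ n)\<^sup>2"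
      using power_mono[OF ud(3), of 2] r by (simp add: power_mult_distrib)
    also have "d = s * 2 ^ (n + 3)" by (simp add: s_def)
    finally have "(cmod (h z))\<^sup>2 * ((r / 2) ^ n)\<^sup>2 \<le> (cmod (h u))\<^sup>2 * ((s * 2 ^ (n + 3)) ^ n)\<^sup>2" .
    then have "(cmod (h z))\<^sup>2 \<le> (cmod (h u))\<^sup>2 * ((s * 2 ^ (n + 3)) ^ n)\<^sup>2 / ((r / 2) ^ n)\<^sup>2"
      using r by (simp add: pos_le_divide_eq)
    also have "\<dots> = (cmod (h u))\<^sup>2 * (s\<^sup>2 / r\<^sup>2) ^ n * (K0 / (4 * C))"
      using r C by (simp add: K0_def power_mult_distrib power_divide power_mult[symmetric] mult.commute)
    finally have "(cmod (h z))\<^sup>2 \<le> (cmod (h u))\<^sup>2 * (s\<^sup>2 / r\<^sup>2) ^ n * (K0 / (4 * C))" .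
    moreover have "(cmod (h z))\<^sup>2 = phi f z" using hphi[of z] by simp
    ultimately have "phi f z * m \<le> (cmod (h u))\<^sup>2 * (s\<^sup>2 / r\<^sup>2) ^ n * (K0 / (4 * C)) * m"
      using m by (intro mult_right_mono) auto
    also have "\<dots> = K0 / C * ((cmod (h u))\<^sup>2 / 4) * (m * (s\<^sup>2 / r\<^sup>2) ^ n)"
      by (simp add: mult_ac)
    also have "\<dots> \<le> K0 / C * ((cmod (h u))\<^sup>2 / 4) * (C * measure nu E)"
      using C K0 by (intro mult_left_mono E_large) auto
    also have "\<dots> = K0 * ((cmod (h u))\<^sup>2 / 4 * measure nu E)" using C by simp
    finally have "ennreal (phi f z * m) \<le> ennreal K0 * ennreal ((cmod (h u))\<^sup>2 / 4 * measure nu E)"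
      using K0 by (subst ennreal_mult'[symmetric]) (auto intro: ennreal_leI)
    also have "\<dots> \<le> ennreal K0 * (ennreal (exp (\<alpha> * r\<^sup>2)) * (\<integral>\<^sup>+v. ennreal (phi f v) * indicator (csq z) v \<partial>nu))"
      by (intro mult_left_mono int) simp
    also have "\<dots> = ennreal K * (\<integral>\<^sup>+v. ennreal (phi f v) * indicator (csq z) v \<partial>nu)"
      using K0 by (simp add: K_def ennreal_mult' mult.assoc)
    finally show "ennreal (phi f z * mass (z - Complex (r / 2) (r / 2)))
        \<le> ennreal K * (\<integral>\<^sup>+v. ennreal (phi f v) * indicator (csq z) v \<partial>nu)" unfolding m_def .
  qed
qed

text \<open>\<open>mass z\<close> refers to the square with lower left corner z; moving from the
  centered one is a shift by half a side.\<close>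

lemma submean_local:
  obtains K where "K > 0" "\<And>f z. entire f \<Longrightarrow>
    ennreal (phi f z * mass z) \<le> ennreal K * (\<integral>\<^sup>+u. ennreal (phi f u) * indicator (csq z) u \<partial>nu)"
proof -
  obtain K where K: "K > 0" "\<And>f z. entire f \<Longrightarrow>
    ennreal (phi f z * mass (z - Complex (r / 2) (r / 2))) \<le> ennreal K * (\<integral>\<^sup>+u. ennreal (phi f u) * indicator (csq z) u \<partial>nu)"
    using submean_csq by metis
  define c where "c = C * 4 ^ k"
  have c: "c > 0" using C by (simp add: c_def)
  show ?thesis
  proof (rule that[of "c * K"])
    show "c * K > 0" using c K by simp
    fix f z assume f: "entire f"
    have "mass z \<le> c * mass (z - Complex (r / 2) (r / 2))"
      using mass_shift[of "- Complex (r / 2) (r / 2)" z] r by (simp add: c_def)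
    then have "phi f z * mass z \<le> c * (phi f z * mass (z - Complex (r / 2) (r / 2)))"
      by (subst mult.left_commute) (intro mult_left_mono; simp)
    then have "ennreal (phi f z * mass z) \<le> ennreal c * ennreal (phi f z * mass (z - Complex (r / 2) (r / 2)))"
      using c by (subst ennreal_mult'[symmetric]) (auto intro: ennreal_leI)
    also have "\<dots> \<le> ennreal c * (ennreal K * (\<integral>\<^sup>+u. ennreal (phi f u) * indicator (csq z) u \<partial>nu))"
      by (intro mult_left_mono K(2)[OF f]) simp
    also have "\<dots> = ennreal (c * K) * (\<integral>\<^sup>+u. ennreal (phi f u) * indicator (csq z) u \<partial>nu)"
      using c by (simp add: ennreal_mult' mult.assoc)
    finally show "ennreal (phi f z * mass z) \<le> \<dots>" .
  qed
qed

lemma submean: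
  obtains K where "K > 0" "\<And>f z. entire f \<Longrightarrow> ennreal (phi f z * mass z) \<le> ennreal K * nrm f"
proof -
  obtain K where K: "K > 0" "\<And>f z. entire f \<Longrightarrow>
    ennreal (phi f z * mass z) \<le> ennreal K * (\<integral>\<^sup>+u. ennreal (phi f u) * indicator (csq z) u \<partial>nu)"
    using submean_local by metis
  show ?thesis
  proof (rule that[OF K(1)])
    fix f z assume f: "entire f"
    have "(\<integral>\<^sup>+u. ennreal (phi f u) * indicator (csq z) u \<partial>nu) \<le> nrm f"
      unfolding nrm_def by (intro nn_integral_mono) (auto simp: indicator_def)
    then show "ennreal (phi f z * mass z) \<le> ennreal K * nrm f"
      using K(2)[OF f, of z] by (meson mult_left_mono order_trans zero_le)
  qed
qed

text \<open>A smoothed local norm around c. Of the decay rate 3, a part 2 will pay for moving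
  \<open>om\<close> from c to u and the remaining 1 makes the sum over lattice points c
  converge.\<close>

definition loc :: "cfun \<Rightarrow> complex \<Rightarrow> ennreal" where
  "loc f c = (\<integral>\<^sup>+u. ennreal (phi f u * exp (- 3 * cmod (u - c))) \<partial>nu)"

lemma loc_measurable: "entire f \<Longrightarrow> (\<lambda>u. ennreal (phi f u * exp (- 3 * cmod (u - c)))) \<in> borel_measurable nu"
  by (intro ennreal_measurable_nu continuous_intros phi_continuous)

lemma submean_loc:
  obtains K where "K > 0" "\<And>f v c. entire f \<Longrightarrow> v \<in> sq r c \<Longrightarrow>
    ennreal (phi f v) \<le> ennreal (K / mass c) * loc f c"
proof -
  obtain K where K: "K > 0" "\<And>f z. entire f \<Longrightarrow>
    ennreal (phi f z * mass z) \<le> ennreal K * (\<integral>\<^sup>+u. ennreal (phi f u) * indicator (csq z) u \<partial>nu)"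
    using submean_local by metis
  obtain D \<kappa> where D: "D > 0" "\<kappa> > 0" "\<And>c c'. mass c \<le> D * exp (\<kappa> * cmod (c - c')) * mass c'"
    using mass_doubling by metis
  define D' where "D' = D * exp (\<kappa> * (2 * r))"
  \<comment> \<open>The square around v lies within 3r of c, so the kernel of \<open>loc\<close> is
    at least \<open>exp (- 9 * r)\<close> on it.\<close>
  define K' where "K' = D' * K * exp (9 * r)"
  have D': "D' > 0" using D by (simp add: D'_def)
  show ?thesis
  proof (rule that[of K'])
    show "K' > 0" using K D' by (simp add: K'_def)
    fix f v c assume f: "entire f" and v: "v \<in> sq r c"
    have vc: "cmod (v - c) \<le> 2 * r" using v r by (rule dist_sq)
    have "mass c \<le> D * exp (\<kappa> * cmod (c - v)) * mass v" by (rule D(3))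
    also have "\<dots> \<le> D' * mass v"
      unfolding D'_def using vc D
      by (intro mult_right_mono mult_left_mono) (auto simp: mass_def norm_minus_commute)
    finally have "phi f v * mass c \<le> D' * (phi f v * mass v)"
      using mult_left_mono[of "mass c" "D' * mass v" "phi f v"] by (simp add: mult_ac)
    then have "phi f v \<le> D' / mass c * (phi f v * mass v)"
      using mass_pos[of c] by (simp add: field_simps)
    then have "ennreal (phi f v) \<le> ennreal (D' / mass c) * ennreal (phi f v * mass v)"
      using mass_pos[of c] D' by (subst ennreal_mult'[symmetric]) (auto intro: ennreal_leI)
    also have "\<dots> \<le> ennreal (D' / mass c) * (ennreal K * (ennreal (exp (9 * r)) * loc f c))"
    proof (intro mult_left_mono order_trans[OF K(2)[OF f]])
      have "(\<integral>\<^sup>+u. ennreal (phi f u) * indicator (csq v) u \<partial>nu)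
          \<le> (\<integral>\<^sup>+u. ennreal (exp (9 * r)) * ennreal (phi f u * exp (- 3 * cmod (u - c))) \<partial>nu)"
      proof (rule nn_integral_mono)
        fix u
        show "ennreal (phi f u) * indicator (csq v) u \<le> ennreal (exp (9 * r)) * ennreal (phi f u * exp (- 3 * cmod (u - c)))"
        proof (cases "u \<in> csq v")
          case True
          then have "cmod (u - c) \<le> 3 * r"
            using csq_dist[OF True] vc norm_triangle_ineq[of "u - v" "v - c"] by simp
          then have "1 \<le> exp (9 * r + - 3 * cmod (u - c))" by simp
          then have "phi f u * 1 \<le> phi f u * exp (9 * r + - 3 * cmod (u - c))"
            by (intro mult_left_mono) auto
          then have "phi f u \<le> exp (9 * r) * (phi f u * exp (- 3 * cmod (u - c)))"
            by (simp only: exp_add mult_ac)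
          then show ?thesis using True by (subst ennreal_mult'[symmetric]) (auto intro: ennreal_leI)
        qed simp
      qed
      also have "\<dots> = ennreal (exp (9 * r)) * loc f c"
        unfolding loc_def by (intro nn_integral_cmult loc_measurable f)
      finally show "(\<integral>\<^sup>+u. ennreal (phi f u) * indicator (csq v) u \<partial>nu) \<le> ennreal (exp (9 * r)) * loc f c" .
    qed simp_all
    also have "\<dots> = ennreal (K' / mass c) * loc f c"
    proof -
      have "K' / mass c = D' / mass c * (K * exp (9 * r))" by (simp add: K'_def)
      then show ?thesis using K D' mass_pos[of c] by (simp only: ennreal_mult' mult.assoc less_imp_le divide_nonneg_pos exp_ge_zero)
    qed
    finally show "ennreal (phi f v) \<le> ennreal (K' / mass c) * loc f c" .
  qed
qed

text \<open>Up to constants and for large z, the reciprocal of the squared gradient of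
  \<open>\<alpha> * (cmod z)\<^sup>2\<close>: the gain in squared modulus from one
  integration.\<close>

definition om :: "complex \<Rightarrow> real" where "om z = 1 / (1 + cmod z)\<^sup>2"

lemma om_pos: "om z > 0"
proof -
  have "1 + cmod z > 0" using norm_ge_zero[of z] by linarith
  then show ?thesis by (simp add: om_def zero_less_power)
qed

lemma om_continuous: "continuous_on A om"
proof -
  have "1 + cmod z \<noteq> 0" for z
    by (metis add_pos_nonneg norm_ge_zero less_irrefl zero_less_one)
  then show ?thesis unfolding om_def[abs_def] by (intro continuous_intros) auto
qed

lemma om_shift: "om z \<le> exp (2 * cmod (z - c)) * om c"
proof -
  have pos: "1 + cmod z > 0" "1 + cmod c > 0" using norm_ge_zero[of z] norm_ge_zero[of c] by linarith+
  have "1 + cmod c \<le> 1 + cmod z + cmod (z - c)"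
    using norm_triangle_ineq4[of z "z - c"] by simp
  also have "\<dots> \<le> (1 + cmod z) * (1 + cmod (z - c))" by (simp add: algebra_simps)
  also have "\<dots> \<le> (1 + cmod z) * exp (cmod (z - c))"
    using pos exp_ge_add_one_self[of "cmod (z - c)"] by (intro mult_left_mono) auto
  finally have "(1 + cmod c)\<^sup>2 \<le> ((1 + cmod z) * exp (cmod (z - c)))\<^sup>2"
    using pos by (intro power_mono) auto
  then have "(1 + cmod c)\<^sup>2 \<le> (1 + cmod z)\<^sup>2 * exp (2 * cmod (z - c))"
    by (simp add: power_mult_distrib exp_double)
  then show ?thesis using pos by (simp add: om_def divide_le_eq le_divide_eq mult.commute)
qed

section \<open>Primitives along rays\<close>

definition prim :: "cfun \<Rightarrow> cfun" where "prim f = (\<lambda>z. contour_integral (linepath 0 z) f)"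

lemma entire_primitive:
  assumes "entire f"
  obtains g where "\<And>z. (g has_field_derivative f z) (at z)"
  using holomorphic_convex_primitive'[of UNIV f] assms unfolding entire_def by auto

lemma prim_has_integral:
  assumes "entire f"
  shows "((\<lambda>t. f (of_real t * z) * z) has_integral prim f z) {0..1}"
proof -
  have "f contour_integrable_on linepath 0 z"
    by (intro contour_integrable_continuous_linepath entire_continuous assms)
  then have "(f has_contour_integral prim f z) (linepath 0 z)"
    unfolding prim_def by (rule has_contour_integral_integral)
  then show ?thesis
    unfolding has_contour_integral_linepath by (simp add: linepath_def scaleR_conv_of_real)
qed

lemma entire_prim:
  assumes "entire f"
  shows "entire (prim f)"
proof -
  obtain g where g: "\<And>z. (g has_field_derivative f z) (at z)"
    using entire_primitive[OF assms] by blast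
  have "prim f = (\<lambda>z. g z - g 0)"
  proof
    fix z
    have "(f has_contour_integral (g (pathfinish (linepath 0 z)) - g (pathstart (linepath 0 z)))) (linepath 0 z)"
      by (rule contour_integral_primitive[of UNIV, OF _ valid_path_linepath])
        (use g in \<open>auto simp: has_field_derivative_at_within\<close>)
    then show "prim f z = g z - g 0" unfolding prim_def by (simp add: contour_integral_unique)
  qed
  moreover have "g holomorphic_on UNIV" unfolding holomorphic_on_def
    using g field_differentiable_def field_differentiable_at_within by blast
  ultimately show ?thesis by (simp add: entire_def holomorphic_on_diff)
qed

lemma real_exp_integral_bound:
  fixes \<beta> :: real
  assumes "\<beta> > 0"
  shows "((\<lambda>t. exp (- (1 - t) * \<beta>)) has_integral (1 - exp (- \<beta>)) / \<beta>) {0..1}"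
proof -
  have "((\<lambda>t. exp (- (1 - t) * \<beta>)) has_integral exp (- (1 - 1) * \<beta>) / \<beta> - exp (- (1 - 0) * \<beta>) / \<beta>) {0..1}"
    using assms by (intro fundamental_theorem_of_calculus[of 0 1 "\<lambda>t. exp (- (1 - t) * \<beta>) / \<beta>"])
      (auto intro!: derivative_eq_intros simp flip: has_real_derivative_iff_has_vector_derivative)
  then show ?thesis by (simp add: diff_divide_distrib)
qed

text \<open>The pointwise form of the Littlewood--Paley inequality: integrating along the segment \<open>[0, z]\<close>
  against the Gaussian gains a factor \<open>1 / |z|\<close>, at the cost of an arbitrarily fast exponential.\<close>

lemma prim_pointwise:
  assumes \<kappa>: "\<kappa> \<ge> 0"
  obtains K where "K > 0" "\<And>f z G. entire f \<Longrightarrow> G \<ge> 0 \<Longrightarrow>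
    (\<And>v. phi f v * exp (- \<kappa> * cmod (z - v)) \<le> G) \<Longrightarrow> phi (prim f) z \<le> K * om z * G"
proof -
  \<comment> \<open>A is the cost of absorbing the factor with rate \<kappa> into the Gaussian by
    completing the square. In c, the 2 stems from
    \<open>(1 - exp (- \<beta>)) / \<beta> \<le> 2 / (1 + \<beta>)\<close> and the last factor from
    comparing \<open>x * (1 + x)\<close> with \<open>1 + \<beta>\<close>, where \<beta> is
    \<open>\<alpha> * x\<^sup>2 / 4\<close>.\<close>
  define A where "A = exp (\<kappa>\<^sup>2 / (4 * \<alpha>))"
  define c where "c = 2 * A * (1 + 8 / \<alpha>)"
  have A: "A > 0" by (simp add: A_def)
  have c: "c > 0" using A \<alpha> by (simp add: c_def add_pos_pos)
  show ?thesis
  proof (rule that[of "c\<^sup>2"])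
    show "c\<^sup>2 > 0" using c by simp
    fix f z G
    assume f: "entire f" and G: "G \<ge> 0" and le: "\<And>v. phi f v * exp (- \<kappa> * cmod (z - v)) \<le> G"
    define x where "x = cmod z"
    define g where "g = sqrt G"
    have x: "x \<ge> 0" by (simp add: x_def)
    have g: "g \<ge> 0" using G by (simp add: g_def)
    define E where "E = exp (- \<alpha> * x\<^sup>2 / 2)"
    have E2: "E\<^sup>2 = exp (- \<alpha> * x\<^sup>2)" by (simp add: E_def flip: exp_double)
    have pt: "cmod (f (of_real t * z) * z) * E \<le> g * x * A * exp (- (1 - t) * (\<alpha> * x\<^sup>2 / 4))" if t: "t \<in> {0..1}" for t
    proof -
      let ?v = "of_real t * z"
      have nv: "cmod ?v = t * x" using t by (simp add: norm_mult x_def)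
      have "z - ?v = of_real (1 - t) * z" by (simp add: algebra_simps)
      then have nzv: "cmod (z - ?v) = (1 - t) * x" using t by (simp only: norm_mult norm_of_real x_def) simp
      have "(cmod (f ?v))\<^sup>2 * exp (- \<alpha> * (t * x)\<^sup>2) * exp (- \<kappa> * ((1 - t) * x)) \<le> G"
        using le[of ?v] unfolding phi_def nv nzv .
      then have "(cmod (f ?v))\<^sup>2 * exp (- (\<alpha> * (t * x)\<^sup>2 + \<kappa> * ((1 - t) * x))) \<le> G"
        by (simp add: mult.assoc flip: exp_add)
      moreover have "a * exp (- X) \<le> G \<Longrightarrow> a \<le> G * exp X" for a X :: real
        by (simp add: exp_minus field_simps)
      ultimately have "(cmod (f ?v))\<^sup>2 \<le> G * exp (\<alpha> * (t * x)\<^sup>2 + \<kappa> * ((1 - t) * x))"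
        by blast
      also have "\<dots> = (g * exp ((\<alpha> * (t * x)\<^sup>2 + \<kappa> * ((1 - t) * x)) / 2))\<^sup>2"
        using G by (simp add: power_mult_distrib g_def flip: exp_double)
      finally have fv: "cmod (f ?v) \<le> g * exp ((\<alpha> * (t * x)\<^sup>2 + \<kappa> * ((1 - t) * x)) / 2)"
        by (rule power2_le_imp_le) (simp add: g)
      \<comment> \<open>Since \<open>t * t \<le> t\<close>, passing from z to t z leaves the
        exponent -2P, with P as defined below. One P absorbs the \<kappa> term, the other is kept
        for the integration over t.\<close>
      have "(\<alpha> * (t * x)\<^sup>2 + \<kappa> * ((1 - t) * x)) / 2 + - \<alpha> * x\<^sup>2 / 2 \<le> \<kappa>\<^sup>2 / (4 * \<alpha>) + - (1 - t) * (\<alpha> * x\<^sup>2 / 4)"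
      proof -
        have "\<kappa> * x / 2 \<le> \<alpha> * x\<^sup>2 / 4 + \<kappa>\<^sup>2 / (4 * \<alpha>)"
        proof -
          have "0 \<le> (\<alpha> * x - \<kappa>)\<^sup>2 / (4 * \<alpha>)" using \<alpha> by simp
          also have "\<dots> = \<alpha> * x\<^sup>2 / 4 + \<kappa>\<^sup>2 / (4 * \<alpha>) - \<kappa> * x / 2"
            using \<alpha> by (simp add: power2_eq_square field_simps)
          finally show ?thesis by simp
        qed
        then have 1: "(1 - t) * (\<kappa> * x / 2) \<le> (1 - t) * (\<alpha> * x\<^sup>2 / 4 + \<kappa>\<^sup>2 / (4 * \<alpha>))"
          using t by (intro mult_left_mono) auto
        have 2: "(1 - t) * (\<kappa>\<^sup>2 / (4 * \<alpha>)) \<le> \<kappa>\<^sup>2 / (4 * \<alpha>)"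
          using t \<alpha> by (intro mult_left_le_one_le) auto
        have 3: "\<alpha> * (t * x)\<^sup>2 \<le> \<alpha> * (t * x\<^sup>2)"
        proof -
          have "t * t * x\<^sup>2 \<le> t * x\<^sup>2" using t by (intro mult_right_mono mult_left_le_one_le) auto
          then show ?thesis using \<alpha> by (intro mult_left_mono) (auto simp: power2_eq_square algebra_simps)
        qed
        define P where "P = (1 - t) * (\<alpha> * x\<^sup>2 / 4)"
        have 4: "\<alpha> * (t * x\<^sup>2) = \<alpha> * x\<^sup>2 - 4 * P" by (simp add: P_def field_simps)
        have "(\<alpha> * (t * x)\<^sup>2 + \<kappa> * ((1 - t) * x)) / 2 + - \<alpha> * x\<^sup>2 / 2
            = \<alpha> * (t * x)\<^sup>2 / 2 + (1 - t) * (\<kappa> * x / 2) - \<alpha> * x\<^sup>2 / 2" by (simp add: field_simps)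
        also have "\<dots> \<le> (\<alpha> * x\<^sup>2 - 4 * P) / 2 + (P + (1 - t) * (\<kappa>\<^sup>2 / (4 * \<alpha>))) - \<alpha> * x\<^sup>2 / 2"
          using 1 3 unfolding 4 P_def[symmetric] distrib_left
          by (intro diff_right_mono add_mono divide_right_mono) auto
        also have "\<dots> \<le> \<kappa>\<^sup>2 / (4 * \<alpha>) - P"
          using 2 by (simp only: diff_divide_distrib)
        also have "\<dots> = \<kappa>\<^sup>2 / (4 * \<alpha>) + - (1 - t) * (\<alpha> * x\<^sup>2 / 4)" by (simp only: P_def minus_mult_left[symmetric] add_uminus_conv_diff)
        finally show ?thesis .
      qed
      then have ex: "exp ((\<alpha> * (t * x)\<^sup>2 + \<kappa> * ((1 - t) * x)) / 2) * E \<le> A * exp (- (1 - t) * (\<alpha> * x\<^sup>2 / 4))"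
        unfolding E_def A_def exp_add[symmetric] by simp
      have "cmod (f ?v * z) * E = x * (cmod (f ?v) * E)" by (simp add: norm_mult x_def)
      also have "\<dots> \<le> x * ((g * exp ((\<alpha> * (t * x)\<^sup>2 + \<kappa> * ((1 - t) * x)) / 2)) * E)"
        using x fv by (intro mult_left_mono mult_right_mono) (auto simp: E_def)
      also have "\<dots> = x * g * (exp ((\<alpha> * (t * x)\<^sup>2 + \<kappa> * ((1 - t) * x)) / 2) * E)" by simp
      also have "\<dots> \<le> x * g * (A * exp (- (1 - t) * (\<alpha> * x\<^sup>2 / 4)))"
        using x g by (intro mult_left_mono ex) auto
      finally show ?thesis by (simp add: mult_ac)
    qed
    have "cmod (prim f z) * E \<le> c * g / (1 + x)"
    proof (cases "x = 0")
      case True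
      then have "z = 0" by (simp add: x_def)
      then show ?thesis using c g x by (simp add: prim_def)
    next
      case False
      define \<beta> where "\<beta> = \<alpha> * x\<^sup>2 / 4"
      have x0: "x > 0" using False x by simp
      have \<beta>: "\<beta> > 0" using x0 \<alpha> by (simp add: \<beta>_def)
      have I1: "((\<lambda>t. (f (of_real t * z) * z) * of_real E) has_integral prim f z * of_real E) {0..1}"
        by (intro has_integral_mult_left prim_has_integral f)
      have I2: "((\<lambda>t. g * x * A * exp (- (1 - t) * \<beta>)) has_integral g * x * A * ((1 - exp (- \<beta>)) / \<beta>)) {0..1}"
        by (intro has_integral_mult_right real_exp_integral_bound \<beta>)
      have "cmod (prim f z * of_real E) \<le> g * x * A * ((1 - exp (- \<beta>)) / \<beta>)"
        using integral_norm_bound_integral[OF has_integral_integrable[OF I1] has_integral_integrable[OF I2]] pt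
        unfolding integral_unique[OF I1] integral_unique[OF I2] by (simp add: norm_mult E_def \<beta>_def)
      also have "\<dots> \<le> g * A * (x * (2 / (1 + \<beta>)))"
      proof -
        have "(1 - exp (- \<beta>)) / \<beta> \<le> 2 / (1 + \<beta>)"
        proof (cases "\<beta> \<le> 1")
          case True
          have "1 - exp (- \<beta>) \<le> \<beta>" using exp_ge_add_one_self[of "- \<beta>"] by simp
          then have "(1 - exp (- \<beta>)) / \<beta> \<le> 1" using \<beta> by simp
          also have "1 \<le> 2 / (1 + \<beta>)" using True \<beta> by simp
          finally show ?thesis .
        next
          case False
          have "(1 - exp (- \<beta>)) / \<beta> \<le> 1 / \<beta>" using \<beta> by (intro divide_right_mono) auto
          also have "\<dots> \<le> 2 / (1 + \<beta>)" using False by (simp add: field_simps)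
          finally show ?thesis .
        qed
        then have "g * x * A * ((1 - exp (- \<beta>)) / \<beta>) \<le> g * x * A * (2 / (1 + \<beta>))"
          using g x A by (intro mult_left_mono) auto
        then show ?thesis by (simp add: mult_ac)
      qed
      also have "\<dots> \<le> g * A * (2 * (1 + 8 / \<alpha>) / (1 + x))"
      proof (intro mult_left_mono)
        have "x * (1 + x) \<le> (1 + 8 / \<alpha>) * (1 + \<beta>)"
        proof -
          have "(1 + 8 / \<alpha>) * (1 + \<beta>) = 1 + \<alpha> * x\<^sup>2 / 4 + 8 / \<alpha> + 2 * x\<^sup>2"
            using \<alpha> by (simp add: \<beta>_def field_simps power2_eq_square)
          moreover have "x \<le> 1 + x\<^sup>2"
            using zero_le_power2[of "x - 1 / 2"] by (simp add: power2_eq_square algebra_simps)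
          moreover have "0 \<le> \<alpha> * x\<^sup>2 / 4" "0 \<le> 8 / \<alpha>" using \<alpha> by auto
          moreover have "x * (1 + x) = x + x\<^sup>2" by (simp add: power2_eq_square algebra_simps)
          ultimately show ?thesis by linarith
        qed
        then have "2 * (x * (1 + x)) / ((1 + \<beta>) * (1 + x)) \<le> 2 * ((1 + 8 / \<alpha>) * (1 + \<beta>)) / ((1 + \<beta>) * (1 + x))"
          using x0 \<beta> by (intro divide_right_mono mult_left_mono) auto
        moreover have "2 * (x * (1 + x)) / ((1 + \<beta>) * (1 + x)) = x * (2 / (1 + \<beta>))"
          using x0 by simp
        moreover have "2 * ((1 + 8 / \<alpha>) * (1 + \<beta>)) / ((1 + \<beta>) * (1 + x)) = 2 * (1 + 8 / \<alpha>) / (1 + x)"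
          using \<beta> by simp
        ultimately show "x * (2 / (1 + \<beta>)) \<le> 2 * (1 + 8 / \<alpha>) / (1 + x)" by simp
      qed (use g A in auto)
      also have "\<dots> = c * g / (1 + x)" by (simp add: c_def)
      finally show ?thesis by (simp add: norm_mult E_def)
    qed
    then have "(cmod (prim f z) * E)\<^sup>2 \<le> (c * g / (1 + x))\<^sup>2"
      by (intro power_mono) (auto simp: E_def)
    then show "phi (prim f) z \<le> c\<^sup>2 * om z * G"
      unfolding phi_def power_mult_distrib E2 using G
      by (simp add: x_def om_def power_divide power_mult_distrib g_def)
  qed
qed

section \<open>The Littlewood--Paley inequality and the Fock space\<close>

text \<open>Tonelli exchanges the lattice sum with the integral, after which the decay left over in
  \<open>loc\<close> sums to a constant uniformly in u.\<close>

lemma nsum_om_loc_le: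
  obtains K where "K > 0" "\<And>f. entire f \<Longrightarrow>
    nsum (\<lambda>i. ennreal (om (latt r i)) * loc f (latt r i)) \<le> ennreal K * (\<integral>\<^sup>+u. ennreal (phi f u * om u) \<partial>nu)"
proof -
  obtain K where K: "K > 0" "\<And>u. nsum (\<lambda>i. ennreal (exp (- 1 * cmod (u - latt r i)))) \<le> ennreal K"
    using nsum_latt_exp[OF r, of 1] by (metis zero_less_one)
  show ?thesis
  proof (rule that[OF K(1)])
    fix f assume f: "entire f"
    have m: "(\<lambda>u. ennreal (phi f u * om u) * ennreal (exp (- 1 * cmod (u - c)))) \<in> borel_measurable nu" for c
      by (intro borel_measurable_times_ennreal ennreal_measurable_nu continuous_intros phi_continuous f om_continuous)
    have "nsum (\<lambda>i. ennreal (om (latt r i)) * loc f (latt r i))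
        \<le> nsum (\<lambda>i. \<integral>\<^sup>+u. ennreal (phi f u * om u) * ennreal (exp (- 1 * cmod (u - latt r i))) \<partial>nu)"
    proof (rule nn_integral_mono)
      fix i
      let ?c = "latt r i"
      have "ennreal (om ?c) * loc f ?c = (\<integral>\<^sup>+u. ennreal (om ?c) * ennreal (phi f u * exp (- 3 * cmod (u - ?c))) \<partial>nu)"
        unfolding loc_def by (rule nn_integral_cmult[symmetric]) (rule loc_measurable[OF f])
      also have "\<dots> \<le> (\<integral>\<^sup>+u. ennreal (phi f u * om u) * ennreal (exp (- 1 * cmod (u - ?c))) \<partial>nu)"
      proof (rule nn_integral_mono)
        fix u
        have "om ?c * (phi f u * exp (- 3 * cmod (u - ?c))) \<le> (exp (2 * cmod (?c - u)) * om u) * (phi f u * exp (- 3 * cmod (u - ?c)))"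
          by (intro mult_right_mono om_shift) auto
        also have "\<dots> = phi f u * om u * (exp (2 * cmod (u - ?c)) * exp (- 3 * cmod (u - ?c)))"
          by (simp add: norm_minus_commute)
        also have "exp (2 * cmod (u - ?c)) * exp (- 3 * cmod (u - ?c)) = exp (- 1 * cmod (u - ?c))"
          unfolding exp_add[symmetric] by simp
        finally show "ennreal (om ?c) * ennreal (phi f u * exp (- 3 * cmod (u - ?c))) \<le> ennreal (phi f u * om u) * ennreal (exp (- 1 * cmod (u - ?c)))"
          by (subst (1 2) ennreal_mult'[symmetric])
            (auto intro!: ennreal_leI mult_nonneg_nonneg less_imp_le[OF om_pos])
      qed
      finally show "ennreal (om ?c) * loc f ?c \<le> \<dots>" .
    qed
    also have "\<dots> = (\<integral>\<^sup>+u. nsum (\<lambda>i. ennreal (phi f u * om u) * ennreal (exp (- 1 * cmod (u - latt r i)))) \<partial>nu)"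
      by (rule nn_integral_count_space_nn_integral[symmetric]) (rule countableI_type, rule m)
    also have "\<dots> = (\<integral>\<^sup>+u. ennreal (phi f u * om u) * nsum (\<lambda>i. ennreal (exp (- 1 * cmod (u - latt r i)))) \<partial>nu)"
      by (intro nn_integral_cong nn_integral_cmult) simp
    also have "\<dots> \<le> (\<integral>\<^sup>+u. ennreal K * ennreal (phi f u * om u) \<partial>nu)"
      by (intro nn_integral_mono) (metis K(2) mult.commute mult_left_mono zero_le)
    also have "\<dots> = ennreal K * (\<integral>\<^sup>+u. ennreal (phi f u * om u) \<partial>nu)"
      by (intro nn_integral_cmult ennreal_measurable_nu continuous_intros phi_continuous f om_continuous)
    finally show "nsum (\<lambda>i. ennreal (om (latt r i)) * loc f (latt r i)) \<le> \<dots>" .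
  qed
qed

text \<open>\<open>prim_pointwise\<close> needs one G that dominates the weighted values of f at all
  v. Every v lies in some lattice square, so the sum of the contributions of all squares can serve.
  Having a sum in place of a supremum allows the integration over z to be carried out square by
  square.\<close>

lemma littlewood_paley:
  obtains K where "K > 0" "\<And>f. entire f \<Longrightarrow> nrm (prim f) \<le> ennreal K * (\<integral>\<^sup>+u. ennreal (phi f u * om u) \<partial>nu)"
proof -
  obtain \<kappa>1 K1 where K1: "\<kappa>1 > 0" "K1 > 0"
    "\<And>c. (\<integral>\<^sup>+z. ennreal (exp (- \<kappa>1 * cmod (z - c))) \<partial>nu) \<le> ennreal (K1 * mass c)"
    using exp_kernel_integral by metis
  \<comment> \<open>The rate \<kappa>1 is used for integrating the kernel, the extra 2 for moving
    \<open>om\<close> from z to the lattice point.\<close>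
  define \<kappa> where "\<kappa> = \<kappa>1 + 2"
  have \<kappa>: "\<kappa> > 0" using K1 by (simp add: \<kappa>_def)
  obtain K2 where K2: "K2 > 0" "\<And>f v c. entire f \<Longrightarrow> v \<in> sq r c \<Longrightarrow> ennreal (phi f v) \<le> ennreal (K2 / mass c) * loc f c"
    using submean_loc by metis
  obtain K3 where K3: "K3 > 0" "\<And>f z G. entire f \<Longrightarrow> G \<ge> 0 \<Longrightarrow>
    (\<And>v. phi f v * exp (- \<kappa> * cmod (z - v)) \<le> G) \<Longrightarrow> phi (prim f) z \<le> K3 * om z * G"
    using prim_pointwise[of \<kappa>] \<kappa> by (metis less_imp_le)
  obtain K4 where K4: "K4 > 0" "\<And>f. entire f \<Longrightarrow>
    nsum (\<lambda>i. ennreal (om (latt r i)) * loc f (latt r i)) \<le> ennreal K4 * (\<integral>\<^sup>+u. ennreal (phi f u * om u) \<partial>nu)"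
    using nsum_om_loc_le by metis
  define E where "E = exp (\<kappa> * (2 * r))"
  have E: "E > 0" by (simp add: E_def)
  define K where "K = K3 * (E * K2 * K1) * K4"
  show ?thesis
  proof (rule that[of K])
    show "K > 0" using K1 K2 K3 K4 E by (simp add: K_def)
    fix f assume f: "entire f"
    define t where "t i z = ennreal (E * K2 / mass (latt r i) * exp (- \<kappa> * cmod (z - latt r i))) * loc f (latt r i)" for i z
    have pt: "ennreal (phi (prim f) z) \<le> ennreal (K3 * om z) * nsum (\<lambda>i. t i z)" for z
    proof (cases "nsum (\<lambda>i. t i z) = top")
      case True
      then show ?thesis using K3(1) om_pos[of z] by (simp add: ennreal_mult_top)
    next
      case False
      define G where "G = enn2real (nsum (\<lambda>i. t i z))"
      have G: "nsum (\<lambda>i. t i z) = ennreal G" "G \<ge> 0" using False by (auto simp: G_def less_top)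
      have "phi f v * exp (- \<kappa> * cmod (z - v)) \<le> G" for v
      proof -
        obtain i where i: "v \<in> sq r (latt r i)" by (rule latt_covers[OF r])
        let ?c = "latt r i"
        have "cmod (z - ?c) \<le> cmod (z - v) + 2 * r"
          using dist_sq[OF i r] norm_triangle_ineq[of "z - v" "v - ?c"] by simp
        then have "\<kappa> * cmod (z - ?c) \<le> \<kappa> * (cmod (z - v) + 2 * r)" using \<kappa> by (intro mult_left_mono) auto
        then have le: "exp (- \<kappa> * cmod (z - v)) \<le> E * exp (- \<kappa> * cmod (z - ?c))"
          unfolding E_def exp_add[symmetric] by (simp add: algebra_simps)
        have "ennreal (phi f v * exp (- \<kappa> * cmod (z - v))) \<le> ennreal (phi f v * (E * exp (- \<kappa> * cmod (z - ?c))))"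
          by (intro ennreal_leI mult_left_mono le) simp
        also have "\<dots> = ennreal (phi f v) * ennreal (E * exp (- \<kappa> * cmod (z - ?c)))"
          using E by (intro ennreal_mult'') simp
        also have "\<dots> \<le> (ennreal (K2 / mass ?c) * loc f ?c) * ennreal (E * exp (- \<kappa> * cmod (z - ?c)))"
          by (intro mult_right_mono K2 f i) simp
        also have "\<dots> = t i z"
        proof -
          have "E * K2 / mass ?c * exp (- \<kappa> * cmod (z - ?c)) = (K2 / mass ?c) * (E * exp (- \<kappa> * cmod (z - ?c)))" by simp
          then have "ennreal (E * K2 / mass ?c * exp (- \<kappa> * cmod (z - ?c))) = ennreal (K2 / mass ?c) * ennreal (E * exp (- \<kappa> * cmod (z - ?c)))"
            using E by (simp only:) (rule ennreal_mult'', simp)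
          then show ?thesis unfolding t_def by (simp only: mult.assoc mult.commute[of "loc f ?c"])
        qed
        also have "\<dots> \<le> nsum (\<lambda>i. t i z)" by (rule nn_integral_ge_point) simp
        finally show ?thesis using G by simp
      qed
      then have "phi (prim f) z \<le> K3 * om z * G" by (intro K3 f G)
      then show ?thesis using G K3(1) om_pos[of z]
        by (simp add: ennreal_mult'[symmetric] ennreal_leI)
    qed
    have t_meas: "(\<lambda>z. ennreal (K3 * om z) * t i z) \<in> borel_measurable nu" for i
      unfolding t_def
      by (intro borel_measurable_times_ennreal ennreal_measurable_nu continuous_intros om_continuous borel_measurable_const)
    have "nrm (prim f) \<le> (\<integral>\<^sup>+z. ennreal (K3 * om z) * nsum (\<lambda>i. t i z) \<partial>nu)"
      unfolding nrm_def by (intro nn_integral_mono pt)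
    also have "\<dots> = (\<integral>\<^sup>+z. nsum (\<lambda>i. ennreal (K3 * om z) * t i z) \<partial>nu)"
      by (intro nn_integral_cong nn_integral_cmult[symmetric]) simp
    also have "\<dots> = nsum (\<lambda>i. \<integral>\<^sup>+z. ennreal (K3 * om z) * t i z \<partial>nu)"
      by (rule nn_integral_count_space_nn_integral) (rule countableI_type, rule t_meas)
    also have "\<dots> \<le> nsum (\<lambda>i. ennreal (K3 * (E * K2 * K1)) * (ennreal (om (latt r i)) * loc f (latt r i)))"
    proof (rule nn_integral_mono)
      fix i
      let ?c = "latt r i"
      have mc: "mass ?c > 0" by (rule mass_pos)
      have oc: "om ?c > 0" by (rule om_pos)
      define b where "b = K3 * (E * K2 / mass ?c) * om ?c"
      have b: "b \<ge> 0" using K3 E K2 mc oc by (simp add: b_def)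
      have "(\<integral>\<^sup>+z. ennreal (K3 * om z) * t i z \<partial>nu) \<le> (\<integral>\<^sup>+z. (ennreal b * loc f ?c) * ennreal (exp (- \<kappa>1 * cmod (z - ?c))) \<partial>nu)"
      proof (rule nn_integral_mono)
        fix z
        have "om z * exp (- \<kappa> * cmod (z - ?c)) \<le> exp (2 * cmod (z - ?c)) * om ?c * exp (- \<kappa> * cmod (z - ?c))"
          by (intro mult_right_mono om_shift) simp
        also have "\<dots> = om ?c * (exp (2 * cmod (z - ?c)) * exp (- \<kappa> * cmod (z - ?c)))" by simp
        also have "exp (2 * cmod (z - ?c)) * exp (- \<kappa> * cmod (z - ?c)) = exp (- \<kappa>1 * cmod (z - ?c))"
          unfolding exp_add[symmetric] by (simp add: \<kappa>_def algebra_simps)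
        finally have "(K3 * (E * K2 / mass ?c)) * (om z * exp (- \<kappa> * cmod (z - ?c))) \<le> (K3 * (E * K2 / mass ?c)) * (om ?c * exp (- \<kappa>1 * cmod (z - ?c)))"
          using K3 E K2 mc by (intro mult_left_mono) auto
        then have "K3 * om z * (E * K2 / mass ?c * exp (- \<kappa> * cmod (z - ?c))) \<le> b * exp (- \<kappa>1 * cmod (z - ?c))"
          by (simp add: b_def mult_ac)
        then have le: "ennreal (K3 * om z * (E * K2 / mass ?c * exp (- \<kappa> * cmod (z - ?c)))) * loc f ?c \<le> ennreal (b * exp (- \<kappa>1 * cmod (z - ?c))) * loc f ?c"
          by (intro mult_right_mono ennreal_leI) auto
        have nn: "0 \<le> E * K2 / mass ?c * exp (- \<kappa> * cmod (z - ?c))" using E K2 mc by simp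
        have "ennreal (K3 * om z) * t i z = ennreal (K3 * om z * (E * K2 / mass ?c * exp (- \<kappa> * cmod (z - ?c)))) * loc f ?c"
          unfolding t_def ennreal_mult''[OF nn] by (rule mult.assoc[symmetric])
        also note le
        also have "ennreal (b * exp (- \<kappa>1 * cmod (z - ?c))) * loc f ?c = (ennreal b * loc f ?c) * ennreal (exp (- \<kappa>1 * cmod (z - ?c)))"
          by (simp only: ennreal_mult''[OF exp_ge_zero] mult_ac)
        finally show "ennreal (K3 * om z) * t i z \<le> (ennreal b * loc f ?c) * ennreal (exp (- \<kappa>1 * cmod (z - ?c)))" .
      qed
      also have "\<dots> = (ennreal b * loc f ?c) * (\<integral>\<^sup>+z. ennreal (exp (- \<kappa>1 * cmod (z - ?c))) \<partial>nu)"
        by (intro nn_integral_cmult ennreal_measurable_nu continuous_intros)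
      also have "\<dots> \<le> (ennreal b * loc f ?c) * ennreal (K1 * mass ?c)"
        by (intro mult_left_mono K1) simp
      also have "\<dots> = ennreal (b * (K1 * mass ?c)) * loc f ?c"
      proof -
        have nn: "0 \<le> K1 * mass ?c" using K1 mc by simp
        show ?thesis unfolding ennreal_mult''[OF nn] by (simp only: mult_ac)
      qed
      also have "b * (K1 * mass ?c) = K3 * (E * K2 * K1) * om ?c"
        using mc by (simp add: b_def)
      also have "ennreal (K3 * (E * K2 * K1) * om ?c) * loc f ?c = ennreal (K3 * (E * K2 * K1)) * (ennreal (om ?c) * loc f ?c)"
        unfolding ennreal_mult''[OF less_imp_le[OF oc]] by (rule mult.assoc)
      finally show "(\<integral>\<^sup>+z. ennreal (K3 * om z) * t i z \<partial>nu) \<le> \<dots>" .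
    qed
    also have "\<dots> = ennreal (K3 * (E * K2 * K1)) * nsum (\<lambda>i. ennreal (om (latt r i)) * loc f (latt r i))"
      by (rule nn_integral_cmult) simp
    also have "\<dots> \<le> ennreal (K3 * (E * K2 * K1)) * (ennreal K4 * (\<integral>\<^sup>+u. ennreal (phi f u * om u) \<partial>nu))"
      by (intro mult_left_mono K4 f) simp
    also have "\<dots> = ennreal K * (\<integral>\<^sup>+u. ennreal (phi f u * om u) \<partial>nu)"
      unfolding K_def ennreal_mult''[OF less_imp_le[OF K4(1)]] by (rule mult.assoc[symmetric])
    finally show "nrm (prim f) \<le> \<dots>" .
  qed
qed

section \<open>The weighted Fock space as an inner product space\<close>

abbreviation Fw :: "cfun set" where "Fw \<equiv> fock_space \<alpha> w"
abbreviation ipw :: "cfun \<Rightarrow> cfun \<Rightarrow> complex" where "ipw \<equiv> fock_inner \<alpha> w"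

lemma nrm_lebesgue:
  assumes "entire f"
  shows "nrm f = (\<integral>\<^sup>+z. ennreal ((cmod (f z))\<^sup>2 * exp (- \<alpha> * (cmod z)\<^sup>2) * w z) \<partial>lebesgue)"
proof -
  have "(\<lambda>z. ennreal (phi f z)) \<in> borel_measurable lebesgue"
    using phi_measurable[OF assms] measurable_cong_sets[OF sets_wmeas refl] by blast
  then have "nrm f = (\<integral>\<^sup>+z. ennreal (w z) * ennreal (phi f z) \<partial>lebesgue)"
    unfolding nrm_def wmeas_def using weight_measurable[OF weight] by (subst nn_integral_density) auto
  also have "\<dots> = (\<integral>\<^sup>+z. ennreal ((cmod (f z))\<^sup>2 * exp (- \<alpha> * (cmod z)\<^sup>2) * w z) \<partial>lebesgue)"
    by (intro nn_integral_cong) (simp add: phi_def weight_nonneg[OF weight] ennreal_mult'' mult.commute)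
  finally show ?thesis .
qed

lemma fock_density_measurable:
  assumes "continuous_on UNIV f"
  shows "(\<lambda>z. f z * (exp (- \<alpha> * (cmod z)\<^sup>2) * w z)) \<in> borel_measurable lebesgue"
proof -
  have "(\<lambda>z. exp (- \<alpha> * (cmod z)\<^sup>2)) \<in> borel_measurable lebesgue"
    by (rule borel_measurable_lebesgue_continuous[OF _ refl]) (intro continuous_intros)
  moreover have "f \<in> borel_measurable lebesgue"
    using assms by (rule borel_measurable_lebesgue_continuous) simp
  ultimately show ?thesis using weight_measurable[OF weight] by (intro borel_measurable_times)
qed

lemma fock_space_iff: "f \<in> Fw \<longleftrightarrow> entire f \<and> nrm f < \<infinity>"
proof (cases "entire f")
  case True
  have "continuous_on UNIV (\<lambda>z. (cmod (f z))\<^sup>2)" by (intro continuous_intros entire_continuous True)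
  then have "(\<lambda>z. (cmod (f z))\<^sup>2 * exp (- \<alpha> * (cmod z)\<^sup>2) * w z) \<in> borel_measurable lebesgue"
    unfolding mult.assoc by (rule fock_density_measurable)
  then have "integrable lebesgue (\<lambda>z. (cmod (f z))\<^sup>2 * exp (- \<alpha> * (cmod z)\<^sup>2) * w z) \<longleftrightarrow> nrm f < \<infinity>"
    unfolding nrm_lebesgue[OF True] integrable_iff_bounded
    by (simp add: weight_nonneg[OF weight] abs_mult)
  then show ?thesis using True by (simp add: fock_space_def entire_def)
qed (auto simp: fock_space_def entire_def)

lemma fock_inner_self:
  assumes "f \<in> Fw"
  shows "ipw f f = complex_of_real (enn2real (nrm f))"
proof -
  have f: "entire f" using assms by (simp add: fock_space_iff)
  have "ipw f f = (LINT z|lebesgue. complex_of_real ((cmod (f z))\<^sup>2 * exp (- \<alpha> * (cmod z)\<^sup>2) * w z))"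
    unfolding fock_inner_def
    by (intro Bochner_Integration.integral_cong refl) (simp only: of_real_mult complex_norm_square mult.assoc)
  also have "\<dots> = complex_of_real (LINT z|lebesgue. (cmod (f z))\<^sup>2 * exp (- \<alpha> * (cmod z)\<^sup>2) * w z)"
    by (rule integral_complex_of_real)
  also have "(LINT z|lebesgue. (cmod (f z))\<^sup>2 * exp (- \<alpha> * (cmod z)\<^sup>2) * w z) = enn2real (nrm f)"
    unfolding nrm_lebesgue[OF f] using assms
    by (intro integral_eq_nn_integral) (auto simp: fock_space_def weight_nonneg[OF weight] dest: borel_measurable_integrable)
  finally show ?thesis .
qed

lemma ennreal_fock_norm: "f \<in> Fw \<Longrightarrow> ennreal (Re (ipw f f)) = nrm f"
  by (simp add: fock_inner_self fock_space_iff less_top)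

lemma fock_inner_integrable:
  assumes "f \<in> Fw" "g \<in> Fw"
  shows "integrable lebesgue (\<lambda>z. f z * cnj (g z) * complex_of_real (exp (- \<alpha> * (cmod z)\<^sup>2) * w z))"
proof (rule Bochner_Integration.integrable_bound)
  show "integrable lebesgue (\<lambda>z. (cmod (f z))\<^sup>2 * exp (- \<alpha> * (cmod z)\<^sup>2) * w z + (cmod (g z))\<^sup>2 * exp (- \<alpha> * (cmod z)\<^sup>2) * w z)"
    using assms by (intro Bochner_Integration.integrable_add) (auto simp: fock_space_def)
  have "continuous_on UNIV f" "continuous_on UNIV g" using assms by (auto simp: fock_space_iff intro: entire_continuous)
  then have "(\<lambda>z. f z * cnj (g z)) \<in> borel_measurable lebesgue"
    by (intro borel_measurable_lebesgue_continuous[OF _ refl] continuous_intros)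
  moreover
  have "(\<lambda>z. exp (- \<alpha> * (cmod z)\<^sup>2)) \<in> borel_measurable lebesgue"
    by (rule borel_measurable_lebesgue_continuous[OF _ refl]) (intro continuous_intros)
  then have "(\<lambda>z. complex_of_real (exp (- \<alpha> * (cmod z)\<^sup>2) * w z)) \<in> borel_measurable lebesgue"
    using weight_measurable[OF weight] by measurable
  ultimately show "(\<lambda>z. f z * cnj (g z) * complex_of_real (exp (- \<alpha> * (cmod z)\<^sup>2) * w z)) \<in> borel_measurable lebesgue"
    by (rule borel_measurable_times)
  show "AE z in lebesgue. norm (f z * cnj (g z) * complex_of_real (exp (- \<alpha> * (cmod z)\<^sup>2) * w z))
      \<le> norm ((cmod (f z))\<^sup>2 * exp (- \<alpha> * (cmod z)\<^sup>2) * w z + (cmod (g z))\<^sup>2 * exp (- \<alpha> * (cmod z)\<^sup>2) * w z)"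
  proof (rule AE_I2)
    fix z
    have "0 \<le> (cmod (f z) - cmod (g z))\<^sup>2" by simp
    moreover have "0 \<le> (cmod (f z))\<^sup>2" "0 \<le> (cmod (g z))\<^sup>2" by auto
    ultimately have "cmod (f z) * cmod (g z) \<le> (cmod (f z))\<^sup>2 + (cmod (g z))\<^sup>2"
      unfolding power2_diff by linarith
    then have "cmod (f z) * cmod (g z) * (exp (- \<alpha> * (cmod z)\<^sup>2) * w z) \<le> ((cmod (f z))\<^sup>2 + (cmod (g z))\<^sup>2) * (exp (- \<alpha> * (cmod z)\<^sup>2) * w z)"
      using weight_nonneg[OF weight] by (intro mult_right_mono) auto
    then show "norm (f z * cnj (g z) * complex_of_real (exp (- \<alpha> * (cmod z)\<^sup>2) * w z))
      \<le> norm ((cmod (f z))\<^sup>2 * exp (- \<alpha> * (cmod z)\<^sup>2) * w z + (cmod (g z))\<^sup>2 * exp (- \<alpha> * (cmod z)\<^sup>2) * w z)"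
      using weight_nonneg[OF weight, of z] by (simp add: norm_mult abs_mult algebra_simps)
  qed
qed

lemma nrm_add_le:
  assumes "entire f" "entire g"
  shows "nrm (f + g) \<le> 2 * nrm f + 2 * nrm g"
proof -
  have "nrm (f + g) \<le> (\<integral>\<^sup>+z. 2 * ennreal (phi f z) + 2 * ennreal (phi g z) \<partial>nu)"
    unfolding nrm_def
  proof (rule nn_integral_mono)
    fix z
    have "(cmod (f z + g z))\<^sup>2 \<le> (cmod (f z) + cmod (g z))\<^sup>2" by (intro power_mono norm_triangle_ineq) simp
    also have "\<dots> \<le> 2 * (cmod (f z))\<^sup>2 + 2 * (cmod (g z))\<^sup>2"
      using zero_le_power2[of "cmod (f z) - cmod (g z)"] unfolding power2_diff power2_sum by linarith
    finally have "phi (f + g) z \<le> (2 * (cmod (f z))\<^sup>2 + 2 * (cmod (g z))\<^sup>2) * exp (- \<alpha> * (cmod z)\<^sup>2)"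
      unfolding phi_def by (intro mult_right_mono) auto
    then have "ennreal (phi (f + g) z) \<le> ennreal (2 * phi f z + 2 * phi g z)"
      by (intro ennreal_leI) (simp add: phi_def algebra_simps)
    then show "ennreal (phi (f + g) z) \<le> 2 * ennreal (phi f z) + 2 * ennreal (phi g z)"
      by (simp add: ennreal_plus ennreal_mult')
  qed
  also have "\<dots> = 2 * nrm f + 2 * nrm g"
    unfolding nrm_def using phi_measurable[OF assms(1)] phi_measurable[OF assms(2)]
    by (subst nn_integral_add) (auto simp: nn_integral_cmult)
  finally show ?thesis .
qed

lemma nrm_scale: "entire f \<Longrightarrow> nrm (cscale c f) = ennreal ((cmod c)\<^sup>2) * nrm f"
proof -
  assume f: "entire f"
  have "phi (cscale c f) z = (cmod c)\<^sup>2 * phi f z" for z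
    by (simp add: phi_def cscale_def norm_mult power_mult_distrib)
  then show ?thesis
    unfolding nrm_def by (simp add: ennreal_mult' nn_integral_cmult[OF phi_measurable[OF f]])
qed

lemma fock_inner_form: "inner_form Fw ipw"
proof
  have ent: "entire f \<Longrightarrow> entire g \<Longrightarrow> entire (f + g)" "entire f \<Longrightarrow> entire (cscale c f)" "entire 0" for f g c
    unfolding entire_def cscale_def plus_fun_def zero_fun_def by (intro holomorphic_intros; simp)+
  show "cfun.subspace Fw"
    unfolding cfun.subspace_def
  proof (intro conjI ballI allI)
    show "0 \<in> Fw" using ent by (simp add: fock_space_iff nrm_def phi_def)
    fix f assume f: "f \<in> Fw"
    show "cscale c f \<in> Fw" for c
      using f ent by (auto simp: fock_space_iff nrm_scale ennreal_mult_less_top)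
    fix g assume g: "g \<in> Fw"
    have "2 * nrm f + 2 * nrm g < \<infinity>" using f g by (simp add: fock_space_iff ennreal_mult_less_top)
    then show "f + g \<in> Fw"
      using f g ent nrm_add_le[of f g] by (auto simp: fock_space_iff intro: le_less_trans)
  qed
  show "ipw (f + g) h = ipw f h + ipw g h" if "f \<in> Fw" "g \<in> Fw" "h \<in> Fw" for f g h
    unfolding fock_inner_def using that
    by (subst Bochner_Integration.integral_add[OF fock_inner_integrable fock_inner_integrable, symmetric])
      (auto simp: algebra_simps)
  show "ipw (cscale c f) g = c * ipw f g" if "f \<in> Fw" "g \<in> Fw" for f g c
    unfolding fock_inner_def by (subst integral_mult_right_zero[symmetric]) (simp add: cscale_def mult_ac)
  show "ipw g f = cnj (ipw f g)" if "f \<in> Fw" "g \<in> Fw" for f g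
    unfolding fock_inner_def by (subst Bochner_Integration.integral_cnj[symmetric]) (simp add: mult_ac)
  show "0 \<le> Re (ipw f f)" if "f \<in> Fw" for f
    using that by (simp add: fock_inner_self)
  \<comment> \<open>Masses of squares are positive, so the submean inequality makes f vanish at
    every point, not merely almost everywhere.\<close>
  show "f = 0" if f: "f \<in> Fw" and "Re (ipw f f) = 0" for f
  proof
    fix z
    obtain K where "K > 0" "\<And>f z. entire f \<Longrightarrow> ennreal (phi f z * mass z) \<le> ennreal K * nrm f"
      using submean by metis
    then have "ennreal (phi f z * mass z) \<le> ennreal K * nrm f" using f by (simp add: fock_space_iff)
    also have "nrm f = 0" using that ennreal_fock_norm[OF f] by simp
    finally have "phi f z * mass z \<le> 0" by (simp add: ennreal_eq_0_iff)
    then have "phi f z = 0" using mass_pos[of z] phi_nonneg[of f z] by (simp add: mult_le_0_iff)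
    then show "f z = 0 z" by (simp add: phi_def)
  qed
qed

section \<open>Compactness of the Volterra operator\<close>

sublocale H: inner_form Fw ipw by (rule fock_inner_form)

lemma q_nrm: "f \<in> Fw \<Longrightarrow> ennreal (H.q f) = nrm f"
  unfolding H.q_def by (rule ennreal_fock_norm)

lemma entire_V: "f \<in> Fw \<Longrightarrow> entire f"
  by (simp add: fock_space_iff)

lemma submean_q:
  obtains K where "K > 0" "\<And>f z. f \<in> Fw \<Longrightarrow> phi f z * mass z \<le> K * H.q f"
proof -
  obtain K where K: "K > 0" "\<And>f z. entire f \<Longrightarrow> ennreal (phi f z * mass z) \<le> ennreal K * nrm f"
    using submean by metis
  show ?thesis
  proof (rule that[OF K(1)])
    fix f z assume f: "f \<in> Fw"
    have "ennreal (phi f z * mass z) \<le> ennreal K * ennreal (H.q f)"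
      using K(2)[OF entire_V[OF f]] by (simp add: q_nrm[OF f])
    then show "phi f z * mass z \<le> K * H.q f"
      using K(1) H.q_nonneg[OF f] by (simp add: ennreal_le_iff flip: ennreal_mult')
  qed
qed

text \<open>The bound is asked only from some index on, as it will be applied to differences in a
  Cauchy sequence.\<close>

lemma fatou:
  assumes ent: "\<And>n. entire (F n)" "entire f" and lim: "\<And>z. (\<lambda>n. F n z) \<longlonglongrightarrow> f z"
    and B: "\<And>n. n \<ge> n0 \<Longrightarrow> nrm (F n) \<le> B"
  shows "nrm f \<le> B"
proof -
  have "nrm f = (\<integral>\<^sup>+z. liminf (\<lambda>n. ennreal (phi (F n) z)) \<partial>nu)"
    unfolding nrm_def
  proof (rule nn_integral_cong)
    fix z
    have "(\<lambda>n. ennreal (phi (F n) z)) \<longlonglongrightarrow> ennreal (phi f z)"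
      unfolding phi_def by (intro tendsto_ennrealI tendsto_intros lim)
    then show "ennreal (phi f z) = liminf (\<lambda>n. ennreal (phi (F n) z))"
      using lim_imp_Liminf[OF sequentially_bot] by metis
  qed
  also have "\<dots> \<le> liminf (\<lambda>n. nrm (F n))"
    unfolding nrm_def by (intro nn_integral_liminf phi_measurable ent)
  also have "\<dots> \<le> B"
  proof -
    have "eventually (\<lambda>n. nrm (F n) \<le> B) sequentially"
      using B by (auto simp: eventually_sequentially)
    then show ?thesis by (rule Liminf_le[OF sequentially_bot])
  qed
  finally show ?thesis .
qed

text \<open>The submean inequality, with the masses compared to \<open>mass 0\<close>, turns a norm
  bound into locally uniform bounds; Montel's theorem gives the subsequence and Fatou's lemma keeps
  the norm bound for the limit. Both completeness and compactness rest on this.\<close>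

lemma normal_family:
  assumes V: "\<And>n. F n \<in> Fw" and B: "\<And>n. H.q (F n) \<le> B"
  obtains g s where "g \<in> Fw" "H.q g \<le> B" "strict_mono (s :: nat \<Rightarrow> nat)"
    "\<And>z. (\<lambda>n. F (s n) z) \<longlonglongrightarrow> g z" "\<And>X. compact X \<Longrightarrow> uniform_limit X (\<lambda>n. F (s n)) g sequentially"
proof -
  obtain K where K: "K > 0" "\<And>f z. f \<in> Fw \<Longrightarrow> phi f z * mass z \<le> K * H.q f"
    using submean_q by metis
  obtain D \<kappa> where D: "D > 0" "\<kappa> > 0" "\<And>c c'. mass c \<le> D * exp (\<kappa> * cmod (c - c')) * mass c'"
    using mass_doubling by metis
  have bnd: "\<exists>b. \<forall>h\<in>range F. \<forall>z\<in>X. norm (h z) \<le> b" if X: "compact X" for X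
  proof -
    obtain R where R: "\<And>z. z \<in> X \<Longrightarrow> cmod z \<le> R"
      using compact_imp_bounded[OF X] bounded_iff by blast
    define b where "b = K * B * (D * exp (\<kappa> * R)) / mass 0 * exp (\<alpha> * R\<^sup>2)"
    have "cmod (F n z) \<le> sqrt b" if "z \<in> X" for n z
    proof -
      have R0: "0 \<le> cmod z" "cmod z \<le> R" using R[OF that] by auto
      have B0: "0 \<le> B" using B[of n] H.q_nonneg[OF V[of n]] by linarith
      have "mass 0 \<le> D * exp (\<kappa> * cmod (0 - z)) * mass z" by (rule D(3))
      also have "\<dots> \<le> D * exp (\<kappa> * R) * mass z"
        using R0 D mass_pos[of z] by (intro mult_right_mono mult_left_mono) auto
      finally have "phi (F n) z * mass 0 \<le> phi (F n) z * (D * exp (\<kappa> * R) * mass z)"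
        by (intro mult_left_mono) auto
      also have "\<dots> = (D * exp (\<kappa> * R)) * (phi (F n) z * mass z)" by simp
      also have "\<dots> \<le> (D * exp (\<kappa> * R)) * (K * B)"
      proof (intro mult_left_mono)
        have "K * H.q (F n) \<le> K * B" using K(1) B by (intro mult_left_mono) auto
        then show "phi (F n) z * mass z \<le> K * B" using K(2)[OF V[of n], of z] by linarith
      qed (use D in auto)
      finally have "phi (F n) z \<le> K * B * (D * exp (\<kappa> * R)) / mass 0"
        using mass_pos[of 0] by (simp add: field_simps)
      moreover have "(cmod (F n z))\<^sup>2 = phi (F n) z * exp (\<alpha> * (cmod z)\<^sup>2)"
        by (simp add: phi_def mult.assoc flip: exp_add)
      moreover have "phi (F n) z * exp (\<alpha> * (cmod z)\<^sup>2) \<le> (K * B * (D * exp (\<kappa> * R)) / mass 0) * exp (\<alpha> * R\<^sup>2)"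
      proof (rule mult_mono)
        show "phi (F n) z \<le> K * B * (D * exp (\<kappa> * R)) / mass 0" by fact
        then show "0 \<le> K * B * (D * exp (\<kappa> * R)) / mass 0" using phi_nonneg order_trans by blast
        show "exp (\<alpha> * (cmod z)\<^sup>2) \<le> exp (\<alpha> * R\<^sup>2)" using \<alpha> R0 by (auto intro!: power_mono)
      qed simp
      ultimately have "(cmod (F n z))\<^sup>2 \<le> b" unfolding b_def by simp
      then show ?thesis by (rule real_le_rsqrt)
    qed
    then show ?thesis by blast
  qed
  have hol: "h holomorphic_on UNIV" if "h \<in> range F" for h
    using that V by (auto simp: fock_space_def)
  obtain g s where g: "g holomorphic_on UNIV" "strict_mono (s :: nat \<Rightarrow> nat)"
    "\<And>z. z \<in> UNIV \<Longrightarrow> (\<lambda>n. F (s n) z) \<longlonglongrightarrow> g z"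
    "\<And>X. compact X \<Longrightarrow> X \<subseteq> UNIV \<Longrightarrow> uniform_limit X (F \<circ> s) g sequentially"
    using Montel[of UNIV "range F" F, OF open_UNIV hol bnd order_refl] by metis
  have "nrm g \<le> ennreal B"
  proof (rule fatou)
    show "entire (F (s n))" for n using V by (rule entire_V)
    show "entire g" using g by (simp add: entire_def)
    show "(\<lambda>n. F (s n) z) \<longlonglongrightarrow> g z" for z using g by simp
    show "nrm (F (s n)) \<le> ennreal B" if "n \<ge> 0" for n
      using q_nrm[OF V, of "s n"] B[of "s n"] by (metis ennreal_leI)
  qed
  then have gV: "g \<in> Fw" using g by (auto simp: fock_space_iff entire_def less_top[symmetric] top_unique)
  have B0: "0 \<le> B" using B[of 0] H.q_nonneg[OF V[of 0]] by linarith
  have "H.q g \<le> B" using \<open>nrm g \<le> ennreal B\<close> q_nrm[OF gV] B0 by (metis ennreal_le_iff)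
  then show ?thesis using that[OF gV _ g(2)] g(3,4) by (auto simp: o_def)
qed

text \<open>The candidate limit is the pointwise limit of a subsequence. Fatou's lemma, applied to
  \<open>F m\<close> minus that subsequence with m fixed, gives norm convergence of the whole
  sequence. The shift by N provides the norm bound that \<open>normal_family\<close>
  requires.\<close>

lemma fock_complete:
  assumes V: "\<And>n. F n \<in> Fw"
    and cauchy: "\<And>\<epsilon>. \<epsilon> > 0 \<Longrightarrow> \<exists>N. \<forall>m\<ge>N. \<forall>n\<ge>N. Re (ipw (F m - F n) (F m - F n)) < \<epsilon>"
  shows "\<exists>g\<in>Fw. (\<lambda>n. Re (ipw (F n - g) (F n - g))) \<longlonglongrightarrow> 0"
proof -
  obtain N where N: "\<And>m n. m \<ge> N \<Longrightarrow> n \<ge> N \<Longrightarrow> H.q (F m - F n) < 1"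
    using cauchy[of 1] unfolding H.q_def by auto
  have b: "H.q (F (n + N)) \<le> 2 + 2 * H.q (F N)" for n
  proof -
    have "H.q ((F (n + N) - F N) + F N) \<le> 2 * H.q (F (n + N) - F N) + 2 * H.q (F N)"
      using V by (intro H.q_add_le) auto
    then show ?thesis using N[of "n + N" N] by simp
  qed
  obtain g s where g: "g \<in> Fw" "strict_mono (s :: nat \<Rightarrow> nat)" "\<And>z. (\<lambda>n. F (s n + N) z) \<longlonglongrightarrow> g z"
    using normal_family[of "\<lambda>n. F (n + N)", OF V b] by metis
  have "\<exists>n0. \<forall>n\<ge>n0. H.q (F n - g) \<le> \<epsilon>" if \<epsilon>: "\<epsilon> > 0" for \<epsilon>
  proof -
    obtain n0 where n0: "\<And>m n. m \<ge> n0 \<Longrightarrow> n \<ge> n0 \<Longrightarrow> H.q (F m - F n) < \<epsilon>"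
      using cauchy[OF \<epsilon>] unfolding H.q_def by auto
    have "H.q (F m - g) \<le> \<epsilon>" if m: "m \<ge> n0" for m
    proof -
      have "nrm (F m - g) \<le> ennreal \<epsilon>"
      proof (rule fatou)
        show "entire (F m - F (s n + N))" for n using V by (intro entire_V) auto
        show "entire (F m - g)" using V g by (intro entire_V) auto
        show "(\<lambda>n. (F m - F (s n + N)) z) \<longlonglongrightarrow> (F m - g) z" for z
          using g(3)[of z] by (auto intro!: tendsto_intros)
        show "nrm (F m - F (s n + N)) \<le> ennreal \<epsilon>" if "n \<ge> n0" for n
        proof -
          have "s n + N \<ge> n0" using that seq_suble[OF g(2), of n] by linarith
          then have "H.q (F m - F (s n + N)) < \<epsilon>" using n0 m by blast
          moreover have "F m - F (s n + N) \<in> Fw" using V by auto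
          ultimately show ?thesis using q_nrm by (metis ennreal_leI less_imp_le)
        qed
      qed
      moreover have "F m - g \<in> Fw" using V g by auto
      ultimately show ?thesis using \<epsilon> q_nrm by (metis ennreal_le_iff less_imp_le)
    qed
    then show ?thesis by blast
  qed
  note * = this
  have "(\<lambda>n. H.q (F n - g)) \<longlonglongrightarrow> 0"
  proof (rule LIMSEQ_I)
    fix e :: real assume "e > 0"
    then obtain n0 where n0: "\<And>n. n \<ge> n0 \<Longrightarrow> H.q (F n - g) \<le> e / 2" using *[of "e / 2"] by auto
    have "norm (H.q (F n - g) - 0) < e" if "n \<ge> n0" for n
    proof -
      have "F n - g \<in> Fw" using V g by auto
      then show ?thesis using n0[OF that] \<open>e > 0\<close> H.q_nonneg by fastforce
    qed
    then show "\<exists>no. \<forall>n\<ge>no. norm (H.q (F n - g) - 0) < e" by blast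
  qed
  then show ?thesis using g(1) unfolding H.q_def by blast
qed

lemma om_le_1: "om u \<le> 1"
proof -
  have "1 \<le> (1 + cmod u)\<^sup>2" by (rule one_le_power) simp
  then show ?thesis by (auto simp: om_def divide_le_eq)
qed

lemma volterra_affine:
  assumes "f \<in> Fw"
  shows "volterra (\<lambda>z. a * z + b) f = cscale a (prim f)"
proof
  fix z
  have d: "deriv (\<lambda>z. a * z + b) = (\<lambda>_. a)"
    by (auto intro!: ext DERIV_imp_deriv derivative_eq_intros)
  have "f contour_integrable_on linepath 0 z"
    using assms by (intro contour_integrable_continuous_linepath entire_continuous entire_V)
  then show "volterra (\<lambda>z. a * z + b) f z = cscale a (prim f) z"
    unfolding volterra_def d cscale_def prim_def
    by (subst mult.commute) (rule contour_integral_lmul)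
qed

lemma prim_linear:
  assumes "entire f" "entire g"
  shows "prim (f + g) = prim f + prim g" "prim (cscale c f) = cscale c (prim f)"
proof -
  have i: "f contour_integrable_on linepath 0 z" "g contour_integrable_on linepath 0 z" for z
    using assms by (auto intro!: contour_integrable_continuous_linepath entire_continuous)
  show "prim (f + g) = prim f + prim g"
    unfolding prim_def plus_fun_def using contour_integral_add[OF i] by auto
  show "prim (cscale c f) = cscale c (prim f)"
    unfolding prim_def cscale_def using contour_integral_lmul[OF i(1)] by auto
qed

lemma littlewood_paley_V:
  obtains K where "K > 0" "\<And>f. f \<in> Fw \<Longrightarrow> prim f \<in> Fw"
    "\<And>f. f \<in> Fw \<Longrightarrow> nrm (prim f) \<le> ennreal K * (\<integral>\<^sup>+u. ennreal (phi f u * om u) \<partial>nu)"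
proof -
  obtain K where K: "K > 0" "\<And>f. entire f \<Longrightarrow> nrm (prim f) \<le> ennreal K * (\<integral>\<^sup>+u. ennreal (phi f u * om u) \<partial>nu)"
    using littlewood_paley by metis
  have "prim f \<in> Fw" if f: "f \<in> Fw" for f
  proof -
    have "(\<integral>\<^sup>+u. ennreal (phi f u * om u) \<partial>nu) \<le> nrm f"
      unfolding nrm_def using om_le_1 by (intro nn_integral_mono ennreal_leI mult_left_le) auto
    also have "\<dots> < \<infinity>" using f by (simp add: fock_space_iff)
    finally have "ennreal K * (\<integral>\<^sup>+u. ennreal (phi f u * om u) \<partial>nu) < \<infinity>"
      by (simp add: ennreal_mult_less_top)
    then have "nrm (prim f) < \<infinity>" using K(2)[OF entire_V[OF f]] by (rule le_less_trans[rotated])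
    then show ?thesis using entire_prim[OF entire_V[OF f]] by (simp add: fock_space_iff)
  qed
  then show ?thesis using that[OF K(1)] K(2) entire_V by blast
qed

lemma volterra_linear: "linear_operator Fw (volterra (\<lambda>z. a * z + b))"
proof -
  obtain K where K: "K > 0" "\<And>f. f \<in> Fw \<Longrightarrow> prim f \<in> Fw"
    "\<And>f. f \<in> Fw \<Longrightarrow> nrm (prim f) \<le> ennreal K * (\<integral>\<^sup>+u. ennreal (phi f u * om u) \<partial>nu)"
    using littlewood_paley_V by metis
  show ?thesis
    unfolding linear_operator_def
  proof (intro conjI ballI allI)
    fix f assume f: "f \<in> Fw"
    show "volterra (\<lambda>z. a * z + b) f \<in> Fw"
      unfolding volterra_affine[OF f] using K(2)[OF f] by blast
    show "volterra (\<lambda>z. a * z + b) (cscale c f) = cscale c (volterra (\<lambda>z. a * z + b) f)" for c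
      unfolding volterra_affine[OF f] volterra_affine[OF H.scale_in[OF f]]
        prim_linear(2)[OF entire_V[OF f] entire_V[OF f]] by (simp add: mult.commute)
    fix g assume g: "g \<in> Fw"
    show "volterra (\<lambda>z. a * z + b) (f + g) = volterra (\<lambda>z. a * z + b) f + volterra (\<lambda>z. a * z + b) g"
      using f g H.add_in[OF f g] entire_V[OF f] entire_V[OF g]
      by (simp add: volterra_affine prim_linear cfun.scale_right_distrib)
  qed
qed

sublocale T: operator_form Fw ipw "volterra (\<lambda>z. a * z + b)" for a b
  by unfold_locales (rule volterra_linear)

lemma volterra_bound:
  obtains K where "K > 0" "\<And>f. f \<in> Fw \<Longrightarrow> ennreal (H.q (volterra (\<lambda>z. a * z + b) f)) \<le> ennreal K * (\<integral>\<^sup>+u. ennreal (phi f u * om u) \<partial>nu)"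
proof -
  obtain K where K: "K > 0" "\<And>f. f \<in> Fw \<Longrightarrow> prim f \<in> Fw"
    "\<And>f. f \<in> Fw \<Longrightarrow> nrm (prim f) \<le> ennreal K * (\<integral>\<^sup>+u. ennreal (phi f u * om u) \<partial>nu)"
    using littlewood_paley_V by metis
  \<comment> \<open>The added 1 keeps the constant positive for a = 0.\<close>
  define K' where "K' = ((cmod a)\<^sup>2 + 1) * K"
  show ?thesis
  proof (rule that[of K'])
    show "K' > 0" using K by (simp add: K'_def add_nonneg_pos)
    fix f assume f: "f \<in> Fw"
    have p: "prim f \<in> Fw" by (rule K(2)[OF f])
    have "H.q (volterra (\<lambda>z. a * z + b) f) \<le> ((cmod a)\<^sup>2 + 1) * H.q (prim f)"
      unfolding volterra_affine[OF f] H.q_scale[OF p] using H.q_nonneg[OF p] by (intro mult_right_mono) auto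
    then have "ennreal (H.q (volterra (\<lambda>z. a * z + b) f)) \<le> ennreal (((cmod a)\<^sup>2 + 1) * H.q (prim f))"
      by (rule ennreal_leI)
    also have "\<dots> = ennreal ((cmod a)\<^sup>2 + 1) * nrm (prim f)"
      using q_nrm[OF p] by (simp add: ennreal_mult')
    also have "\<dots> \<le> ennreal ((cmod a)\<^sup>2 + 1) * (ennreal K * (\<integral>\<^sup>+u. ennreal (phi f u * om u) \<partial>nu))"
      by (intro mult_left_mono K(3) f) simp
    also have "\<dots> = ennreal K' * (\<integral>\<^sup>+u. ennreal (phi f u * om u) \<partial>nu)"
      using K(1) unfolding K'_def by (subst ennreal_mult'') (simp_all add: mult.assoc)
    finally show "ennreal (H.q (volterra (\<lambda>z. a * z + b) f)) \<le> \<dots>" .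
  qed
qed

text \<open>After subtracting the locally uniform limit, the integral bounding the image is small
  for two reasons: on a large disc the functions are uniformly small, and outside it
  \<open>om\<close> is small while the norms stay bounded.\<close>

lemma volterra_compact: "compact_operator Fw ipw (volterra (\<lambda>z. a * z + b))"
  unfolding compact_operator_def
proof (intro conjI allI impI volterra_linear)
  fix F :: "nat \<Rightarrow> cfun"
  let ?T = "volterra (\<lambda>z. a * z + b)"
  assume "(\<forall>n. F n \<in> Fw) \<and> bounded (range (\<lambda>n. ip_norm ipw (F n)))"
  then have V: "\<And>n. F n \<in> Fw" and bdd: "bounded (range (\<lambda>n. ip_norm ipw (F n)))" by auto
  obtain b0 where "\<And>n. norm (ip_norm ipw (F n)) \<le> b0" using bdd unfolding bounded_iff by auto
  then have b0: "\<bar>sqrt (H.q (F n))\<bar> \<le> b0" for n by (simp add: H.ip_norm_eq)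
  define B where "B = b0\<^sup>2"
  have B: "H.q (F n) \<le> B" for n
  proof -
    have "(sqrt (H.q (F n)))\<^sup>2 \<le> b0\<^sup>2" using b0[of n] H.q_nonneg[OF V[of n]] by (intro power_mono) auto
    then show ?thesis using H.q_nonneg[OF V[of n]] by (simp add: B_def)
  qed
  have B0: "B \<ge> 0" by (simp add: B_def)
  obtain g s where g: "g \<in> Fw" "H.q g \<le> B" "strict_mono (s :: nat \<Rightarrow> nat)"
    "\<And>z. (\<lambda>n. F (s n) z) \<longlonglongrightarrow> g z"
    "\<And>X. compact X \<Longrightarrow> uniform_limit X (\<lambda>n. F (s n)) g sequentially"
    using normal_family[of F B, OF V B] by blast
  define h where "h n = F (s n) - g" for n
  have hV: "h n \<in> Fw" for n unfolding h_def using V g by auto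
  have hB: "H.q (h n) \<le> 4 * B" for n
    using H.q_diff_le[OF V[of "s n"] g(1)] B[of "s n"] g(2) unfolding h_def by linarith
  obtain K where K: "K > 0" "\<And>f. f \<in> Fw \<Longrightarrow> ennreal (H.q (?T f)) \<le> ennreal K * (\<integral>\<^sup>+u. ennreal (phi f u * om u) \<partial>nu)"
    using volterra_bound[of a b] by metis
  have lim: "(\<lambda>n. H.q (?T (h n))) \<longlonglongrightarrow> 0"
  proof (rule LIMSEQ_I)
    fix e :: real assume e: "e > 0"
    \<comment> \<open>Makes the part outside the disc at most e/4, given the bound 4B on
      \<open>H.q (h n)\<close>.\<close>
    define R where "R = 1 + 16 * K * B / e"
    have R: "R \<ge> 1" using K B0 e by (simp add: R_def)
    define M where "M = measure nu (cball 0 R)"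
    have M: "emeasure nu (cball 0 R) = ennreal M" "M \<ge> 0"
      unfolding M_def by (auto intro!: wmeas_finite[OF weight compact_cball])
    \<comment> \<open>Makes the part inside the disc at most e/4; M + 1 avoids a division by
      0.\<close>
    define \<delta> where "\<delta> = sqrt (e / (4 * K * (M + 1)))"
    have \<delta>: "\<delta> > 0" "\<delta>\<^sup>2 = e / (4 * K * (M + 1))" using e K M by (auto simp: \<delta>_def)
    have "eventually (\<lambda>n. \<forall>z\<in>cball 0 R. dist (F (s n) z) (g z) < \<delta>) sequentially"
      using g(5)[OF compact_cball] \<delta>(1) by (rule uniform_limitD)
    then obtain n0 where n0': "\<forall>n\<ge>n0. \<forall>z\<in>cball 0 R. dist (F (s n) z) (g z) < \<delta>"
      unfolding eventually_sequentially by blast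
    have n0: "cmod (h n z) < \<delta>" if "n \<ge> n0" "z \<in> cball 0 R" for n z
      using n0'[rule_format, OF that] by (simp add: h_def dist_norm)
    have "H.q (?T (h n)) < e" if n: "n \<ge> n0" for n
    proof -
      have "(\<integral>\<^sup>+u. ennreal (phi (h n) u * om u) \<partial>nu)
          \<le> (\<integral>\<^sup>+u. ennreal (\<delta>\<^sup>2) * indicator (cball 0 R) u + ennreal (1 / R) * ennreal (phi (h n) u) \<partial>nu)"
      proof (rule nn_integral_mono)
        fix u
        show "ennreal (phi (h n) u * om u) \<le> ennreal (\<delta>\<^sup>2) * indicator (cball 0 R) u + ennreal (1 / R) * ennreal (phi (h n) u)"
        proof (cases "u \<in> cball 0 R")
          case True
          have "(cmod (h n u))\<^sup>2 \<le> \<delta>\<^sup>2" using n0[OF n True] by (intro power_mono) auto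
          moreover have "exp (- \<alpha> * (cmod u)\<^sup>2) \<le> 1" using \<alpha> by simp
          ultimately have "phi (h n) u \<le> \<delta>\<^sup>2 * 1" unfolding phi_def by (intro mult_mono) auto
          then have "phi (h n) u * om u \<le> \<delta>\<^sup>2 * 1"
            using om_le_1[of u] om_pos[of u] by (intro mult_mono) auto
          then have "ennreal (phi (h n) u * om u) \<le> ennreal (\<delta>\<^sup>2)" by (intro ennreal_leI) simp
          then show ?thesis using True by (simp add: add_increasing2)
        next
          case False
          then have "R \<le> cmod u" by simp
          then have "R * 1 \<le> (1 + cmod u) * (1 + cmod u)" using R by (intro mult_mono) auto
          then have "om u \<le> 1 / R" unfolding om_def using R
            by (intro divide_left_mono) (auto simp: power2_eq_square intro!: mult_pos_pos)
          then have "phi (h n) u * om u \<le> 1 / R * phi (h n) u"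
            using mult_left_mono[OF _ phi_nonneg[of "h n" u]] by (metis mult.commute)
          then show ?thesis using False R by (simp add: ennreal_leI flip: ennreal_mult')
        qed
      qed
      also have "\<dots> = (\<integral>\<^sup>+u. ennreal (\<delta>\<^sup>2) * indicator (cball 0 R) u \<partial>nu) + (\<integral>\<^sup>+u. ennreal (1 / R) * ennreal (phi (h n) u) \<partial>nu)"
        by (intro nn_integral_add borel_measurable_times_ennreal borel_measurable_const
            borel_measurable_indicator phi_measurable entire_V hV) simp
      also have "(\<integral>\<^sup>+u. ennreal (\<delta>\<^sup>2) * indicator (cball 0 R) u \<partial>nu) = ennreal (\<delta>\<^sup>2) * ennreal M"
        unfolding M(1)[symmetric] by (rule nn_integral_cmult_indicator) simp
      also have "(\<integral>\<^sup>+u. ennreal (1 / R) * ennreal (phi (h n) u) \<partial>nu) = ennreal (1 / R) * nrm (h n)"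
        unfolding nrm_def by (intro nn_integral_cmult phi_measurable entire_V hV)
      also have "ennreal (\<delta>\<^sup>2) * ennreal M + ennreal (1 / R) * nrm (h n) = ennreal (\<delta>\<^sup>2 * M + 1 / R * H.q (h n))"
      proof -
        have "0 \<le> \<delta>\<^sup>2 * M" "0 \<le> 1 / R * H.q (h n)" "0 \<le> 1 / R"
          using M(2) R H.q_nonneg[OF hV[of n]] by auto
        then show ?thesis
          by (simp only: ennreal_plus ennreal_mult' zero_le_power2 q_nrm[OF hV])
      qed
      finally have "ennreal (H.q (?T (h n))) \<le> ennreal K * ennreal (\<delta>\<^sup>2 * M + 1 / R * H.q (h n))"
        using K(2)[OF hV[of n]] by (meson mult_left_mono order_trans zero_le)
      then have "ennreal (H.q (?T (h n))) \<le> ennreal (K * (\<delta>\<^sup>2 * M + 1 / R * H.q (h n)))"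
        using K(1) by (simp add: ennreal_mult')
      moreover have nn: "0 \<le> K * (\<delta>\<^sup>2 * M + 1 / R * H.q (h n))"
        using K(1) M(2) R H.q_nonneg[OF hV[of n]] by (auto intro!: mult_nonneg_nonneg add_nonneg_nonneg)
      ultimately have "H.q (?T (h n)) \<le> K * (\<delta>\<^sup>2 * M + 1 / R * H.q (h n))"
        by (simp only: ennreal_le_iff)
      also have "\<dots> = K * \<delta>\<^sup>2 * M + K / R * H.q (h n)" by (simp add: algebra_simps)
      also have "K * \<delta>\<^sup>2 * M \<le> e / 4"
      proof -
        have "K * \<delta>\<^sup>2 * M = e / 4 * (M / (M + 1))" unfolding \<delta>(2) using K(1) by simp
        also have "\<dots> \<le> e / 4 * 1" using e M(2) by (intro mult_left_mono) auto
        finally show ?thesis by simp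
      qed
      also have "K / R * H.q (h n) \<le> K / R * (4 * B)"
        using K R hB by (intro mult_left_mono) auto
      also have "K / R * (4 * B) \<le> e / 4"
      proof -
        have "16 * K * B \<le> e * R" using e by (simp add: R_def field_simps)
        then show ?thesis using R by (simp add: field_simps)
      qed
      finally show ?thesis using e by simp
    qed
    then have "norm (H.q (?T (h n)) - 0) < e" if "n \<ge> n0" for n
      using that H.q_nonneg[OF T.T_in[OF hV[of n]]] by simp
    then show "\<exists>no. \<forall>n\<ge>no. norm (H.q (?T (h n)) - 0) < e" by blast
  qed
  have eq: "ip_norm ipw (?T (F (s n)) - ?T g) = sqrt (H.q (?T (h n)))" for n
    unfolding h_def H.ip_norm_eq using T.T_diff[OF V g(1)] by simp
  have "(\<lambda>n. ip_norm ipw (?T (F (s n)) - ?T g)) \<longlonglongrightarrow> 0"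
    unfolding eq using tendsto_real_sqrt[OF lim] by simp
  then show "\<exists>r. \<exists>g\<in>Fw. strict_mono r \<and> (\<lambda>n. ip_norm ipw (?T (F (r n)) - g)) \<longlonglongrightarrow> 0"
    using g(3) T.T_in[OF g(1)] by blast
qed

end

section \<open>Membership in the Schatten classes\<close>

lemma sum_cfun_apply: "(sum F I :: cfun) z = (\<Sum>i\<in>I. F i z)"
  by (induction I rule: infinite_finite_induct) auto

context fock_weight begin

text \<open>Testing the pointwise estimate on \<open>\<Sum>\<^sub>e cnj (e z) e\<close> bounds the diagonal of the reproducing kernel.\<close>

lemma orthonormal_kernel_bound:
  obtains K where "K > 0"
    "\<And>S z. finite S \<Longrightarrow> S \<subseteq> Fw \<Longrightarrow> orthonormal ipw S \<Longrightarrow> (\<Sum>e\<in>S. phi e z) * mass z \<le> K"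
proof -
  obtain K where K: "K > 0" "\<And>f z. f \<in> Fw \<Longrightarrow> phi f z * mass z \<le> K * H.q f"
    using submean_q by metis
  show ?thesis
  proof (rule that[OF K(1)])
    fix S z assume S: "finite S" "S \<subseteq> Fw" "orthonormal ipw S"
    define h where "h = (\<Sum>e\<in>S. cscale (cnj (e z)) e)"
    define t where "t = (\<Sum>e\<in>S. (cmod (e z))\<^sup>2)"
    have t0: "t \<ge> 0" unfolding t_def by (intro sum_nonneg) auto
    have h: "h \<in> Fw" unfolding h_def using S by (intro H.sum_in) blast
    have he: "ipw h e = cnj (e z)" if "e \<in> S" for e
      unfolding h_def using S that by (rule H.orthonormal_sum_left)
    have hz: "h z = complex_of_real t"
      unfolding h_def t_def sum_cfun_apply of_real_sum
      by (intro sum.cong refl) (simp only: cscale_def complex_norm_square mult.commute)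
    have "ipw h (\<Sum>e\<in>S. cscale (cnj (e z)) e) = (\<Sum>e\<in>S. ipw h (cscale (cnj (e z)) e))"
      using S h by (intro H.sum_right) blast+
    then have "ipw h h = (\<Sum>e\<in>S. ipw h (cscale (cnj (e z)) e))"
      by (simp only: h_def[symmetric])
    also have "\<dots> = (\<Sum>e\<in>S. complex_of_real ((cmod (e z))\<^sup>2))"
    proof (intro sum.cong refl)
      fix e assume e: "e \<in> S"
      then have "ipw h (cscale (cnj (e z)) e) = cnj (cnj (e z)) * ipw h e"
        using S h by (intro H.scale_right) auto
      then show "ipw h (cscale (cnj (e z)) e) = complex_of_real ((cmod (e z))\<^sup>2)"
        by (simp only: he[OF e] complex_cnj_cnj complex_norm_square)
    qed
    finally have qh: "H.q h = t" by (simp add: H.q_def t_def)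
    have P: "(\<Sum>e\<in>S. phi e z) = t * exp (- \<alpha> * (cmod z)\<^sup>2)"
      by (simp add: phi_def t_def sum_distrib_right)
    \<comment> \<open>Both \<open>h z\<close> and \<open>H.q h\<close> equal t, so the pointwise
      estimate has t squared on the left and t on the right; one factor cancels.\<close>
    have "phi h z = t * (\<Sum>e\<in>S. phi e z)"
      unfolding P by (simp add: phi_def hz power2_eq_square)
    then have "t * ((\<Sum>e\<in>S. phi e z) * mass z) \<le> t * K"
      using K(2)[OF h, of z] by (simp add: qh mult_ac)
    then show "(\<Sum>e\<in>S. phi e z) * mass z \<le> K"
      using t0 K(1) unfolding P by (cases "t = 0") (auto simp: mult_le_cancel_left)
  qed
qed

lemma phi_om_powr_continuous:
  assumes "S \<subseteq> Fw"
  shows "continuous_on UNIV (\<lambda>u. (\<Sum>e\<in>S. phi e u) * om u powr c)"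
proof (rule continuous_on_mult)
  show "continuous_on UNIV (\<lambda>u. \<Sum>e\<in>S. phi e u)"
    using assms by (intro continuous_on_sum phi_continuous entire_V) blast
  have "om u \<noteq> 0" for u using om_pos[of u] by simp
  then show "continuous_on UNIV (\<lambda>u. om u powr c)"
    by (intro continuous_on_powr om_continuous continuous_on_const) auto
qed

text \<open>On each lattice square the kernel bound contains the reciprocal of the mass, and
  integration restores the mass. What is left is an unweighted lattice sum, independent of the
  system S and of its size.\<close>

lemma orthonormal_om_bound:
  assumes p: "p > 2"
  obtains X where "X > 0"
    "\<And>S. finite S \<Longrightarrow> S \<subseteq> Fw \<Longrightarrow> orthonormal ipw S \<Longrightarrow>
      (\<integral>\<^sup>+u. ennreal ((\<Sum>e\<in>S. phi e u) * om u powr (p / 2)) \<partial>nu) \<le> ennreal X"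
proof -
  obtain K where K: "K > 0"
    "\<And>S z. finite S \<Longrightarrow> S \<subseteq> Fw \<Longrightarrow> orthonormal ipw S \<Longrightarrow> (\<Sum>e\<in>S. phi e z) * mass z \<le> K"
    using orthonormal_kernel_bound by metis
  obtain D \<kappa> where D: "D > 0" "\<kappa> > 0" "\<And>c c'. mass c \<le> D * exp (\<kappa> * cmod (c - c')) * mass c'"
    using mass_doubling by metis
  define D' where "D' = D * exp (\<kappa> * (2 * r))"
  have D': "D' > 0" using D by (simp add: D'_def)
  define L where "L = exp (4 * r * (p / 2))"
  define Y where "Y = enn2real (nsum (\<lambda>i. ennreal ((1 + cmod (latt r i)) powr - p)))"
  have Y: "nsum (\<lambda>i. ennreal ((1 + cmod (latt r i)) powr - p)) = ennreal Y" "Y \<ge> 0"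
    using nsum_latt_powr[OF r p] by (auto simp: Y_def less_top)
  define X where "X = K * D' * L * Y + 1"
  show ?thesis
  proof (rule that[of X])
    have "0 \<le> K * D' * L * Y" using K D' Y by (simp add: L_def)
    then show "X > 0" by (simp add: X_def)
    fix S assume S: "finite S" "S \<subseteq> Fw" "orthonormal ipw S"
    let ?P = "\<lambda>u. \<Sum>e\<in>S. phi e u"
    have P0: "?P u \<ge> 0" for u by (intro sum_nonneg) auto
    have meas: "(\<lambda>u. ennreal (?P u * om u powr (p / 2))) \<in> borel_measurable nu"
      by (intro ennreal_measurable_nu phi_om_powr_continuous S(2))
    have "(\<integral>\<^sup>+u. ennreal (?P u * om u powr (p / 2)) \<partial>nu)
        \<le> nsum (\<lambda>i. \<integral>\<^sup>+u. ennreal (?P u * om u powr (p / 2)) * indicator (sq r (latt r i)) u \<partial>nu)"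
      by (rule nn_integral_latt_le[OF r sets_wmeas meas])
    also have "\<dots> \<le> nsum (\<lambda>i. ennreal (K * D' * L) * ennreal ((1 + cmod (latt r i)) powr - p))"
    proof (rule nn_integral_mono)
      fix i
      let ?c = "latt r i"
      have mc: "mass ?c > 0" by (rule mass_pos)
      have "(\<integral>\<^sup>+u. ennreal (?P u * om u powr (p / 2)) * indicator (sq r ?c) u \<partial>nu)
          \<le> ennreal (K * D' / mass ?c * (L * (1 + cmod ?c) powr - p)) * emeasure nu (sq r ?c)"
      proof (rule nn_integral_sq_le[OF sets_wmeas], rule ennreal_leI, rule mult_mono)
        fix u assume u: "u \<in> sq r ?c"
        have uc: "cmod (u - ?c) \<le> 2 * r" using u r by (rule dist_sq)
        have "mass ?c \<le> D * exp (\<kappa> * cmod (?c - u)) * mass u" by (rule D(3))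
        also have "\<dots> \<le> D' * mass u"
          unfolding D'_def using uc D mass_pos[of u]
          by (intro mult_right_mono mult_left_mono) (auto simp: norm_minus_commute)
        finally have "?P u * mass ?c \<le> ?P u * (D' * mass u)" by (intro mult_left_mono P0)
        also have "\<dots> = D' * (?P u * mass u)" by (simp add: mult_ac)
        also have "\<dots> \<le> D' * K" using D' by (intro mult_left_mono K(2)[OF S]) auto
        finally show "?P u \<le> K * D' / mass ?c" using mc by (simp add: le_divide_eq mult.commute)
        have "om u \<le> exp (2 * cmod (u - ?c)) * om ?c" by (rule om_shift)
        also have "\<dots> \<le> exp (4 * r) * om ?c"
          using uc om_pos[of ?c] by (intro mult_right_mono) auto
        finally have "om u powr (p / 2) \<le> (exp (4 * r) * om ?c) powr (p / 2)"
          using p om_pos[of u] by (intro powr_mono2) auto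
        also have "\<dots> = L * (om ?c powr (p / 2))"
          using om_pos[of ?c] by (simp add: powr_mult L_def powr_def[of "exp _"] mult.commute)
        also have "om ?c powr (p / 2) = (1 + cmod ?c) powr - p"
        proof -
          have pos: "1 + cmod ?c > 0" using norm_ge_zero[of ?c] by linarith
          have "om ?c = (1 + cmod ?c) powr - 2"
            using pos by (simp add: om_def powr_minus_divide powr_numeral)
          then show ?thesis by (simp add: powr_powr)
        qed
        finally show "om u powr (p / 2) \<le> L * (1 + cmod ?c) powr - p" .
      qed (use K D' mc in auto)
      also have "\<dots> = ennreal (K * D' / mass ?c * (L * (1 + cmod ?c) powr - p) * mass ?c)"
        unfolding emeasure_sq using mc by (simp only: ennreal_mult''[OF less_imp_le])
      also have "K * D' / mass ?c * (L * (1 + cmod ?c) powr - p) * mass ?c = K * D' * L * (1 + cmod ?c) powr - p"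
        using mc by simp
      finally show "(\<integral>\<^sup>+u. ennreal (?P u * om u powr (p / 2)) * indicator (sq r ?c) u \<partial>nu)
          \<le> ennreal (K * D' * L) * ennreal ((1 + cmod ?c) powr - p)"
        by (subst (asm) ennreal_mult'') simp_all
    qed
    also have "\<dots> = ennreal (K * D' * L) * ennreal Y"
      unfolding Y(1)[symmetric] by (rule nn_integral_cmult) simp
    also have "\<dots> = ennreal (K * D' * L * Y)" using Y(2) by (rule ennreal_mult''[symmetric])
    also have "\<dots> \<le> ennreal X" unfolding X_def by (intro ennreal_leI) simp
    finally show "(\<integral>\<^sup>+u. ennreal (?P u * om u powr (p / 2)) \<partial>nu) \<le> ennreal X" .
  qed
qed

text \<open>Summing the Littlewood-Paley bound over S leaves the integral of \<open>om\<close>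
  against the sum of the \<open>phi e\<close>, whose total mass is the number n of vectors.
  Splitting \<open>om\<close> at a level \<epsilon> gives a term proportional to n, absorbed on the
  left, and a term in the power p/2 of \<open>om\<close>, bounded independently of n.\<close>

lemma volterra_count_bound:
  assumes p: "p > 2"
  obtains C0 where "count_bound Fw ipw (volterra (\<lambda>z. a * z + b)) p C0"
proof -
  let ?T = "volterra (\<lambda>z. a * z + b)"
  define q where "q = p / 2"
  have q: "q > 1" using p by (simp add: q_def)
  obtain K where K: "K > 0" "\<And>f. f \<in> Fw \<Longrightarrow> ennreal (H.q (?T f)) \<le> ennreal K * (\<integral>\<^sup>+u. ennreal (phi f u * om u) \<partial>nu)"
    using volterra_bound[of a b] by metis
  obtain X where X: "X > 0"
    "\<And>S. finite S \<Longrightarrow> S \<subseteq> Fw \<Longrightarrow> orthonormal ipw S \<Longrightarrow>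
      (\<integral>\<^sup>+u. ennreal ((\<Sum>e\<in>S. phi e u) * om u powr (p / 2)) \<partial>nu) \<le> ennreal X"
    using orthonormal_om_bound[OF p] by blast
  have "count_bound Fw ipw ?T p (X * (2 * K) powr q)"
    unfolding count_bound_def
  proof (intro allI impI)
    fix \<sigma> :: real and S
    assume \<sigma>: "\<sigma> > 0" and S: "finite S" "S \<subseteq> Fw" "orthonormal ipw S" and big: "\<forall>e\<in>S. \<sigma>\<^sup>2 \<le> Re (ipw (?T e) (?T e))"
    define n where "n = real (card S)"
    \<comment> \<open>With this level the first part contributes exactly half of
      \<open>n * \<sigma>\<^sup>2\<close>.\<close>
    define \<epsilon> where "\<epsilon> = \<sigma>\<^sup>2 / (2 * K)"
    have \<epsilon>: "\<epsilon> > 0" using \<sigma> K by (simp add: \<epsilon>_def)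
    \<comment> \<open>Where \<open>om u\<close> exceeds \<epsilon>, its negative power 1 - q is at
      most that of \<epsilon>.\<close>
    have om_split: "om u \<le> \<epsilon> + \<epsilon> powr (1 - q) * om u powr q" for u
    proof (cases "om u \<le> \<epsilon>")
      case False
      have "om u = om u powr (1 - q) * om u powr q" using om_pos[of u] by (simp flip: powr_add)
      also have "\<dots> \<le> \<epsilon> powr (1 - q) * om u powr q"
        using False \<epsilon> q by (intro mult_right_mono powr_mono2') auto
      finally show ?thesis using \<epsilon> by simp
    qed (simp add: add_increasing2)
    have m1: "(\<lambda>u. ennreal (phi e u)) \<in> borel_measurable nu" if "e \<in> S" for e
      using that S by (intro phi_measurable entire_V) blast
    have mom: "(\<lambda>u. ennreal (phi e u * om u)) \<in> borel_measurable nu" if "e \<in> S" for e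
      using that S by (intro ennreal_measurable_nu continuous_intros om_continuous phi_continuous entire_V) blast
    have mpow: "(\<lambda>u. ennreal ((\<Sum>e\<in>S. phi e u) * om u powr q)) \<in> borel_measurable nu"
      by (intro ennreal_measurable_nu phi_om_powr_continuous S(2))
    have nrm1: "nrm e = 1" if "e \<in> S" for e
    proof -
      have "ipw e e = 1" using that S(3) by (simp add: orthonormal_def)
      then show ?thesis using that S(2) ennreal_fock_norm[of e] by auto
    qed
    have "ennreal (n * \<sigma>\<^sup>2) \<le> (\<Sum>e\<in>S. ennreal (H.q (?T e)))"
    proof -
      have "n * \<sigma>\<^sup>2 = (\<Sum>e\<in>S. \<sigma>\<^sup>2)" by (simp add: n_def)
      also have "\<dots> \<le> (\<Sum>e\<in>S. H.q (?T e))" using big by (intro sum_mono) (simp add: H.q_def)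
      finally have "ennreal (n * \<sigma>\<^sup>2) \<le> ennreal (\<Sum>e\<in>S. H.q (?T e))" by (rule ennreal_leI)
      also have "\<dots> = (\<Sum>e\<in>S. ennreal (H.q (?T e)))"
        using S(2) by (intro sum_ennreal[symmetric] H.q_nonneg T.T_in) blast
      finally show ?thesis .
    qed
    also have "\<dots> \<le> (\<Sum>e\<in>S. ennreal K * (\<integral>\<^sup>+u. ennreal (phi e u * om u) \<partial>nu))"
      using S(2) by (intro sum_mono K(2)) blast
    also have "\<dots> = ennreal K * (\<integral>\<^sup>+u. (\<Sum>e\<in>S. ennreal (phi e u * om u)) \<partial>nu)"
      by (simp add: sum_distrib_left[symmetric] nn_integral_sum[OF mom])
    also have "(\<integral>\<^sup>+u. (\<Sum>e\<in>S. ennreal (phi e u * om u)) \<partial>nu)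
        \<le> (\<integral>\<^sup>+u. ennreal \<epsilon> * (\<Sum>e\<in>S. ennreal (phi e u)) + ennreal (\<epsilon> powr (1 - q)) * ennreal ((\<Sum>e\<in>S. phi e u) * om u powr q) \<partial>nu)"
    proof (rule nn_integral_mono)
      fix u
      have P0: "0 \<le> (\<Sum>e\<in>S. phi e u)" by (intro sum_nonneg) simp
      have "(\<Sum>e\<in>S. ennreal (phi e u * om u)) = ennreal ((\<Sum>e\<in>S. phi e u) * om u)"
        using om_pos[of u] by (simp add: sum_distrib_right)
      also have "\<dots> \<le> ennreal ((\<Sum>e\<in>S. phi e u) * (\<epsilon> + \<epsilon> powr (1 - q) * om u powr q))"
        by (intro ennreal_leI mult_left_mono om_split P0)
      also have "(\<Sum>e\<in>S. phi e u) * (\<epsilon> + \<epsilon> powr (1 - q) * om u powr q)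
          = \<epsilon> * (\<Sum>e\<in>S. phi e u) + \<epsilon> powr (1 - q) * ((\<Sum>e\<in>S. phi e u) * om u powr q)"
        by (simp only: distrib_left mult_ac)
      also have "ennreal \<dots> = ennreal \<epsilon> * (\<Sum>e\<in>S. ennreal (phi e u)) + ennreal (\<epsilon> powr (1 - q)) * ennreal ((\<Sum>e\<in>S. phi e u) * om u powr q)"
        using \<epsilon> P0 by (subst ennreal_plus) (auto simp: ennreal_mult')
      finally show "(\<Sum>e\<in>S. ennreal (phi e u * om u)) \<le> \<dots>" .
    qed
    also have "\<dots> = (\<integral>\<^sup>+u. ennreal \<epsilon> * (\<Sum>e\<in>S. ennreal (phi e u)) \<partial>nu)
        + (\<integral>\<^sup>+u. ennreal (\<epsilon> powr (1 - q)) * ennreal ((\<Sum>e\<in>S. phi e u) * om u powr q) \<partial>nu)"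
      by (intro nn_integral_add borel_measurable_times_ennreal borel_measurable_const borel_measurable_sum m1 mpow)
    also have "(\<integral>\<^sup>+u. ennreal \<epsilon> * (\<Sum>e\<in>S. ennreal (phi e u)) \<partial>nu) = ennreal \<epsilon> * (\<integral>\<^sup>+u. (\<Sum>e\<in>S. ennreal (phi e u)) \<partial>nu)"
      by (intro nn_integral_cmult borel_measurable_sum m1)
    also have "(\<integral>\<^sup>+u. (\<Sum>e\<in>S. ennreal (phi e u)) \<partial>nu) = (\<Sum>e\<in>S. nrm e)"
      unfolding nrm_def by (rule nn_integral_sum[OF m1])
    also have "(\<Sum>e\<in>S. nrm e) = ennreal n" by (simp add: nrm1 n_def ennreal_of_nat_eq_real_of_nat)
    also have "(\<integral>\<^sup>+u. ennreal (\<epsilon> powr (1 - q)) * ennreal ((\<Sum>e\<in>S. phi e u) * om u powr q) \<partial>nu)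
        = ennreal (\<epsilon> powr (1 - q)) * (\<integral>\<^sup>+u. ennreal ((\<Sum>e\<in>S. phi e u) * om u powr q) \<partial>nu)"
      by (intro nn_integral_cmult mpow)
    also have "(\<integral>\<^sup>+u. ennreal ((\<Sum>e\<in>S. phi e u) * om u powr q) \<partial>nu) \<le> ennreal X"
      unfolding q_def by (rule X(2)[OF S])
    finally have "ennreal (n * \<sigma>\<^sup>2) \<le> ennreal K * (ennreal \<epsilon> * ennreal n + ennreal (\<epsilon> powr (1 - q)) * ennreal X)"
      by (simp add: mult_left_mono add_left_mono)
    also have "\<dots> = ennreal (K * (\<epsilon> * n + \<epsilon> powr (1 - q) * X))"
    proof -
      have "0 \<le> \<epsilon> * n" "0 \<le> \<epsilon> powr (1 - q) * X" using \<epsilon> X by (auto simp: n_def)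
      then show ?thesis using K(1) \<epsilon> by (simp only: ennreal_plus ennreal_mult' less_imp_le powr_ge_zero)
    qed
    finally have "n * \<sigma>\<^sup>2 \<le> K * (\<epsilon> * n + \<epsilon> powr (1 - q) * X)"
      using K(1) \<epsilon> X(1) by (subst (asm) ennreal_le_iff) (auto simp: n_def intro!: mult_nonneg_nonneg add_nonneg_nonneg)
    also have "\<dots> = n * \<sigma>\<^sup>2 / 2 + K * \<epsilon> powr (1 - q) * X"
      using K(1) by (simp add: \<epsilon>_def field_simps)
    finally have "n * \<sigma>\<^sup>2 \<le> 2 * K * \<epsilon> powr (1 - q) * X" by simp
    \<comment> \<open>Clears the negative power of \<epsilon>; since \<open>\<sigma>\<^sup>2\<close>
      is \<open>2 * K * \<epsilon>\<close>, the result is a bound on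
      \<open>n * \<epsilon> powr q\<close>, a constant multiple of
      \<open>n * \<sigma> powr p\<close>.\<close>
    then have "n * \<sigma>\<^sup>2 * \<epsilon> powr (q - 1) \<le> 2 * K * \<epsilon> powr (1 - q) * X * \<epsilon> powr (q - 1)"
      by (intro mult_right_mono) auto
    also have "\<dots> = 2 * K * X * (\<epsilon> powr (1 - q) * \<epsilon> powr (q - 1))" by simp
    also have "\<epsilon> powr (1 - q) * \<epsilon> powr (q - 1) = 1" using \<epsilon> by (simp flip: powr_add)
    also have "\<sigma>\<^sup>2 = 2 * K * \<epsilon>" using K(1) by (simp add: \<epsilon>_def)
    finally have "n * \<epsilon> * \<epsilon> powr (q - 1) \<le> X" using K(1) by (simp add: mult_ac)
    moreover have "\<epsilon> * \<epsilon> powr (q - 1) = \<epsilon> powr q" using \<epsilon> by (simp add: powr_mult_base)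
    ultimately have le: "n * \<epsilon> powr q \<le> X" by (simp add: mult.assoc)
    have "\<sigma> powr p = (\<sigma>\<^sup>2) powr q"
      using \<sigma> by (simp add: q_def powr_powr flip: powr_numeral)
    also have "\<sigma>\<^sup>2 = 2 * K * \<epsilon>" using K(1) by (simp add: \<epsilon>_def)
    also have "(2 * K * \<epsilon>) powr q = (2 * K) powr q * \<epsilon> powr q" by (rule powr_mult)
    finally have "card S * \<sigma> powr p = (2 * K) powr q * (n * \<epsilon> powr q)" by (simp add: n_def mult_ac)
    also have "\<dots> \<le> (2 * K) powr q * X" by (intro mult_left_mono le) simp
    finally show "card S * \<sigma> powr p \<le> X * (2 * K) powr q" by (simp add: mult.commute)
  qed
  then show ?thesis by (rule that)
qed

lemma volterra_schatten:
  assumes "p > 2"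
  shows "volterra (\<lambda>z. a * z + b) \<in> schatten_class p Fw ipw"
proof -
  \<comment> \<open>A point strictly between 2 and p: the count bound needs p' > 2, summability
    needs p' < p.\<close>
  define p' where "p' = (2 + p) / 2"
  have p': "2 < p'" "p' < p" using assms by (auto simp: p'_def)
  obtain C0 where "count_bound Fw ipw (volterra (\<lambda>z. a * z + b)) p' C0"
    by (rule volterra_count_bound[OF p'(1)])
  then have "summable (\<lambda>n. singular_value Fw ipw (volterra (\<lambda>z. a * z + b)) n powr p)"
    using p' by (intro T.summable_singular_values) auto
  then show ?thesis using volterra_compact by (simp add: schatten_class_def)
qed

text \<open>The operator vanishes, so no nonempty system can satisfy the lower bound in
  \<open>count_bound\<close> and the constant 0 will do. The exponent is halved to leave the gap
  required for summability.\<close>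

lemma volterra_const_schatten:
  assumes "p > 0"
  shows "volterra (\<lambda>z. 0 * z + b) \<in> schatten_class p Fw ipw"
proof -
  let ?T = "volterra (\<lambda>z. 0 * z + b)"
  have q0: "H.q (?T f) = 0" if "f \<in> Fw" for f
    by (simp only: volterra_affine[OF that]) simp
  have cb: "count_bound Fw ipw ?T (p / 2) 0"
    unfolding count_bound_def
  proof (intro allI impI)
    fix \<sigma> :: real and S
    assume "\<sigma> > 0" and V: "S \<subseteq> Fw" and big: "\<forall>e\<in>S. \<sigma>\<^sup>2 \<le> Re (ipw (?T e) (?T e))"
    have "e \<notin> S" for e
    proof
      assume e: "e \<in> S"
      then have "\<sigma>\<^sup>2 \<le> H.q (?T e)" using big unfolding H.q_def by blast
      also have "\<dots> = 0" using e V by (intro q0) blast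
      finally show False using \<open>\<sigma> > 0\<close> by simp
    qed
    then have "S = {}" by blast
    then show "card S * \<sigma> powr (p / 2) \<le> 0" by simp
  qed
  have "summable (\<lambda>n. singular_value Fw ipw ?T n powr p)"
    by (rule T.summable_singular_values[OF cb]) (use assms in auto)
  then show ?thesis using volterra_compact[of 0 b] unfolding schatten_class_def by blast
qed

end

section \<open>Failure of the Hilbert--Schmidt property\<close>

lemma sum_le_nsum:
  assumes "finite I" "inj_on \<phi> I"
  shows "(\<Sum>i\<in>I. g (\<phi> i)) \<le> nsum g"
proof -
  have "(\<Sum>i\<in>I. g (\<phi> i)) = (\<Sum>j\<in>\<phi> ` I. g j)"
    using assms(2) by (simp add: sum.reindex)
  also have "\<dots> = (\<integral>\<^sup>+j. g j \<partial>count_space (\<phi> ` I))"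
    using assms(1) by (simp add: nn_integral_count_space_finite)
  also have "\<dots> = (\<integral>\<^sup>+j. g j * indicator (\<phi> ` I) j \<partial>count_space UNIV)"
    by (simp add: nn_integral_count_space_indicator)
  also have "\<dots> \<le> nsum g" by (intro nn_integral_mono) (auto simp: indicator_def)
  finally show ?thesis .
qed

lemma exp_square_le:
  fixes a \<kappa> x :: real
  assumes "a > 0"
  shows "exp (- a * x\<^sup>2) \<le> exp (\<kappa>\<^sup>2 / (4 * a)) * exp (- \<kappa> * x)"
proof -
  have "0 \<le> (2 * a * x - \<kappa>)\<^sup>2 / (4 * a)" using assms by simp
  also have "\<dots> = a * x\<^sup>2 - \<kappa> * x + \<kappa>\<^sup>2 / (4 * a)"
    using assms by (simp add: power2_eq_square field_simps)
  finally show ?thesis unfolding exp_add[symmetric] by simp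
qed

section \<open>A Bessel family of Gaussian bumps\<close>

context fock_weight begin

text \<open>A normalized kernel of the unweighted Fock space, divided by the root of the local mass:
  \<open>phi (test c)\<close> is a Gaussian centered at c, and the weighted norm is bounded
  independently of c.\<close>

definition test :: "complex \<Rightarrow> cfun" where
  "test c = (\<lambda>u. exp (of_real \<alpha> * cnj c * u - of_real (\<alpha> * (cmod c)\<^sup>2 / 2)) / of_real (sqrt (mass c)))"

lemma entire_test: "entire (test c)"
  unfolding entire_def test_def using mass_pos[of c] by (intro holomorphic_intros) auto

lemma phi_test: "phi (test c) u = exp (- \<alpha> * (cmod (u - c))\<^sup>2) / mass c"
proof -
  have "(cmod (test c u))\<^sup>2 = exp (2 * (\<alpha> * Re (cnj c * u) - \<alpha> * (cmod c)\<^sup>2 / 2)) / mass c"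
    using mass_pos[of c]
    by (simp add: test_def norm_divide norm_exp_eq_Re power_divide mult.assoc flip: exp_double)
  also have "2 * (\<alpha> * Re (cnj c * u) - \<alpha> * (cmod c)\<^sup>2 / 2) = \<alpha> * (cmod u)\<^sup>2 + - \<alpha> * (cmod (u - c))\<^sup>2"
    unfolding cmod_power2 by (simp add: power2_eq_square algebra_simps)
  finally have "phi (test c) u = exp (\<alpha> * (cmod u)\<^sup>2 + - \<alpha> * (cmod (u - c))\<^sup>2) / mass c * exp (- \<alpha> * (cmod u)\<^sup>2)"
    by (simp only: phi_def)
  also have "\<dots> = exp (- \<alpha> * (cmod (u - c))\<^sup>2) * (exp (\<alpha> * (cmod u)\<^sup>2) * exp (- \<alpha> * (cmod u)\<^sup>2)) / mass c"
  proof -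
    have "exp (x + y) / m * t = exp y * (exp x * t) / m" for x y m t :: real by (simp add: exp_add)
    then show ?thesis .
  qed
  also have "exp (\<alpha> * (cmod u)\<^sup>2) * exp (- \<alpha> * (cmod u)\<^sup>2) = 1" by (simp flip: exp_add)
  finally show ?thesis by simp
qed

lemma test_in: "test c \<in> Fw"
proof -
  obtain \<kappa> K where K: "\<kappa> > 0" "K > 0"
    "\<And>c. (\<integral>\<^sup>+z. ennreal (exp (- \<kappa> * cmod (z - c))) \<partial>nu) \<le> ennreal (K * mass c)"
    using exp_kernel_integral by metis
  define A where "A = exp (\<kappa>\<^sup>2 / (4 * \<alpha>)) / mass c"
  have "nrm (test c) \<le> (\<integral>\<^sup>+z. ennreal A * ennreal (exp (- \<kappa> * cmod (z - c))) \<partial>nu)"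
    unfolding nrm_def
  proof (rule nn_integral_mono)
    fix z
    have "phi (test c) z \<le> exp (\<kappa>\<^sup>2 / (4 * \<alpha>)) * exp (- \<kappa> * cmod (z - c)) / mass c"
      unfolding phi_test using exp_square_le[OF \<alpha>] mass_pos[of c] by (intro divide_right_mono) auto
    also have "\<dots> = A * exp (- \<kappa> * cmod (z - c))" by (simp add: A_def)
    finally show "ennreal (phi (test c) z) \<le> ennreal A * ennreal (exp (- \<kappa> * cmod (z - c)))"
      by (subst ennreal_mult''[symmetric]) (auto intro: ennreal_leI)
  qed
  also have "\<dots> = ennreal A * (\<integral>\<^sup>+z. ennreal (exp (- \<kappa> * cmod (z - c))) \<partial>nu)"
    by (intro nn_integral_cmult ennreal_measurable_nu continuous_intros)
  also have "\<dots> \<le> ennreal A * ennreal (K * mass c)" by (intro mult_left_mono K) simp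
  also have "\<dots> < \<infinity>" by (simp add: ennreal_mult_less_top)
  finally show ?thesis using entire_test by (simp add: fock_space_iff)
qed

text \<open>The Gaussian is dominated by an exponential with rate \<kappa> + 1. In the
  Cauchy-Schwarz inequality the part with rate \<kappa> is integrated alone, where its integral
  cancels the normalization by \<open>mass c\<close>, and the part with rate 1 remains with h to
  localize it near c.\<close>

lemma test_inner_bound:
  obtains K where "K > 0" "\<And>h c. h \<in> Fw \<Longrightarrow>
    ennreal ((cmod (ipw (test c) h))\<^sup>2) \<le> ennreal K * (\<integral>\<^sup>+u. ennreal (phi h u) * ennreal (exp (- 1 * cmod (u - c))) \<partial>nu)"
proof -
  obtain \<kappa> K where K: "\<kappa> > 0" "K > 0"
    "\<And>c. (\<integral>\<^sup>+z. ennreal (exp (- \<kappa> * cmod (z - c))) \<partial>nu) \<le> ennreal (K * mass c)"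
    using exp_kernel_integral by metis
  define A where "A = exp ((\<kappa> + 1)\<^sup>2 / (4 * \<alpha>))"
  have A: "A > 0" by (simp add: A_def)
  show ?thesis
  proof (rule that[of "A * K"])
    show "A * K > 0" using A K by simp
    fix h c assume h: "h \<in> Fw"
    have mc: "mass c > 0" by (rule mass_pos)
    define F where "F u = ennreal (sqrt (A / mass c * exp (- \<kappa> * cmod (u - c))))" for u
    define G where "G u = ennreal (sqrt (phi h u * exp (- 1 * cmod (u - c))))" for u
    have cont: "continuous_on UNIV (phi h)" using h by (intro phi_continuous entire_V)
    have Fm: "F \<in> borel_measurable nu" unfolding F_def by (intro ennreal_measurable_nu continuous_intros)
    have Gm: "G \<in> borel_measurable nu" unfolding G_def by (intro ennreal_measurable_nu continuous_intros cont)
    have F2: "F u ^ 2 = ennreal (A / mass c) * ennreal (exp (- \<kappa> * cmod (u - c)))" for u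
    proof -
      have nn: "0 \<le> A / mass c * exp (- \<kappa> * cmod (u - c))" using A mc by simp
      have "F u ^ 2 = ennreal ((sqrt (A / mass c * exp (- \<kappa> * cmod (u - c))))\<^sup>2)"
        unfolding F_def by (rule ennreal_power) (use nn in simp)
      then show ?thesis unfolding real_sqrt_pow2[OF nn] ennreal_mult''[OF exp_ge_zero] .
    qed
    have G2: "G u ^ 2 = ennreal (phi h u) * ennreal (exp (- 1 * cmod (u - c)))" for u
      by (simp add: G_def ennreal_power ennreal_mult'')
    have "ennreal (cmod (ipw (test c) h)) \<le> (\<integral>\<^sup>+u. ennreal (cmod (test c u * cnj (h u) * complex_of_real (exp (- \<alpha> * (cmod u)\<^sup>2) * w u))) \<partial>lebesgue)"
      unfolding fock_inner_def by (intro integral_norm_bound_ennreal fock_inner_integrable test_in h)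
    also have "\<dots> = (\<integral>\<^sup>+u. ennreal (w u) * ennreal (cmod (test c u) * cmod (h u) * exp (- \<alpha> * (cmod u)\<^sup>2)) \<partial>lebesgue)"
    proof (rule nn_integral_cong)
      fix u
      have "cmod (test c u * cnj (h u) * complex_of_real (exp (- \<alpha> * (cmod u)\<^sup>2) * w u)) = w u * (cmod (test c u) * cmod (h u) * exp (- \<alpha> * (cmod u)\<^sup>2))"
        using weight_nonneg[OF weight, of u] by (simp add: norm_mult)
      then show "ennreal (cmod (test c u * cnj (h u) * complex_of_real (exp (- \<alpha> * (cmod u)\<^sup>2) * w u))) = ennreal (w u) * ennreal (cmod (test c u) * cmod (h u) * exp (- \<alpha> * (cmod u)\<^sup>2))"
        using weight_nonneg[OF weight, of u] by (simp only: ennreal_mult')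
    qed
    also have "\<dots> = (\<integral>\<^sup>+u. ennreal (cmod (test c u) * cmod (h u) * exp (- \<alpha> * (cmod u)\<^sup>2)) \<partial>nu)"
    proof -
      have "(\<lambda>u. ennreal (cmod (test c u) * cmod (h u) * exp (- \<alpha> * (cmod u)\<^sup>2))) \<in> borel_measurable nu"
        by (intro ennreal_measurable_nu continuous_intros entire_continuous entire_test entire_V h)
      then have m: "(\<lambda>u. ennreal (cmod (test c u) * cmod (h u) * exp (- \<alpha> * (cmod u)\<^sup>2))) \<in> borel_measurable lebesgue"
        using measurable_cong_sets[OF sets_wmeas refl] by blast
      have mw: "(\<lambda>u. ennreal (w u)) \<in> borel_measurable lebesgue"
        by (rule measurable_compose[OF weight_measurable[OF weight] measurable_ennreal])
      show ?thesis unfolding wmeas_def by (rule nn_integral_density[OF mw m, symmetric])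
    qed
    also have "\<dots> \<le> (\<integral>\<^sup>+u. F u * G u \<partial>nu)"
    proof (rule nn_integral_mono)
      fix u
      let ?x = "cmod (u - c)"
      have "(cmod (test c u) * cmod (h u) * exp (- \<alpha> * (cmod u)\<^sup>2))\<^sup>2 = phi (test c) u * phi h u"
        by (simp add: phi_def power2_eq_square mult_ac)
      also have "\<dots> \<le> (A * exp (- (\<kappa> + 1) * ?x) / mass c) * phi h u"
        unfolding phi_test A_def by (intro mult_right_mono divide_right_mono exp_square_le \<alpha> less_imp_le[OF mc] phi_nonneg)
      also have "exp (- (\<kappa> + 1) * ?x) = exp (- \<kappa> * ?x) * exp (- 1 * ?x)"
        unfolding exp_add[symmetric] by (simp add: algebra_simps)
      also have "A * (exp (- \<kappa> * ?x) * exp (- 1 * ?x)) / mass c * phi h u = (A / mass c * exp (- \<kappa> * ?x)) * (phi h u * exp (- 1 * ?x))"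
        by simp
      finally have "cmod (test c u) * cmod (h u) * exp (- \<alpha> * (cmod u)\<^sup>2) \<le> sqrt ((A / mass c * exp (- \<kappa> * ?x)) * (phi h u * exp (- 1 * ?x)))"
        by (rule real_le_rsqrt)
      then show "ennreal (cmod (test c u) * cmod (h u) * exp (- \<alpha> * (cmod u)\<^sup>2)) \<le> F u * G u"
        unfolding F_def G_def real_sqrt_mult by (subst ennreal_mult''[symmetric]) (auto intro: ennreal_leI)
    qed
    finally have "(ennreal (cmod (ipw (test c) h)))\<^sup>2 \<le> (\<integral>\<^sup>+u. F u * G u \<partial>nu)\<^sup>2"
      by (rule power_mono) simp
    also have "\<dots> \<le> (\<integral>\<^sup>+u. F u ^ 2 \<partial>nu) * (\<integral>\<^sup>+u. G u ^ 2 \<partial>nu)"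
      by (rule Cauchy_Schwarz_nn_integral[OF Fm Gm])
    also have "(\<integral>\<^sup>+u. F u ^ 2 \<partial>nu) = ennreal (A / mass c) * (\<integral>\<^sup>+u. ennreal (exp (- \<kappa> * cmod (u - c))) \<partial>nu)"
      unfolding F2 by (intro nn_integral_cmult ennreal_measurable_nu continuous_intros)
    also have "\<dots> \<le> ennreal (A / mass c) * ennreal (K * mass c)" by (intro mult_left_mono K) simp
    also have "\<dots> = ennreal (A * K)"
      using A K mc by (subst ennreal_mult''[symmetric]) auto
    finally show "ennreal ((cmod (ipw (test c) h))\<^sup>2) \<le> ennreal (A * K) * (\<integral>\<^sup>+u. ennreal (phi h u) * ennreal (exp (- 1 * cmod (u - c))) \<partial>nu)"
      unfolding G2 by (simp add: ennreal_power mult_right_mono)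
  qed
qed

text \<open>The localized bounds sum over the lattice to a multiple of the norm of h, uniformly in
  h. Injectivity of \<phi> ensures that a finite sum is dominated by the sum over the whole
  lattice.\<close>

lemma test_bessel:
  obtains B where "B > 0" "\<And>(I :: 'i set) (\<phi> :: 'i \<Rightarrow> int \<times> int) h. finite I \<Longrightarrow> inj_on \<phi> I \<Longrightarrow> h \<in> Fw \<Longrightarrow>
    (\<Sum>i\<in>I. (cmod (ipw (test (latt r (\<phi> i))) h))\<^sup>2) \<le> B * H.q h"
proof -
  obtain K where K: "K > 0" "\<And>h c. h \<in> Fw \<Longrightarrow>
    ennreal ((cmod (ipw (test c) h))\<^sup>2) \<le> ennreal K * (\<integral>\<^sup>+u. ennreal (phi h u) * ennreal (exp (- 1 * cmod (u - c))) \<partial>nu)"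
    using test_inner_bound by blast
  obtain K1 where K1: "K1 > 0" "\<And>u. nsum (\<lambda>i. ennreal (exp (- 1 * cmod (u - latt r i)))) \<le> ennreal K1"
    using nsum_latt_exp[OF r, of 1] by (metis zero_less_one)
  show ?thesis
  proof (rule that[of "K * K1"])
    show "K * K1 > 0" using K K1 by simp
    fix I :: "'i set" and \<phi> :: "'i \<Rightarrow> int \<times> int" and h assume I: "finite I" "inj_on \<phi> I" and h: "h \<in> Fw"
    have m: "(\<lambda>u. ennreal (phi h u) * ennreal (exp (- 1 * cmod (u - c)))) \<in> borel_measurable nu" for c
      by (intro borel_measurable_times_ennreal ennreal_measurable_nu continuous_intros phi_continuous entire_V h)
    have "nsum (\<lambda>i. \<integral>\<^sup>+u. ennreal (phi h u) * ennreal (exp (- 1 * cmod (u - latt r i))) \<partial>nu)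
        = (\<integral>\<^sup>+u. nsum (\<lambda>i. ennreal (phi h u) * ennreal (exp (- 1 * cmod (u - latt r i)))) \<partial>nu)"
      by (rule nn_integral_count_space_nn_integral[symmetric]) (rule countableI_type, rule m)
    also have "\<dots> = (\<integral>\<^sup>+u. ennreal (phi h u) * nsum (\<lambda>i. ennreal (exp (- 1 * cmod (u - latt r i)))) \<partial>nu)"
      by (intro nn_integral_cong nn_integral_cmult) simp
    also have "\<dots> \<le> (\<integral>\<^sup>+u. ennreal K1 * ennreal (phi h u) \<partial>nu)"
      by (intro nn_integral_mono) (metis K1(2) mult.commute mult_left_mono zero_le)
    also have "\<dots> = ennreal K1 * nrm h"
      unfolding nrm_def by (intro nn_integral_cmult phi_measurable entire_V h)
    finally have int_le: "nsum (\<lambda>i. \<integral>\<^sup>+u. ennreal (phi h u) * ennreal (exp (- 1 * cmod (u - latt r i))) \<partial>nu) \<le> ennreal K1 * nrm h" .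
    have "ennreal (\<Sum>i\<in>I. (cmod (ipw (test (latt r (\<phi> i))) h))\<^sup>2) = (\<Sum>i\<in>I. ennreal ((cmod (ipw (test (latt r (\<phi> i))) h))\<^sup>2))"
      by (rule sum_ennreal[symmetric]) simp
    also have "\<dots> \<le> (\<Sum>i\<in>I. ennreal K * (\<integral>\<^sup>+u. ennreal (phi h u) * ennreal (exp (- 1 * cmod (u - latt r (\<phi> i)))) \<partial>nu))"
      by (intro sum_mono K h)
    also have "\<dots> \<le> nsum (\<lambda>i. ennreal K * (\<integral>\<^sup>+u. ennreal (phi h u) * ennreal (exp (- 1 * cmod (u - latt r i))) \<partial>nu))"
      by (rule sum_le_nsum[OF I])
    also have "\<dots> = ennreal K * nsum (\<lambda>i. \<integral>\<^sup>+u. ennreal (phi h u) * ennreal (exp (- 1 * cmod (u - latt r i))) \<partial>nu)"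
      by (rule nn_integral_cmult) simp
    also have "\<dots> \<le> ennreal K * (ennreal K1 * nrm h)" by (intro mult_left_mono int_le) simp
    also have "\<dots> = ennreal (K * K1 * H.q h)"
      using K(1) K1(1) q_nrm[OF h] by (simp add: ennreal_mult' mult.assoc)
    finally show "(\<Sum>i\<in>I. (cmod (ipw (test (latt r (\<phi> i))) h))\<^sup>2) \<le> K * K1 * H.q h"
      using K(1) K1(1) H.q_nonneg[OF h] by (subst (asm) ennreal_le_iff) simp_all
  qed
qed

lemma prim_test:
  assumes "c \<noteq> 0"
  shows "prim (test c) u = (test c u - test c 0) / (of_real \<alpha> * cnj c)"
proof -
  define g where "g = (\<lambda>u. test c u / (of_real \<alpha> * cnj c))"
  have ne: "of_real \<alpha> * cnj c \<noteq> 0" using \<alpha> assms by simp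
  have "(g has_field_derivative test c x) (at x)" for x
    unfolding g_def test_def using ne mass_pos[of c]
    by (auto intro!: derivative_eq_intros simp: field_simps)
  then have "(test c has_contour_integral (g (pathfinish (linepath 0 u)) - g (pathstart (linepath 0 u)))) (linepath 0 u)"
    by (intro contour_integral_primitive[of UNIV, OF _ valid_path_linepath]) (auto intro: has_field_derivative_at_within)
  then show ?thesis
    unfolding prim_def by (simp add: contour_integral_unique g_def diff_divide_distrib)
qed

text \<open>The primitive is the difference of the values at u and 0 divided by a multiple of
  \<open>cnj c\<close>. Near a distant c the value at 0 is at most half as large as that at u, so
  the subtraction is harmless. Integrating over the square at c cancels \<open>mass c\<close> and
  leaves the inverse square of the modulus of c.\<close>

lemma prim_test_lower:
  obtains R c0 where "R > 0" "c0 > 0" "\<And>c. cmod c \<ge> R \<Longrightarrow> c0 / (cmod c)\<^sup>2 \<le> H.q (prim (test c))"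
proof -
  \<comment> \<open>Guarantees \<open>1 \<le> cmod c\<close> and
    \<open>1 / \<alpha> \<le> cmod c - 2 * r\<close>, whose product gives
    \<open>1 \<le> Re X\<close> below.\<close>
  define R where "R = 2 * r + 1 + 1 / \<alpha>"
  \<comment> \<open>The smallest value of the Gaussian within 2r of c, with 4 from the squared half
    and \<open>\<alpha>\<^sup>2\<close> from the primitive.\<close>
  define c0 where "c0 = exp (- \<alpha> * (2 * r)\<^sup>2) / (4 * \<alpha>\<^sup>2)"
  have R: "R > 0" using r \<alpha> by (simp add: R_def add_pos_pos)
  obtain K where pV: "\<And>f. f \<in> Fw \<Longrightarrow> prim f \<in> Fw"
    using littlewood_paley_V by metis
  show ?thesis
  proof (rule that[OF R])
    show "c0 > 0" using \<alpha> by (simp add: c0_def)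
    fix c assume c: "cmod c \<ge> R"
    have cne: "c \<noteq> 0" using c R by auto
    have mc: "mass c > 0" by (rule mass_pos)
    have low: "c0 / ((cmod c)\<^sup>2 * mass c) \<le> phi (prim (test c)) u" if u: "u \<in> sq r c" for u
    proof -
      have uc: "cmod (u - c) \<le> 2 * r" using u r by (rule dist_sq)
      define X where "X = of_real \<alpha> * cnj c * u"
      have "Re X = \<alpha> * (cmod c)\<^sup>2 + \<alpha> * Re (cnj c * (u - c))"
        unfolding X_def cmod_power2 by (simp add: power2_eq_square algebra_simps)
      moreover have "\<bar>Re (cnj c * (u - c))\<bar> \<le> cmod c * (2 * r)"
        using abs_Re_le_cmod[of "cnj c * (u - c)"] mult_left_mono[OF uc, of "cmod c"] by (simp add: norm_mult)
      then have "\<alpha> * - (cmod c * (2 * r)) \<le> \<alpha> * Re (cnj c * (u - c))"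
        using \<alpha> by (intro mult_left_mono) auto
      ultimately have "\<alpha> * (cmod c * (cmod c - 2 * r)) \<le> Re X"
        by (simp add: power2_eq_square algebra_simps)
      moreover have "1 \<le> \<alpha> * (cmod c * (cmod c - 2 * r))"
      proof -
        have "1 * (1 / \<alpha>) \<le> cmod c * (cmod c - 2 * r)"
        proof (rule mult_mono)
          have "0 \<le> 1 / \<alpha>" using \<alpha> by simp
          then show "1 \<le> cmod c" "1 / \<alpha> \<le> cmod c - 2 * r" using c r unfolding R_def by linarith+
        qed (use \<alpha> in auto)
        then have "\<alpha> * (1 / \<alpha>) \<le> \<alpha> * (cmod c * (cmod c - 2 * r))" using \<alpha> by (intro mult_left_mono) auto
        then show ?thesis using \<alpha> by simp
      qed
      ultimately have "1 \<le> Re X" by linarith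
      then have "2 \<le> exp (Re X)" using exp_ge_add_one_self[of "Re X"] by linarith
      then have "2 \<le> cmod (exp X)" by (simp add: norm_exp_eq_Re)
      then have half: "cmod (exp X) / 2 \<le> cmod (exp X - 1)"
        using norm_triangle_ineq2[of "exp X" 1] by simp
      define E where "E = exp (- of_real (\<alpha> * (cmod c)\<^sup>2 / 2)) / complex_of_real (sqrt (mass c))"
      have tu: "test c u = exp X * E" "test c 0 = E"
        unfolding test_def X_def E_def diff_conv_add_uminus exp_add by simp_all
      have "cmod (test c u) / 2 = cmod (exp X) / 2 * cmod E" by (simp add: tu norm_mult)
      also have "\<dots> \<le> cmod (exp X - 1) * cmod E" by (intro mult_right_mono half) simp
      also have "\<dots> = cmod (test c u - test c 0)" by (simp add: tu algebra_simps flip: norm_mult)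
      also have "\<dots> = cmod (prim (test c) u) * (\<alpha> * cmod c)"
        unfolding prim_test[OF cne] using \<alpha> cne by (simp add: norm_divide norm_mult)
      finally have "(cmod (test c u) / 2)\<^sup>2 \<le> (cmod (prim (test c) u) * (\<alpha> * cmod c))\<^sup>2"
        by (intro power_mono) auto
      then have "(cmod (test c u))\<^sup>2 / 4 * exp (- \<alpha> * (cmod u)\<^sup>2) \<le> (cmod (prim (test c) u))\<^sup>2 * (\<alpha> * cmod c)\<^sup>2 * exp (- \<alpha> * (cmod u)\<^sup>2)"
        by (intro mult_right_mono) (simp_all add: power_divide power_mult_distrib)
      then have "phi (test c) u / 4 \<le> phi (prim (test c)) u * (\<alpha> * cmod c)\<^sup>2"
        by (simp add: phi_def mult_ac)
      then have "phi (test c) u / (4 * (\<alpha> * cmod c)\<^sup>2) \<le> phi (prim (test c)) u"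
        using \<alpha> cne by (simp add: field_simps)
      moreover have "exp (- \<alpha> * (2 * r)\<^sup>2) / mass c \<le> phi (test c) u"
        unfolding phi_test using power_mono[OF uc norm_ge_zero, of 2] \<alpha> mc
        by (intro divide_right_mono) simp_all
      then have "exp (- \<alpha> * (2 * r)\<^sup>2) / mass c / (4 * (\<alpha> * cmod c)\<^sup>2) \<le> phi (test c) u / (4 * (\<alpha> * cmod c)\<^sup>2)"
        by (intro divide_right_mono) auto
      moreover have "exp (- \<alpha> * (2 * r)\<^sup>2) / mass c / (4 * (\<alpha> * cmod c)\<^sup>2) = c0 / ((cmod c)\<^sup>2 * mass c)"
        by (simp add: c0_def power_mult_distrib mult_ac)
      ultimately show ?thesis by linarith
    qed
    have c0p: "c0 > 0" using \<alpha> by (simp add: c0_def)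
    have "ennreal (c0 / (cmod c)\<^sup>2) = ennreal (c0 / ((cmod c)\<^sup>2 * mass c)) * emeasure nu (sq r c)"
      unfolding emeasure_sq using mc c0p by (subst ennreal_mult''[symmetric]) auto
    also have "\<dots> = (\<integral>\<^sup>+u. ennreal (c0 / ((cmod c)\<^sup>2 * mass c)) * indicator (sq r c) u \<partial>nu)"
      by (rule nn_integral_cmult_indicator[symmetric]) simp
    also have "\<dots> \<le> nrm (prim (test c))"
      unfolding nrm_def using low by (intro nn_integral_mono) (auto simp: indicator_def ennreal_leI)
    also have "\<dots> = ennreal (H.q (prim (test c)))" by (rule q_nrm[OF pV[OF test_in], symmetric])
    finally show "c0 / (cmod c)\<^sup>2 \<le> H.q (prim (test c))"
      using H.q_nonneg[OF pV[OF test_in]] by (simp add: ennreal_le_iff)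
  qed
qed

text \<open>The column with abscissa m in a sector of the lattice holds m points of modulus
  comparable to m, each contributing at least a constant over \<open>m\<^sup>2\<close>. Summed over
  columns this is the harmonic series, while the Bessel bound would keep it finite.\<close>

lemma volterra_not_hilbert_schmidt:
  assumes a: "a \<noteq> 0"
  shows "\<not> hilbert_schmidt Fw ipw (volterra (\<lambda>z. a * z + b))"
proof
  let ?T = "volterra (\<lambda>z. a * z + b)"
  assume "hilbert_schmidt Fw ipw ?T"
  then have sm: "summable (\<lambda>n. singular_value Fw ipw ?T n powr 2)"
    by (simp add: hilbert_schmidt_def schatten_class_def)
  \<comment> \<open>Any exponent above 2 would do; it only serves to exclude degenerate singular
    values.\<close>
  obtain C0 where cb: "count_bound Fw ipw ?T 3 C0" using volterra_count_bound[of 3 a b] by auto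
  interpret CF: compact_form Fw ipw ?T 3 C0
  proof
    show "compact_operator Fw ipw ?T" by (rule volterra_compact)
    show "count_bound Fw ipw ?T 3 C0" by (rule cb)
    show "\<exists>g\<in>Fw. (\<lambda>n. Re (ipw (f n - g) (f n - g))) \<longlonglongrightarrow> 0"
      if "\<And>n. f n \<in> Fw" "\<And>\<epsilon>. \<epsilon> > 0 \<Longrightarrow> \<exists>N. \<forall>m\<ge>N. \<forall>n\<ge>N. Re (ipw (f m - f n) (f m - f n)) < \<epsilon>" for f :: "nat \<Rightarrow> cfun"
      using that by (rule fock_complete)
  qed simp
  have sm2: "summable (\<lambda>n. (singular_value Fw ipw ?T n)\<^sup>2)"
    using sm T.singular_value_nonneg[OF cb] by simp
  obtain B where B: "B > 0" "\<And>(I :: (nat \<times> nat) set) \<phi> h. finite I \<Longrightarrow> inj_on \<phi> I \<Longrightarrow> h \<in> Fw \<Longrightarrow>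
    (\<Sum>i\<in>I. (cmod (ipw (test (latt r (\<phi> i))) h))\<^sup>2) \<le> B * H.q h"
    using test_bessel[where 'i = "nat \<times> nat"] by blast
  obtain R c0 where R: "R > 0" "c0 > 0" "\<And>c. cmod c \<ge> R \<Longrightarrow> c0 / (cmod c)\<^sup>2 \<le> H.q (prim (test c))"
    using prim_test_lower by metis
  obtain K where pV: "\<And>f. f \<in> Fw \<Longrightarrow> prim f \<in> Fw"
    using littlewood_paley_V by metis
  define \<phi> where "\<phi> = (\<lambda>(m, n). (int m, int n))"
  \<comment> \<open>From this column on every lattice point has modulus at least R, and m is
    positive.\<close>
  define M0 where "M0 = nat \<lceil>R / r\<rceil> + 1"
  define Z where "Z = B * (\<Sum>n. (singular_value Fw ipw ?T n)\<^sup>2)"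
  \<comment> \<open>In the sector the squared modulus of a point in column m is at most
    \<open>2 * r\<^sup>2 * (real m)\<^sup>2\<close>.\<close>
  define c1 where "c1 = (cmod a)\<^sup>2 * c0 / (2 * r\<^sup>2)"
  have c1: "c1 > 0" using a R r by (simp add: c1_def)
  have bound: "(\<Sum>m\<in>{M0..<N}. c1 * inverse (real m)) \<le> Z" for N
  proof -
    \<comment> \<open>The sector of points with 0 \<le> n < m, so that column m has exactly m
      points.\<close>
    define I where "I = Sigma {M0..<N} (\<lambda>m. {0..<m})"
    have I: "finite I" "inj_on \<phi> I" by (auto simp: I_def \<phi>_def inj_on_def)
    have "(\<Sum>i\<in>I. H.q (?T (test (latt r (\<phi> i))))) \<le> Z"
      unfolding Z_def
    proof (rule CF.hilbert_schmidt_bessel[OF sm2 I(1)])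
      show "test (latt r (\<phi> i)) \<in> Fw" for i by (rule test_in)
      show "(\<Sum>i\<in>I. (cmod (ipw (test (latt r (\<phi> i))) h))\<^sup>2) \<le> B * H.q h" if "h \<in> Fw" for h
        by (rule B(2)[OF I that])
    qed (use B in simp)
    moreover have "c1 * inverse ((real m)\<^sup>2) \<le> H.q (?T (test (latt r (\<phi> (m, n)))))" if "(m, n) \<in> I" for m n
    proof -
      let ?c = "latt r (\<phi> (m, n))"
      have mn: "M0 \<le> m" "n \<le> m" "m > 0" using that by (auto simp: I_def M0_def)
      have "R / r \<le> M0" unfolding M0_def using real_nat_ceiling_ge[of "R / r"] by simp
      then have "R / r \<le> m" using mn(1) by linarith
      then have "R \<le> m * r" using r by (simp add: field_simps)
      also have "\<dots> \<le> cmod ?c" using abs_Re_le_cmod[of ?c] r by (simp add: latt_def \<phi>_def)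
      finally have Rc: "R \<le> cmod ?c" .
      have "(cmod ?c)\<^sup>2 = (m * r)\<^sup>2 + (n * r)\<^sup>2" by (simp add: latt_def \<phi>_def cmod_power2)
      also have "\<dots> \<le> (m * r)\<^sup>2 + (m * r)\<^sup>2"
        using mn r by (intro add_left_mono power_mono mult_right_mono) auto
      finally have "(cmod ?c)\<^sup>2 \<le> 2 * r\<^sup>2 * (real m)\<^sup>2" by (simp add: power_mult_distrib mult_ac)
      then have "c0 / (2 * r\<^sup>2 * (real m)\<^sup>2) \<le> c0 / (cmod ?c)\<^sup>2"
        using R Rc r mn by (intro divide_left_mono) (auto intro!: mult_pos_pos)
      also have "\<dots> \<le> H.q (prim (test ?c))" by (rule R(3)[OF Rc])
      finally have "(cmod a)\<^sup>2 * (c0 / (2 * r\<^sup>2 * (real m)\<^sup>2)) \<le> (cmod a)\<^sup>2 * H.q (prim (test ?c))"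
        by (intro mult_left_mono) auto
      also have "\<dots> = H.q (?T (test ?c))"
        unfolding volterra_affine[OF test_in] by (rule H.q_scale[OF pV[OF test_in], symmetric])
      finally have le: "(cmod a)\<^sup>2 * (c0 / (2 * r\<^sup>2 * (real m)\<^sup>2)) \<le> H.q (?T (test ?c))" .
      have "c1 * inverse ((real m)\<^sup>2) = (cmod a)\<^sup>2 * (c0 / (2 * r\<^sup>2 * (real m)\<^sup>2))"
        unfolding c1_def inverse_eq_divide by simp
      with le show ?thesis by (simp only:)
    qed
    then have "(\<Sum>(m, n)\<in>I. c1 * inverse ((real m)\<^sup>2)) \<le> (\<Sum>i\<in>I. H.q (?T (test (latt r (\<phi> i)))))"
      by (intro sum_mono) auto
    moreover have "(\<Sum>(m, n)\<in>I. c1 * inverse ((real m)\<^sup>2)) = (\<Sum>m\<in>{M0..<N}. \<Sum>n\<in>{0..<m}. c1 * inverse ((real m)\<^sup>2))"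
      unfolding I_def by (rule sum.Sigma[symmetric]) auto
    moreover have "\<dots> = (\<Sum>m\<in>{M0..<N}. c1 * inverse (real m))"
      by (intro sum.cong) (auto simp: power2_eq_square inverse_eq_divide)
    ultimately show ?thesis by linarith
  qed
  have "summable (\<lambda>m. c1 * inverse (real (m + M0)))"
  proof (rule summableI_nonneg_bounded)
    show "0 \<le> c1 * inverse (real (m + M0))" for m using c1 by simp
    show "(\<Sum>m<N. c1 * inverse (real (m + M0))) \<le> Z" for N
    proof -
      have "(\<Sum>m<N. c1 * inverse (real (m + M0))) = (\<Sum>m\<in>{0 + M0..<N + M0}. c1 * inverse (real m))"
        by (simp only: sum.shift_bounds_nat_ivl atLeast0LessThan[symmetric])
      then show ?thesis using bound[of "N + M0"] by simp
    qed
  qed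
  then have "summable (\<lambda>m. inverse (real (m + M0)))" using c1 by (simp add: summable_cmult_iff)
  then have "summable (\<lambda>m. inverse (real m))" using summable_iff_shift[of "\<lambda>m. inverse (real m)" M0] by blast
  then show False using not_summable_harmonic[where 'a = real] by simp
qed

end

theorem corollary6p1:
  fixes \<alpha> :: real and w :: "complex \<Rightarrow> real" and a b :: complex and g :: "complex \<Rightarrow> complex"
  assumes "\<alpha> > 0"
    and "w \<in> A_infinity_restricted"
    and "g = (\<lambda>z. a * z + b)"
  shows "(\<forall>p>2. volterra g \<in> schatten_class p (fock_space \<alpha> w) (fock_inner \<alpha> w)) \<and>
         (hilbert_schmidt (fock_space \<alpha> w) (fock_inner \<alpha> w) (volterra g) \<longleftrightarrow> a = 0)"
proof -
  obtain r k C where "comparison_weight w r k C"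
    by (rule A_infinity_comparison[OF assms(2)])
  then interpret fock_weight w r k C \<alpha>
    using assms(1) by (simp add: fock_weight_def fock_weight_axioms_def)
  show ?thesis
    unfolding assms(3)
    using volterra_schatten[of _ a b] volterra_not_hilbert_schmidt[of a b] volterra_const_schatten[of 2 b]
    by (auto simp: hilbert_schmidt_def)
qed

end
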